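(* Let $p\ge 3$, $q\ge 3$ and $r\ge 2$ be integers. The graph $d(p,q,r)$ is determined by its Laplacian permanental polynomial; that is, for every graph $H$, if $\pi(L(H);x)=\pi(L(d(p,q,r));x)$ then $H$ is isomorphic to $d(p,q,r)$.
   Context: All graphs are finite, simple and undirected (not necessarily connected). For a graph $G$ with vertices $v_1,\dots,v_n$, let $A(G)$ be its $(0,1)$-adjacency matrix, $D(G)=\mathrm{diag}(d(v_1),\dots,d(v_n))$ the diagonal matrix of vertex degrees, and $L(G)=D(G)-A(G)$ the Laplacian matrix. The permanent of an $n\times n$ matrix $X=(x_{ij})$ is $\mathrm{per}(X)=\sum_{\sigma}\prod_{i=1}^n x_{i\sigma(i)}$, the sum being over all permutations $\sigma$ of $\{1,\dots,n\}$. The Laplacian permanental polynomial of $G$ is $\pi(L(G);x)=\mathrm{per}(xI-L(G))$, where $I$ is the $n\times n$ identity matrix. $C_n$ and $P_n$ denote the cycle and the path on $n$ vertices. The graph $d(p,q,r)$ is obtained from vertex-disjoint copies of the cycles $C_p$ ($p\ge 3$), $C_q$ ($q\ge 3$) and the path $P_r$ by identifying one end vertex of $P_r$ with a vertex of $C_p$ and the other (different) end vertex of $P_r$ with a vertex of $C_q$. *)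

theory Defs
  imports
    "HOL-Combinatorics.Permutations"
    "HOL-Computational_Algebra.Polynomial"
    "Graph_Theory.Pair_Digraph"
    "Graph_Theory.Digraph_Isomorphism"
begin

text \<open>A finite simple undirected graph is a \<^locale>\<open>pair_graph\<close>: an edge \<open>uv\<close> is represented by
  the two arcs \<open>(u, v)\<close> and \<open>(v, u)\<close>, so the degree of a vertex is its out-degree. Square matrices
  whose rows and columns are indexed by the vertices are functions on pairs of vertices; only
  their values on the vertex set matter.\<close>

definition adjacency_matrix :: "'a pair_pre_digraph \<Rightarrow> 'a \<Rightarrow> 'a \<Rightarrow> int" where
  "adjacency_matrix G u v = (if (u, v) \<in> parcs G then 1 else 0)"

definition degree_matrix :: "'a pair_pre_digraph \<Rightarrow> 'a \<Rightarrow> 'a \<Rightarrow> int" where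
  "degree_matrix G u v = (if u = v then int (out_degree (with_proj G) u) else 0)"

definition laplacian_matrix :: "'a pair_pre_digraph \<Rightarrow> 'a \<Rightarrow> 'a \<Rightarrow> int" where
  "laplacian_matrix G u v = degree_matrix G u v - adjacency_matrix G u v"

definition permanent :: "'a set \<Rightarrow> ('a \<Rightarrow> 'a \<Rightarrow> 'b::comm_ring_1) \<Rightarrow> 'b" where
  "permanent V X = (\<Sum>\<sigma> | \<sigma> permutes V. \<Prod>v\<in>V. X v (\<sigma> v))"

definition laplacian_permanental_poly :: "'a pair_pre_digraph \<Rightarrow> int poly" where
  "laplacian_permanental_poly G =
     permanent (pverts G) (\<lambda>u v. (if u = v then [:0, 1:] else 0) - [:laplacian_matrix G u v:])"

text \<open>\<open>path_graph a n\<close> and \<open>cycle_graph a n\<close> are \<open>P\<^sub>n\<close> and (for \<open>n \<ge> 3\<close>) \<open>C\<^sub>n\<close> on the consecutive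
  labels \<open>a, \<dots>, a + n - 1\<close>; the offset \<open>a\<close> is used to glue copies along common labels.\<close>

definition path_graph :: "nat \<Rightarrow> nat \<Rightarrow> nat pair_pre_digraph" where
  "path_graph a n = \<lparr> pverts = {a..<a + n},
     parcs = {(i, j). i \<in> {a..<a + n} \<and> j \<in> {a..<a + n} \<and> (j = Suc i \<or> i = Suc j)} \<rparr>"

definition cycle_graph :: "nat \<Rightarrow> nat \<Rightarrow> nat pair_pre_digraph" where
  "cycle_graph a n = \<lparr> pverts = pverts (path_graph a n),
     parcs = parcs (path_graph a n) \<union> {(a, a + n - 1), (a + n - 1, a)} \<rparr>"

definition pair_union :: "'a pair_pre_digraph \<Rightarrow> 'a pair_pre_digraph \<Rightarrow> 'a pair_pre_digraph" where
  "pair_union G H = \<lparr> pverts = pverts G \<union> pverts H, parcs = parcs G \<union> parcs H \<rparr>"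

text \<open>The graph \<open>d(p, q, r)\<close>. For \<open>p, q \<ge> 3\<close> and \<open>r \<ge> 2\<close> the path, on the labels
  \<open>p - 1, \<dots>, p + r - 2\<close>, meets the first cycle only in its end vertex \<open>p - 1\<close> and the second cycle
  only in its end vertex \<open>p + r - 2\<close>, and the two cycles are disjoint.\<close>

definition dumbbell_graph :: "nat \<Rightarrow> nat \<Rightarrow> nat \<Rightarrow> nat pair_pre_digraph" where
  "dumbbell_graph p q r =
     pair_union (pair_union (cycle_graph 0 p) (path_graph (p - 1) r)) (cycle_graph (p + r - 2) q)"

lemma dumbbell_intersections:
  assumes "p \<ge> 3" "q \<ge> 3" "r \<ge> 2"
  shows "pverts (cycle_graph 0 p) \<inter> pverts (path_graph (p - 1) r) = {p - 1}"
    and "pverts (path_graph (p - 1) r) \<inter> pverts (cycle_graph (p + r - 2) q) = {p + r - 2}"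
    and "pverts (cycle_graph 0 p) \<inter> pverts (cycle_graph (p + r - 2) q) = {}"
  using assms by (auto simp: path_graph_def cycle_graph_def)

lemma pair_graph_dumbbell_graph:
  assumes "p \<ge> 3" "q \<ge> 3" "r \<ge> 2"
  shows "pair_graph (dumbbell_graph p q r)"
proof -
  let ?G = "dumbbell_graph p q r"
  have wf: "fst e \<in> pverts ?G \<and> snd e \<in> pverts ?G \<and> fst e \<noteq> snd e" if "e \<in> parcs ?G" for e
    using that assms
    by (auto simp: dumbbell_graph_def pair_union_def cycle_graph_def path_graph_def)
  have fin: "finite (pverts ?G)"
    by (simp add: dumbbell_graph_def pair_union_def cycle_graph_def path_graph_def)
  have "parcs ?G \<subseteq> pverts ?G \<times> pverts ?G"
    using wf by fastforce
  then have "finite (parcs ?G)"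
    using fin by (meson finite_SigmaI finite_subset)
  moreover have "sym (parcs ?G)"
    unfolding dumbbell_graph_def pair_union_def cycle_graph_def path_graph_def pair_pre_digraph.simps
    by (intro sym_Un symI) (simp_all, blast+)
  then have "symmetric (with_proj ?G)"
    by (simp add: symmetric_def arcs_ends_def arc_to_ends_def)
  ultimately show ?thesis
    using wf fin by unfold_locales auto
qed

end

theory Submission
  imports Defs "HOL-Computational_Algebra.Primes"
begin

text \<open>The coefficients of \<open>x\<^sup>n\<^sup>-\<^sup>1\<close> and \<open>x\<^sup>n\<^sup>-\<^sup>2\<close> determine the sum of the degrees and of their squares,
  so a graph \<open>H\<close> with the polynomial of \<open>d(p, q, r)\<close> has two vertices of degree 3 and all others of
  degree 2. Hence \<open>H\<close> is a dumbbell \<open>d(a, b, s)\<close> or a theta graph, together with disjoint cycles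
  \<open>C\<^sub>k\<close>. With the substitution \<open>x - 2 = 1/w - w\<close> the permanents of paths become geometric, and
  \<open>w\<^sup>n (1 + w\<^sup>2)\<^sup>3 \<pi>\<close> becomes an explicit integer polynomial in \<open>w\<close>, the product of a core
  polynomial and of \<open>1 + 2 w\<^sup>k + (- w\<^sup>2)\<^sup>k\<close> for every additional cycle. Modulo 2 these polynomials are
  squares of products of simple factors, which yields parity relations between the cycle lengths and
  the path lengths; comparing in addition the first four coefficients above the order of the shortest
  cycle excludes theta graphs and additional cycles and identifies \<open>a, b, s\<close>.\<close>

text \<open>Off the diagonal \<open>x I - L\<close> has only nonnegative entries, so path permanents
  satisfy a recurrence with characteristic roots \<open>1/w\<close> and \<open>-w\<close>; their
  product -1 is the source of the signs in \<open>(- w^2)^k\<close>. The obstacle is interference: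
  over the integers a cycle of length \<open>k\<close> first shows at order \<open>k\<close>, with
  an even coefficient, but a path with \<open>r\<close> vertices first shows at order
  \<open>2 r\<close>, with coefficient 1 or -1, and may disturb the comparison of cycles. Square
  roots modulo 2 resolve this, because there the path shows already at order \<open>r\<close>: path
  orders are matched before they reach the integer coefficients in question. Four coefficients are
  needed because of \<open>pD / pA = 1 + w - 2 w^3 + ...\<close>: a lollipop cycle enters with the
  factor \<open>2 pA pD\<close>, a cycle component with \<open>2 pA^2\<close>, so imitating an
  unmatched lollipop cycle of length \<open>g\<close> by components would take -2 components of
  length \<open>g + 3\<close>. Theta cycles enter with \<open>2 pD^2\<close>. The hard theta case
  has two equal paths of even length \<open>l\<close> and \<open>g = 2 l\<close>: modulo 2 the theta
  then factors like a cycle times a path, and exact factorisations or further orders of the root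
  have to decide.\<close>

section \<open>Permanents: row expansion, block structure and cofactors\<close>

lemma permanent_cong:
  assumes "\<And>u v. u \<in> V \<Longrightarrow> v \<in> V \<Longrightarrow> X u v = Y u v"
  shows "permanent V X = permanent V Y"
  unfolding permanent_def
proof (rule sum.cong[OF refl], rule prod.cong[OF refl])
  fix p v assume "p \<in> {p. p permutes V}" "v \<in> V"
  then show "X v (p v) = Y v (p v)"
    using permutes_in_image[of p V v] by (intro assms) simp_all
qed

lemma permanent_empty [simp]: "permanent {} X = 1"
  by (simp add: permanent_def)

text \<open>Every permutation of \<open>insert a S\<close> is a permutation of \<open>S\<close>
  followed by the transposition of \<open>a\<close> with the image \<open>b\<close> of
  \<open>a\<close>. The minor without row \<open>a\<close> and column \<open>b\<close> therefore
  stays indexed by \<open>S\<close>: column \<open>a\<close> takes the place of column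
  \<open>b\<close>.\<close>

lemma permanent_insert:
  assumes "finite S" "a \<notin> S"
  shows "permanent (insert a S) X = X a a * permanent S X +
     (\<Sum>b\<in>S. X a b * permanent S (\<lambda>u v. if v = b then X u a else X u v))"
proof -
  have *: "(\<Sum>q | q permutes S. \<Prod>v\<in>insert a S. X v ((transpose a b \<circ> q) v)) =
      X a b * permanent S (\<lambda>u v. if v = b then X u a else X u v)" if "b \<in> S" for b
    unfolding permanent_def sum_distrib_left
  proof (rule sum.cong[OF refl])
    fix q assume "q \<in> {q. q permutes S}"
    then have q: "q permutes S" by simp
    have qa: "q a = a" using q assms(2) by (simp add: permutes_def)
    have "(\<Prod>v\<in>S. X v (transpose a b (q v))) = (\<Prod>v\<in>S. if q v = b then X v a else X v (q v))"
    proof (rule prod.cong[OF refl])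
      fix v assume "v \<in> S"
      then have "q v \<in> S" using q by (simp add: permutes_in_image)
      then have "q v \<noteq> a" using assms(2) by auto
      then show "X v (transpose a b (q v)) = (if q v = b then X v a else X v (q v))"
        by (auto simp: transpose_def)
    qed
    then show "(\<Prod>v\<in>insert a S. X v ((transpose a b \<circ> q) v)) =
        X a b * (\<Prod>v\<in>S. if q v = b then X v a else X v (q v))"
      using assms qa by simp
  qed
  have **: "(\<Sum>q | q permutes S. \<Prod>v\<in>insert a S. X v ((transpose a a \<circ> q) v)) = X a a * permanent S X"
    unfolding permanent_def sum_distrib_left
    by (rule sum.cong[OF refl]) (use assms in \<open>auto simp: permutes_def\<close>)
  show ?thesis
    unfolding permanent_def[of "insert a S"] sum_over_permutations_insert[OF assms]
    using assms * ** by simp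
qed

lemma permanent_row_zero:
  assumes "finite V" "a \<in> V" "\<And>b. b \<in> V \<Longrightarrow> X a b = 0"
  shows "permanent V X = 0"
  unfolding permanent_def
proof (rule sum.neutral, intro ballI)
  fix p assume "p \<in> {p. p permutes V}"
  then have "p a \<in> V" using assms(2) by (simp add: permutes_in_image)
  then show "(\<Prod>v\<in>V. X v (p v)) = 0" using assms by (intro prod_zero) auto
qed

lemma permanent_row_unit:
  assumes "finite S" "a \<notin> S" "\<And>b. b \<in> S \<Longrightarrow> X a b = 0"
  shows "permanent (insert a S) X = X a a * permanent S X"
  unfolding permanent_insert[OF assms(1,2)] using assms(3) by simp

lemma permanent_linear_row:
  assumes "finite V" "a \<in> V"
  shows "permanent V (X(a := \<lambda>v. f v + c * g v)) =
    permanent V (X(a := f)) + c * permanent V (X(a := g))"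
proof -
  have *: "(\<Prod>v\<in>V. (X(a := h)) v (p v)) = h (p a) * (\<Prod>v\<in>V-{a}. X v (p v))" for h p
    using assms by (simp add: prod.remove[of V a])
  show ?thesis unfolding permanent_def *
    by (simp add: sum_distrib_left ring_distribs sum.distrib mult.assoc)
qed

text \<open>Expanding a row of the first block only overwrites columns of that block, so the zero
  block and the second factor survive. The induction has to generalise the matrix because each
  expansion changes it.\<close>

lemma permanent_Un:
  assumes "finite S" "finite T" "S \<inter> T = {}"
    "\<And>u v. u \<in> S \<Longrightarrow> v \<in> T \<Longrightarrow> X u v = 0"
  shows "permanent (S \<union> T) X = permanent S X * permanent T X"
  using assms
proof (induction S arbitrary: X rule: finite_induct)
  case (insert a S)
  have dis: "S \<inter> T = {}" "a \<notin> T"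
    using insert.prems(2) by blast+
  have "permanent (insert a S \<union> T) X = X a a * permanent (S \<union> T) X +
     (\<Sum>b\<in>S\<union>T. X a b * permanent (S\<union>T) (\<lambda>u v. if v = b then X u a else X u v))"
    unfolding Un_insert_left by (rule permanent_insert) (use insert.hyps insert.prems(1) dis in auto)
  also have "(\<Sum>b\<in>S\<union>T. X a b * permanent (S\<union>T) (\<lambda>u v. if v = b then X u a else X u v)) =
     (\<Sum>b\<in>S. X a b * permanent (S\<union>T) (\<lambda>u v. if v = b then X u a else X u v))"
    by (rule sum.mono_neutral_right) (use insert.hyps(1) insert.prems(1,3) in auto)
  also have "\<dots> = (\<Sum>b\<in>S. X a b * (permanent S (\<lambda>u v. if v = b then X u a else X u v) * permanent T X))"
  proof (rule sum.cong[OF refl])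
    fix b assume b: "b \<in> S"
    have "permanent (S\<union>T) (\<lambda>u v. if v = b then X u a else X u v) =
       permanent S (\<lambda>u v. if v = b then X u a else X u v) * permanent T (\<lambda>u v. if v = b then X u a else X u v)"
    proof (rule insert.IH)
      fix u v assume "u \<in> S" "v \<in> T"
      then show "(if v = b then X u a else X u v) = 0"
        using b dis insert.prems(3)[of u v] by (metis IntI empty_iff insertI2)
    qed (use insert.prems dis in blast)+
    also have "permanent T (\<lambda>u v. if v = b then X u a else X u v) = permanent T X"
      by (rule permanent_cong) (use b dis in auto)
    finally show "X a b * permanent (S\<union>T) (\<lambda>u v. if v = b then X u a else X u v) =
      X a b * (permanent S (\<lambda>u v. if v = b then X u a else X u v) * permanent T X)" by simp
  qed
  also have "permanent (S \<union> T) X = permanent S X * permanent T X"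
    by (rule insert.IH) (use insert.prems(1,3) dis in blast)+
  also have "X a a * (permanent S X * permanent T X) + (\<Sum>b\<in>S. X a b *
      (permanent S (\<lambda>u v. if v = b then X u a else X u v) * permanent T X)) =
      permanent (insert a S) X * permanent T X"
    unfolding permanent_insert[OF insert.hyps] distrib_right sum_distrib_right by (simp only: mult.assoc)
  finally show ?case .
qed simp

text \<open>The permanental cofactor of the entry \<open>(u, w)\<close>: only permutations sending
  \<open>u\<close> to \<open>w\<close> survive, and that entry counts as 1. Overwriting a row avoids
  minors whose rows and columns have different index sets.\<close>

definition arc_permanent :: "'a set \<Rightarrow> ('a \<Rightarrow> 'a \<Rightarrow> 'b::comm_ring_1) \<Rightarrow> 'a \<Rightarrow> 'a \<Rightarrow> 'b" where
  "arc_permanent V X u w = permanent V (X(u := \<lambda>v. of_bool (v = w)))"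

lemma permanent_insert_row_unit_vector:
  assumes "finite S" "a \<notin> S" "w \<in> S" "\<And>b. b \<in> S \<Longrightarrow> X a b = of_bool (b = w)"
  shows "permanent (insert a S) X = X a a * permanent S X + permanent S (\<lambda>u v. if v = w then X u a else X u v)"
proof -
  have "(\<Sum>b\<in>S. X a b * permanent S (\<lambda>u v. if v = b then X u a else X u v)) =
      (\<Sum>b\<in>S. if b = w then permanent S (\<lambda>u v. if v = b then X u a else X u v) else 0)"
    by (rule sum.cong) (auto simp: assms(4))
  also have "\<dots> = permanent S (\<lambda>u v. if v = w then X u a else X u v)"
    using assms by (simp add: sum.delta)
  finally show ?thesis by (simp only: permanent_insert[OF assms(1,2)])
qed

lemma arc_permanent_self:
  assumes "finite V" "u \<in> V"
  shows "arc_permanent V X u u = permanent (V - {u}) X"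
proof -
  have "arc_permanent V X u u = permanent (insert u (V - {u})) (X(u := \<lambda>v. of_bool (v = u)))"
    using assms by (simp add: arc_permanent_def insert_absorb)
  also have "\<dots> = permanent (V - {u}) (X(u := \<lambda>v. of_bool (v = u)))"
    by (subst permanent_row_unit) (use assms in auto)
  also have "\<dots> = permanent (V - {u}) X"
    by (rule permanent_cong) auto
  finally show ?thesis .
qed

text \<open>A column \<open>w\<close> supported in row \<open>u\<close> selects the same
  permutations, those with \<open>p u = w\<close>, as a unit row at \<open>u\<close>. This turns the
  overwritten columns of \<open>permanent_insert\<close> back into cofactors.\<close>

lemma permanent_col_unit_vector:
  assumes "finite V" "u \<in> V" "w \<in> V"
  shows "permanent V (\<lambda>v z. if z = w then (if v = u then c else 0) else X v z) = c * arc_permanent V X u w"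
  unfolding permanent_def arc_permanent_def sum_distrib_left
proof (rule sum.cong[OF refl])
  fix p assume "p \<in> {p. p permutes V}"
  then have p: "p permutes V" by simp
  have R: "(\<Prod>v\<in>V. (X(u := \<lambda>v. of_bool (v = w))) v (p v)) = of_bool (p u = w) * (\<Prod>v\<in>V-{u}. X v (p v))"
    using assms by (subst prod.remove[of V u]) (auto intro!: prod.cong)
  show "(\<Prod>v\<in>V. if p v = w then (if v = u then c else 0) else X v (p v)) =
      c * (\<Prod>v\<in>V. (X(u := \<lambda>v. of_bool (v = w))) v (p v))"
  proof (cases "p u = w")
    case True
    have "p v \<noteq> w" if "v \<noteq> u" for v
      using True that permutes_inj[OF p] by (metis injD)
    then have "(\<Prod>v\<in>V-{u}. if p v = w then (if v = u then c else 0) else X v (p v)) = (\<Prod>v\<in>V-{u}. X v (p v))"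
      by (intro prod.cong) auto
    then show ?thesis
      unfolding R using assms True by (subst prod.remove[of V u]) auto
  next
    case False
    obtain v where v: "v \<in> V" "p v = w"
      using assms(3) permutes_image[OF p] by (metis imageE)
    with False have "v \<noteq> u" by auto
    then have "(\<Prod>v\<in>V. if p v = w then (if v = u then c else 0) else X v (p v)) = 0"
      using v assms(1) by (intro prod_zero bexI[of _ v]) auto
    then show ?thesis unfolding R using False by simp
  qed
qed

lemma arc_permanent_insert_from:
  assumes "finite V" "x \<notin> V" "w \<in> V"
  shows "arc_permanent (insert x V) X x w = permanent V (\<lambda>v z. if z = w then X v x else X v z)"
proof -
  have "arc_permanent (insert x V) X x w = permanent V (\<lambda>v z. if z = w then (X(x := \<lambda>v. of_bool (v = w))) v x
        else (X(x := \<lambda>v. of_bool (v = w))) v z)"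
    unfolding arc_permanent_def
    by (subst permanent_insert_row_unit_vector[OF assms]) (use assms in auto)
  also have "\<dots> = permanent V (\<lambda>v z. if z = w then X v x else X v z)"
    by (rule permanent_cong) (use assms in auto)
  finally show ?thesis .
qed

text \<open>A permutation sending \<open>w\<close> to \<open>x\<close> must send \<open>x\<close> on
  to \<open>u\<close>, the only nonzero entry of row \<open>x\<close> inside \<open>V\<close>;
  contracting \<open>x\<close> leaves the cofactor of \<open>(w, u)\<close>.\<close>

lemma arc_permanent_insert_to:
  assumes "finite V" "x \<notin> V" "w \<in> V" "u \<in> V" "\<And>b. b \<in> V \<Longrightarrow> X x b = of_bool (b = u)"
  shows "arc_permanent (insert x V) X w x = arc_permanent V X w u"
proof -
  let ?Y = "\<lambda>v z. if z = x then (if v = w then 1 else 0) else X v z"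
  have "arc_permanent (insert x V) X w x = permanent (insert x V) ?Y"
    using permanent_col_unit_vector[of "insert x V" w x 1 X] assms by simp
  also have "\<dots> = permanent V (\<lambda>v z. if z = u then ?Y v x else ?Y v z)"
    by (subst permanent_insert_row_unit_vector[OF assms(1,2,4)]) (use assms in auto)
  also have "\<dots> = permanent V (\<lambda>v z. if z = u then (if v = w then 1 else 0) else X v z)"
    by (rule permanent_cong) (use assms in auto)
  also have "\<dots> = arc_permanent V X w u"
    using permanent_col_unit_vector[of V w u 1 X] assms by simp
  finally show ?thesis .
qed

lemma arc_permanent_cong:
  assumes "\<And>v z. v \<in> V \<Longrightarrow> z \<in> V \<Longrightarrow> X v z = Y v z"
  shows "arc_permanent V X u w = arc_permanent V Y u w"
  unfolding arc_permanent_def by (rule permanent_cong) (use assms in auto)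

lemma permanent_two_arcs:
  assumes "finite V" "u \<in> V" "w \<in> V" "u \<noteq> w"
  shows "permanent V (X(u := \<lambda>v. of_bool (v = w), w := \<lambda>v. of_bool (v = u))) = permanent (V - {u, w}) X"
proof -
  let ?X = "X(w := \<lambda>v. of_bool (v = u))"
  have V: "insert u (V - {u}) = V" "insert w (V - {u, w}) = V - {u}" using assms by auto
  have "permanent V (X(u := \<lambda>v. of_bool (v = w), w := \<lambda>v. of_bool (v = u))) = arc_permanent (insert u (V - {u})) ?X u w"
    unfolding arc_permanent_def V using assms(4) by (simp add: fun_upd_twist)
  also have "\<dots> = permanent (insert w (V - {u,w})) (\<lambda>v z. if z = w then ?X v u else ?X v z)"
    unfolding V(2) by (rule arc_permanent_insert_from) (use assms in auto)
  also have "\<dots> = permanent (V - {u,w}) (\<lambda>v z. if z = w then ?X v u else ?X v z)"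
    by (subst permanent_row_unit) (use assms in auto)
  also have "\<dots> = permanent (V - {u,w}) X"
    by (rule permanent_cong) auto
  finally show ?thesis .
qed

text \<open>\<open>cont y (k + 2)\<close> is the permanent of the path on \<open>k\<close> vertices with all diagonal entries \<open>y\<close>; the
  shift accommodates the values at \<open>k = -2\<close> and \<open>k = -1\<close>.\<close>

fun cont :: "'b::comm_ring_1 \<Rightarrow> nat \<Rightarrow> 'b" where
  "cont y 0 = 1"
| "cont y (Suc 0) = 0"
| "cont y (Suc (Suc n)) = y * cont y (Suc n) + cont y n"

section \<open>Attaching an ear to a matrix\<close>

definition walk_arcs :: "'a list \<Rightarrow> ('a \<times> 'a) set" where
  "walk_arcs p = set (zip p (tl p))"

lemma walk_arcs_simps [simp]:
  "walk_arcs [] = {}" "walk_arcs [x] = {}"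
  "walk_arcs (x # y # p) = insert (x, y) (walk_arcs (y # p))"
  by (simp_all add: walk_arcs_def)

lemma walk_arcs_Cons: "p \<noteq> [] \<Longrightarrow> walk_arcs (x # p) = insert (x, hd p) (walk_arcs p)"
  by (cases p) auto

lemma walk_arcsD:
  "(v, z) \<in> walk_arcs (x # xs @ [w]) \<Longrightarrow> v \<in> insert x (set xs) \<and> z \<in> insert w (set xs)"
  by (induction xs arbitrary: x) auto

text \<open>The matrix obtained from \<open>B\<close> on \<open>V\<close> by attaching a path with inner vertices \<open>xs\<close> to
  \<open>u, w \<in> V\<close>. The arcs leaving \<open>u\<close> and \<open>w\<close> get the weights \<open>a\<close> and \<open>b\<close>, so that the formula below
  also applies to the matrices of \<open>arc_permanent\<close>.\<close>

definition ear :: "'a set \<Rightarrow> ('a \<Rightarrow> 'a \<Rightarrow> 'b::comm_ring_1) \<Rightarrow> 'b \<Rightarrow> 'a \<Rightarrow> 'a list \<Rightarrow> 'a \<Rightarrow> 'b \<Rightarrow> 'b \<Rightarrow> 'a \<Rightarrow> 'a \<Rightarrow> 'b" where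
  "ear V B y u xs w a b = (\<lambda>v z. (if v \<in> V \<and> z \<in> V then B v z else if v = z then y else 0) +
     (if (v, z) \<in> walk_arcs (u # xs @ [w]) then (if v = u then a else 1) else 0) +
     (if (z, v) \<in> walk_arcs (u # xs @ [w]) then (if v = w then b else 1) else 0))"

text \<open>The first step of an ear: a new vertex \<open>x\<close> hanging on \<open>u\<close>. The
  weight \<open>a\<close> stays on the arc leaving \<open>u\<close>, and the rest of the ear starts
  at \<open>x\<close> with weight 1.\<close>

definition pendant :: "'a set \<Rightarrow> ('a \<Rightarrow> 'a \<Rightarrow> 'b::comm_ring_1) \<Rightarrow> 'b \<Rightarrow> 'a \<Rightarrow> 'a \<Rightarrow> 'b \<Rightarrow> 'a \<Rightarrow> 'a \<Rightarrow> 'b" where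
  "pendant V B y u x a = (\<lambda>v z. (if v \<in> V \<and> z \<in> V then B v z else if v = z then y else 0) +
     (if v = u \<and> z = x then a else 0) + (if v = x \<and> z = u then 1 else 0))"

lemma pendant_simps:
  assumes "x \<notin> V" "u \<in> V"
  shows "v \<in> V \<Longrightarrow> z \<in> V \<Longrightarrow> pendant V B y u x a v z = B v z"
    and "v \<in> V \<Longrightarrow> pendant V B y u x a v x = (if v = u then a else 0)"
    and "z \<in> V \<Longrightarrow> pendant V B y u x a x z = of_bool (z = u)"
    and "pendant V B y u x a x x = y"
proof -
  have [simp]: "x \<noteq> u" "u \<noteq> x" using assms by auto
  show "v \<in> V \<Longrightarrow> z \<in> V \<Longrightarrow> pendant V B y u x a v z = B v z"
    using assms by (cases "z = x"; cases "v = x"; simp add: pendant_def)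
  show "v \<in> V \<Longrightarrow> pendant V B y u x a v x = (if v = u then a else 0)"
    using assms by (cases "v = x"; simp add: pendant_def)
  show "z \<in> V \<Longrightarrow> pendant V B y u x a x z = of_bool (z = u)"
    using assms by (cases "z = x"; simp add: pendant_def)
  show "pendant V B y u x a x x = y"
    using assms by (simp add: pendant_def)
qed

lemma permanent_pendant:
  assumes "finite V" "x \<notin> V" "u \<in> V"
  shows "permanent (insert x V) (pendant V B y u x a) = y * permanent V B + a * permanent (V - {u}) B"
proof -
  let ?P = "pendant V B y u x a"
  have "permanent (insert x V) ?P = ?P x x * permanent V ?P + permanent V (\<lambda>v z. if z = u then ?P v x else ?P v z)"
  proof (rule permanent_insert_row_unit_vector[OF assms])
    fix b assume "b \<in> V"
    then have "b \<noteq> x" using assms(2) by auto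
    then show "?P x b = of_bool (b = u)" using assms(2,3) by (simp add: pendant_def)
  qed
  also have "?P x x = y"
  proof -
    have "x \<noteq> u" using assms by auto
    then show ?thesis using assms(2) by (simp add: pendant_def)
  qed
  also have "permanent V (\<lambda>v z. if z = u then ?P v x else ?P v z) = permanent V (\<lambda>v z. if z = u then (if v = u then a else 0) else B v z)"
    by (rule permanent_cong) (use assms in \<open>simp add: pendant_simps[OF assms(2,3)]\<close>)
  also have "\<dots> = a * permanent (V - {u}) B"
    using assms by (simp add: permanent_col_unit_vector arc_permanent_self)
  also have "permanent V ?P = permanent V B"
    by (rule permanent_cong) (use assms in \<open>simp add: pendant_simps[OF assms(2,3)]\<close>)
  finally show ?thesis .
qed

text \<open>The last hypothesis excludes the walk \<open>u, x, u\<close>, where the arc from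
  \<open>u\<close> to \<open>x\<close> would occur a second time as the reverse of the arc
  back.\<close>

lemma ear_Cons:
  assumes "u \<in> V" "w \<in> V" "x \<notin> V" "x \<notin> set xs" "set xs \<inter> V = {}" "u \<noteq> w \<or> xs \<noteq> []"
  shows "ear V B y u (x # xs) w a b = ear (insert x V) (pendant V B y u x a) y x xs w 1 b"
proof -
  let ?W = "walk_arcs (x # xs @ [w])"
  have W: "v \<in> insert x (set xs) \<and> z \<in> insert w (set xs)" if "(v, z) \<in> ?W" for v z
    using walk_arcsD[OF that] .
  have W1: "(u, z) \<notin> ?W" "(z, x) \<notin> ?W" for z
    using W[of u z] W[of z x] assms by auto
  have W2: "(x, u) \<notin> ?W"
  proof
    assume A: "(x, u) \<in> ?W"
    with W[OF A] assms have "u = w" "xs \<noteq> []" by auto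
    then obtain z zs where zs: "xs = z # zs" by (cases xs) auto
    with A \<open>u = w\<close> assms walk_arcsD[of x u z zs w] show False by auto
  qed
  show ?thesis
    unfolding ear_def
  proof (intro ext)
    fix v z
    have u: "u \<notin> insert x (set xs)" and xw: "x \<noteq> w" "x \<noteq> u" using assms by auto
    have "(if (v, z) \<in> walk_arcs (u # (x # xs) @ [w]) then if v = u then a else 1 else 0) =
        (if v = u \<and> z = x then a else 0) + (if (v, z) \<in> ?W then if v = x then 1 else 1 else 0)"
      using W[of v z] W1(1)[of x] u by auto
    moreover have "(if (z, v) \<in> walk_arcs (u # (x # xs) @ [w]) then if v = w then b else 1 else 0) =
        (if v = x \<and> z = u then 1 else 0) + (if (z, v) \<in> ?W then if v = w then b else 1 else 0)"
      using W1(1)[of x] xw by auto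
    moreover have "(if v \<in> insert x V \<and> z \<in> insert x V then pendant V B y u x a v z else if v = z then y else 0) =
        (if v \<in> V \<and> z \<in> V then B v z else if v = z then y else 0) + (if v = u \<and> z = x then a else 0) +
        (if v = x \<and> z = u then 1 else 0)"
      using assms(1) xw unfolding pendant_def by (cases "v = x"; cases "z = x") auto
    ultimately show "(if v \<in> V \<and> z \<in> V then B v z else if v = z then y else 0) +
       (if (v, z) \<in> walk_arcs (u # (x # xs) @ [w]) then if v = u then a else 1 else 0) +
       (if (z, v) \<in> walk_arcs (u # (x # xs) @ [w]) then if v = w then b else 1 else 0) =
       (if v \<in> insert x V \<and> z \<in> insert x V then pendant V B y u x a v z else if v = z then y else 0) +
       (if (v, z) \<in> ?W then if v = x then 1 else 1 else 0) +
       (if (z, v) \<in> ?W then if v = w then b else 1 else 0)"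
      by (simp only: ac_simps)
  qed
qed

text \<open>The terms list how a permutation can use the ear: no end of \<open>V\<close> is
  involved; a 2-cycle joins \<open>u\<close>, or \<open>w\<close>, or each of them, to the
  neighbouring ear vertex; or a long cycle runs through the ear in one of two directions and returns
  inside \<open>V\<close>, which is a cofactor. The induction absorbs the first ear vertex into
  \<open>V\<close> as a pendant, hence the generalisation over \<open>V\<close>, \<open>B\<close>,
  \<open>u\<close> and \<open>a\<close>.\<close>

theorem permanent_ear:
  assumes "finite V" "u \<in> V" "w \<in> V" "u \<noteq> w" "distinct xs" "set xs \<inter> V = {}"
  shows "permanent (V \<union> set xs) (ear V B y u xs w a b) =
     cont y (length xs + 2) * permanent V B +
     cont y (length xs + 1) * (a * permanent (V - {u}) B + b * permanent (V - {w}) B) +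
     cont y (length xs) * (a * b * permanent (V - {u, w}) B) +
     a * arc_permanent V B u w + b * arc_permanent V B w u"
  using assms
proof (induction xs arbitrary: V B u a)
  case Nil
  \<comment> \<open>Without inner vertices the ear is one edge, which adds a multiple of a unit
    vector to each of the rows \<open>u\<close> and \<open>w\<close>; linearity in both rows yields
    four permanents. They fit the formula because \<open>cont y 2 = cont y 0 = 1\<close> and
    \<open>cont y 1 = 0\<close>.\<close>
  let ?U = "B(u := \<lambda>v. B u v + a * of_bool (v = w))"
  have "permanent (V \<union> set []) (ear V B y u [] w a b) =
      permanent V (?U(w := \<lambda>v. B w v + b * of_bool (v = u)))"
    unfolding ear_def using Nil by (auto intro!: permanent_cong)
  also have "\<dots> = permanent V (?U(w := B w)) + b * permanent V (?U(w := (\<lambda>v. of_bool (v = u))))"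
    using Nil by (intro permanent_linear_row) auto
  also have "?U(w := B w) = ?U"
    using Nil by auto
  also have "permanent V ?U = permanent V (B(u := B u)) + a * permanent V (B(u := (\<lambda>v. of_bool (v = w))))"
    using Nil by (intro permanent_linear_row) auto
  also have "?U(w := (\<lambda>v. of_bool (v = u))) =
      (B(w := (\<lambda>v. of_bool (v = u))))(u := \<lambda>v. B u v + a * of_bool (v = w))"
    using Nil by auto
  also have "permanent V \<dots> = permanent V ((B(w := (\<lambda>v. of_bool (v = u))))(u := B u)) +
      a * permanent V ((B(w := (\<lambda>v. of_bool (v = u))))(u := (\<lambda>v. of_bool (v = w))))"
    using Nil by (intro permanent_linear_row) auto
  also have "(B(w := (\<lambda>v. of_bool (v = u))))(u := (\<lambda>v. of_bool (v = w))) =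
      B(u := (\<lambda>v. of_bool (v = w)), w := (\<lambda>v. of_bool (v = u)))"
    using Nil by auto
  also have "permanent V \<dots> = permanent (V - {u, w}) B"
    using Nil by (intro permanent_two_arcs) auto
  also have "(B(w := (\<lambda>v. of_bool (v = u))))(u := B u) = B(w := (\<lambda>v. of_bool (v = u)))"
    using Nil by auto
  finally have "permanent (V \<union> set []) (ear V B y u [] w a b) =
      permanent V B + a * arc_permanent V B u w + b * (arc_permanent V B w u + a * permanent (V - {u, w}) B)"
    by (simp only: arc_permanent_def fun_upd_triv)
  then show ?case by (simp add: algebra_simps)
next
  case (Cons x xs)
  let ?V = "insert x V" and ?B = "pendant V B y u x a"
  have x: "x \<notin> V" "x \<notin> set xs" "set xs \<inter> V = {}" using Cons.prems by auto
  have e: "?V - {x} = V" "?V - {x, w} = V - {w}" "?V - {w} = insert x (V - {w})" "V - {w} - {u} = V - {u, w}"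
    using x Cons.prems(3) by auto
  note P = pendant_simps[OF x(1) Cons.prems(2)]
  have "permanent (V \<union> set (x # xs)) (ear V B y u (x # xs) w a b) =
      permanent (?V \<union> set xs) (ear ?V ?B y x xs w 1 b)"
    using Cons.prems x by (subst ear_Cons) auto
  also have "\<dots> = cont y (length xs + 2) * permanent ?V ?B +
     cont y (length xs + 1) * (1 * permanent (?V - {x}) ?B + b * permanent (?V - {w}) ?B) +
     cont y (length xs) * (1 * b * permanent (?V - {x, w}) ?B) +
     1 * arc_permanent ?V ?B x w + b * arc_permanent ?V ?B w x"
    by (rule Cons.IH) (use Cons.prems x in auto)
  also have "permanent ?V ?B = y * permanent V B + a * permanent (V - {u}) B"
    using Cons.prems x by (intro permanent_pendant) auto
  also have "permanent (?V - {x}) ?B = permanent V B"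
    unfolding e(1) by (rule permanent_cong) (simp add: P)
  also have "permanent (?V - {x, w}) ?B = permanent (V - {w}) B"
    unfolding e(2) by (rule permanent_cong) (simp add: P)
  also have "permanent (?V - {w}) ?B = y * permanent (V - {w}) B + a * permanent (V - {u, w}) B"
  proof -
    have P': "x \<notin> V - {w}" "u \<in> V - {w}" using Cons.prems x by auto
    have "permanent (?V - {w}) ?B = permanent (insert x (V - {w})) (pendant (V - {w}) B y u x a)"
      unfolding e(3)
    proof (rule permanent_cong)
      fix v z assume "v \<in> insert x (V - {w})" "z \<in> insert x (V - {w})"
      then show "?B v z = pendant (V - {w}) B y u x a v z"
        by (auto simp: P pendant_simps[OF P'])
    qed
    also have "\<dots> = y * permanent (V - {w}) B + a * permanent (V - {w} - {u}) B"
      using P' Cons.prems by (intro permanent_pendant) auto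
    finally show ?thesis unfolding e(4) .
  qed
  also have "arc_permanent ?V ?B x w = a * arc_permanent V B u w"
  proof -
    have "arc_permanent ?V ?B x w = permanent V (\<lambda>v z. if z = w then ?B v x else ?B v z)"
      using Cons.prems x by (intro arc_permanent_insert_from) auto
    also have "\<dots> = permanent V (\<lambda>v z. if z = w then (if v = u then a else 0) else B v z)"
      using Cons.prems x by (intro permanent_cong) (auto simp: P)
    finally show ?thesis using Cons.prems by (simp add: permanent_col_unit_vector)
  qed
  also have "arc_permanent ?V ?B w x = arc_permanent V B w u"
  proof -
    have "arc_permanent ?V ?B w x = arc_permanent V ?B w u"
      using Cons.prems x by (intro arc_permanent_insert_to) (auto simp: P)
    also have "\<dots> = arc_permanent V B w u"
      using x by (intro arc_permanent_cong) (auto simp: P)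
    finally show ?thesis .
  qed
  finally show ?case by (simp add: algebra_simps)
qed

text \<open>After absorbing its first vertex \<open>x\<close>, the closed ear is an ear between the
  distinct ends \<open>x\<close> and \<open>u\<close>. The factor 2 counts the two end vertices that
  can form a 2-cycle with \<open>u\<close>, and the two orientations of the whole cycle.\<close>

theorem permanent_loop_ear:
  assumes "finite V" "u \<in> V" "distinct xs" "set xs \<inter> V = {}" "length xs \<ge> 2"
  shows "permanent (V \<union> set xs) (ear V B y u xs u 1 1) =
     cont y (length xs + 2) * permanent V B +
     2 * (cont y (length xs + 1) + 1) * permanent (V - {u}) B"
proof -
  obtain x zs where xs: "xs = x # zs" "zs \<noteq> []" using assms(5) by (cases xs; cases "tl xs") auto
  let ?V = "insert x V" and ?B = "pendant V B y u x 1"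
  have x: "x \<notin> V" "x \<notin> set zs" "set zs \<inter> V = {}" "x \<noteq> u" using assms xs by auto
  have e: "?V - {x} = V" "?V - {x, u} = V - {u}" "?V - {u} = insert x (V - {u})"
    using x assms(2) by auto
  note P = pendant_simps[OF x(1) assms(2)]
  have "permanent (V \<union> set xs) (ear V B y u xs u 1 1) =
      permanent (?V \<union> set zs) (ear ?V ?B y x zs u 1 1)"
    unfolding xs using assms x xs by (subst ear_Cons) auto
  also have "\<dots> = cont y (length zs + 2) * permanent ?V ?B +
     cont y (length zs + 1) * (1 * permanent (?V - {x}) ?B + 1 * permanent (?V - {u}) ?B) +
     cont y (length zs) * (1 * 1 * permanent (?V - {x, u}) ?B) +
     1 * arc_permanent ?V ?B x u + 1 * arc_permanent ?V ?B u x"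
    by (rule permanent_ear) (use assms x xs in auto)
  also have "permanent ?V ?B = y * permanent V B + permanent (V - {u}) B"
    using assms x by (subst permanent_pendant) auto
  also have "permanent (?V - {x}) ?B = permanent V B"
    unfolding e(1) by (rule permanent_cong) (simp add: P)
  also have "permanent (?V - {x, u}) ?B = permanent (V - {u}) B"
    unfolding e(2) by (rule permanent_cong) (simp add: P)
  also have "permanent (?V - {u}) ?B = y * permanent (V - {u}) B"
  proof -
    have "permanent (insert x (V - {u})) ?B = ?B x x * permanent (V - {u}) ?B"
      using assms x by (intro permanent_row_unit) (auto simp: P)
    moreover have "permanent (V - {u}) ?B = permanent (V - {u}) B"
      by (rule permanent_cong) (simp add: P)
    ultimately show ?thesis unfolding e(3) by (simp add: P)
  qed
  also have "arc_permanent ?V ?B x u = permanent (V - {u}) B"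
  proof -
    have "arc_permanent ?V ?B x u = permanent V (\<lambda>v z. if z = u then ?B v x else ?B v z)"
      using assms x by (intro arc_permanent_insert_from) auto
    also have "\<dots> = permanent V (\<lambda>v z. if z = u then (if v = u then 1 else 0) else B v z)"
      by (intro permanent_cong) (auto simp: P)
    finally show ?thesis using assms by (simp add: permanent_col_unit_vector arc_permanent_self)
  qed
  also have "arc_permanent ?V ?B u x = permanent (V - {u}) B"
  proof -
    have "arc_permanent ?V ?B u x = arc_permanent V ?B u u"
      using assms x by (intro arc_permanent_insert_to) (auto simp: P)
    also have "\<dots> = permanent (V - {u}) ?B"
      using assms by (simp add: arc_permanent_self)
    also have "\<dots> = permanent (V - {u}) B"
      by (intro permanent_cong) (auto simp: P)
    finally show ?thesis .
  qed
  finally show ?thesis using xs by (simp add: algebra_simps)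
qed

lemma walk_arcs_antisym:
  assumes "distinct xs" "u \<notin> set xs" "w \<notin> set xs" "u = w \<longrightarrow> length xs \<ge> 2"
    "(v, z) \<in> walk_arcs (u # xs @ [w])"
  shows "(z, v) \<notin> walk_arcs (u # xs @ [w]) \<and> v \<noteq> z"
  using assms
proof (induction xs arbitrary: u)
  case (Cons x xs)
  let ?W = "walk_arcs (x # xs @ [w])"
  have IH: "(z, v) \<notin> ?W \<and> v \<noteq> z" if "(v, z) \<in> ?W"
    using Cons.prems that by (intro Cons.IH) auto
  have xu: "(x, u) \<notin> ?W"
  proof
    assume A: "(x, u) \<in> ?W"
    then have "u = w" using walk_arcsD[OF A] Cons.prems by auto
    then obtain y ys where ys: "xs = y # ys" using Cons.prems(4) by (cases xs) auto
    have "(x, u) \<in> walk_arcs (y # ys @ [w])"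
      using A ys \<open>u = w\<close> Cons.prems(3) by (auto simp: ys)
    then show False
      using walk_arcsD[of x u y ys w] Cons.prems(1) ys \<open>u = w\<close> Cons.prems(3) by auto
  qed
  have ux: "(u, x) \<notin> ?W" "(x, u) \<notin> ?W" "u \<noteq> x"
    using walk_arcsD[of u x x xs w] xu Cons.prems by auto
  show ?case
    using Cons.prems(5) IH ux by auto
qed auto

section \<open>Adjacency matrices with a given diagonal; permanents of dumbbells, thetas and
  cycles\<close>

definition adj_matrix :: "('a \<times> 'a) set \<Rightarrow> ('a \<Rightarrow> 'b::comm_ring_1) \<Rightarrow> 'a \<Rightarrow> 'a \<Rightarrow> 'b" where
  "adj_matrix E d v z = (if v = z then d v else of_bool ((v, z) \<in> E))"

definition walk_edges :: "'a list \<Rightarrow> ('a \<times> 'a) set" where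
  "walk_edges p = walk_arcs p \<union> (walk_arcs p)\<inverse>"

text \<open>\<open>ear\<close> adds the new arcs as weights. The hypotheses make sure that no arc is
  present already or added twice, so the sum has entries 0 and 1 off the diagonal.\<close>

lemma adj_matrix_ear:
  assumes "u \<in> V" "w \<in> V" "distinct xs" "set xs \<inter> V = {}" "E \<subseteq> V \<times> V"
    and "u = w \<longrightarrow> length xs \<ge> 2" "xs = [] \<longrightarrow> (u, w) \<notin> E \<and> (w, u) \<notin> E"
    and "\<And>x. x \<in> set xs \<Longrightarrow> d x = y" and vz: "v \<in> V \<union> set xs" "z \<in> V \<union> set xs"
  shows "adj_matrix (E \<union> walk_edges (u # xs @ [w])) d v z = ear V (adj_matrix E d) y u xs w 1 1 v z"
proof -
  let ?W = "walk_arcs (u # xs @ [w])"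
  have anti: "(z, v) \<notin> ?W \<and> v \<noteq> z" if "(v, z) \<in> ?W" for v z
    using walk_arcs_antisym[OF assms(3) _ _ assms(6) that] assms(1,2,4) by auto
  have inner: "(v, z) \<notin> E \<and> (z, v) \<notin> E" if A: "(v, z) \<in> ?W" for v z
  proof (cases xs)
    case Nil
    then show ?thesis using A assms(7) by auto
  next
    case (Cons x zs)
    have "v \<in> set xs \<or> z \<in> set xs"
      using A walk_arcsD[of v z x zs w] unfolding Cons by auto
    then show ?thesis using assms(4,5) by auto
  qed
  have "ear V (adj_matrix E d) y u xs w 1 1 v z = (if v \<in> V \<and> z \<in> V then adj_matrix E d v z else if v = z then y else 0) +
     of_bool ((v, z) \<in> ?W) + of_bool ((z, v) \<in> ?W)"
    by (simp add: ear_def)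
  also have "(if v \<in> V \<and> z \<in> V then adj_matrix E d v z else if v = z then y else 0) = adj_matrix E d v z"
    using vz assms(5,8) by (auto simp: adj_matrix_def)
  also have "adj_matrix E d v z + of_bool ((v, z) \<in> ?W) + of_bool ((z, v) \<in> ?W) =
      adj_matrix (E \<union> walk_edges (u # xs @ [w])) d v z"
  proof (cases "(v, z) \<in> ?W \<or> (z, v) \<in> ?W")
    case True
    then show ?thesis
      using anti[of v z] anti[of z v] inner[of v z] inner[of z v]
      unfolding adj_matrix_def walk_edges_def by (elim disjE) auto
  next
    case False
    then show ?thesis by (simp add: adj_matrix_def walk_edges_def)
  qed
  finally show ?thesis by simp
qed

lemma ear_upd_start:
  assumes "u \<in> V" "w \<in> V" "u \<noteq> w" "set xs \<inter> V = {}" "t \<in> V" "v \<in> V \<union> set xs" "z \<in> V \<union> set xs"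
  shows "((ear V B y u xs w a b)(u := \<lambda>z. of_bool (z = t))) v z =
    ear V (B(u := \<lambda>z. of_bool (z = t))) y u xs w 0 b v z"
proof (cases "v = u")
  case True
  have "(z, u) \<notin> walk_arcs (u # xs @ [w])"
  proof
    assume "(z, u) \<in> walk_arcs (u # xs @ [w])"
    then show False using walk_arcsD[of z u u xs w] assms by auto
  qed
  then show ?thesis using True assms by (auto simp: ear_def)
next
  case False
  then show ?thesis by (simp add: ear_def)
qed

lemma ear_upd_end:
  assumes "u \<in> V" "w \<in> V" "u \<noteq> w" "set xs \<inter> V = {}" "t \<in> V" "v \<in> V \<union> set xs" "z \<in> V \<union> set xs"
  shows "((ear V B y u xs w a b)(w := \<lambda>z. of_bool (z = t))) v z =
    ear V (B(w := \<lambda>z. of_bool (z = t))) y u xs w a 0 v z"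
proof (cases "v = w")
  case True
  have "(w, z) \<notin> walk_arcs (u # xs @ [w])"
  proof
    assume A: "(w, z) \<in> walk_arcs (u # xs @ [w])"
    then show False using walk_arcsD[OF A] assms by auto
  qed
  then show ?thesis using True assms by (auto simp: ear_def)
next
  case False
  then show ?thesis by (simp add: ear_def)
qed

lemma arc_permanent_same_target:
  assumes "finite V" "u \<in> V" "w \<in> V" "t \<in> V" "u \<noteq> w"
  shows "arc_permanent V (X(u := \<lambda>z. of_bool (z = t))) w t = 0"
proof -
  let ?X = "X(u := \<lambda>z. of_bool (z = t))"
  have "arc_permanent V ?X w t = permanent V (\<lambda>v z. if z = t then (if v = w then 1 else 0) else ?X v z)"
    using permanent_col_unit_vector[of V w t 1 ?X] assms by simp
  also have "\<dots> = 0"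
    by (rule permanent_row_zero[of V u]) (use assms in auto)
  finally show ?thesis .
qed

text \<open>Together with \<open>permanent_ear\<close> this shows that six values are closed under
  attaching an ear at \<open>u\<close> and \<open>w\<close>: the permanent, the two cofactors
  between the ends and the three minors without one or both ends. Further ears can then be attached
  at the same ends.\<close>

lemma arc_permanent_ear:
  fixes B :: "'a \<Rightarrow> 'a \<Rightarrow> 'b::comm_ring_1" and y :: 'b
  assumes "finite V" "u \<in> V" "w \<in> V" "u \<noteq> w" "distinct xs" "set xs \<inter> V = {}"
  defines "X \<equiv> ear V B y u xs w 1 1"
  shows "arc_permanent (V \<union> set xs) X u w =
      cont y (length xs + 2) * arc_permanent V B u w + permanent (V - {u, w}) B"
    and "arc_permanent (V \<union> set xs) X w u =
      cont y (length xs + 2) * arc_permanent V B w u + permanent (V - {u, w}) B"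
    and "permanent (V \<union> set xs - {u}) X =
      cont y (length xs + 2) * permanent (V - {u}) B + cont y (length xs + 1) * permanent (V - {u, w}) B"
    and "permanent (V \<union> set xs - {w}) X =
      cont y (length xs + 2) * permanent (V - {w}) B + cont y (length xs + 1) * permanent (V - {u, w}) B"
    and "permanent (V \<union> set xs - {u, w}) X = cont y (length xs + 2) * permanent (V - {u, w}) B"
proof -
  note ear = permanent_ear[OF assms(1-6)]
  have W: "finite (V \<union> set xs)" "u \<in> V \<union> set xs" "w \<in> V \<union> set xs" using assms by auto
  have s: "arc_permanent (V \<union> set xs) X u t = permanent (V \<union> set xs) (ear V (B(u := \<lambda>z. of_bool (z = t))) y u xs w 0 1)"
    if "t \<in> V" for t
    unfolding arc_permanent_def X_def
    by (rule permanent_cong) (use ear_upd_start[OF assms(2-4,6) that] in blast)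
  have e: "arc_permanent (V \<union> set xs) X w t = permanent (V \<union> set xs) (ear V (B(w := \<lambda>z. of_bool (z = t))) y u xs w 1 0)"
    if "t \<in> V" for t
    unfolding arc_permanent_def X_def
    by (rule permanent_cong) (use ear_upd_end[OF assms(2-4,6) that] in blast)
  have f: "(V - {w}) - {u} = V - {u, w}" "(V - {u}) - {w} = V - {u, w}" by auto
  \<comment> \<open>The unit entry of row \<open>u\<close> stands in the deleted column
    \<open>w\<close>.\<close>
  have z1: "permanent (V - {w}) (B(u := \<lambda>z. of_bool (z = w))) = 0"
    by (rule permanent_row_zero[of _ u]) (use assms in auto)
  have z2: "permanent (V - {u}) (B(w := \<lambda>z. of_bool (z = u))) = 0"
    by (rule permanent_row_zero[of _ w]) (use assms in auto)
  have two: "arc_permanent V (B(u := \<lambda>z. of_bool (z = w))) w u = permanent (V - {u, w}) B"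
    unfolding arc_permanent_def using permanent_two_arcs[OF assms(1-4), of B] by simp
  have two': "arc_permanent V (B(w := \<lambda>z. of_bool (z = u))) u w = permanent (V - {u, w}) B"
    unfolding arc_permanent_def using permanent_two_arcs[of V w u B] assms by (simp add: insert_commute)
  show "arc_permanent (V \<union> set xs) X u w =
      cont y (length xs + 2) * arc_permanent V B u w + permanent (V - {u, w}) B"
    unfolding s[OF assms(3)] ear z1 two by (simp add: arc_permanent_def)
  show "arc_permanent (V \<union> set xs) X w u =
      cont y (length xs + 2) * arc_permanent V B w u + permanent (V - {u, w}) B"
    unfolding e[OF assms(2)] ear z2 two' by (simp add: arc_permanent_def)
  have p1: "permanent (V - {w}) (B(u := \<lambda>z. of_bool (z = u))) = permanent (V - {u, w}) B"
    using arc_permanent_self[of "V - {w}" u B] assms unfolding arc_permanent_def f by simp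
  have p2: "permanent (V - {u}) (B(w := \<lambda>z. of_bool (z = w))) = permanent (V - {u, w}) B"
    using arc_permanent_self[of "V - {u}" w B] assms unfolding arc_permanent_def f by simp
  have q1: "permanent V (B(u := \<lambda>z. of_bool (z = u))) = permanent (V - {u}) B"
    using arc_permanent_self[of V u B] assms unfolding arc_permanent_def by simp
  have q2: "permanent V (B(w := \<lambda>z. of_bool (z = w))) = permanent (V - {w}) B"
    using arc_permanent_self[of V w B] assms unfolding arc_permanent_def by simp
  have r1: "arc_permanent V (B(u := \<lambda>z. of_bool (z = u))) w u = 0"
    using assms by (intro arc_permanent_same_target) auto
  have r2: "arc_permanent V (B(w := \<lambda>z. of_bool (z = w))) u w = 0"
    using assms by (intro arc_permanent_same_target) auto
  show "permanent (V \<union> set xs - {u}) X =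
      cont y (length xs + 2) * permanent (V - {u}) B + cont y (length xs + 1) * permanent (V - {u, w}) B"
    unfolding arc_permanent_self[OF W(1,2), symmetric] s[OF assms(2)] ear p1 q1 r1 by simp
  show "permanent (V \<union> set xs - {w}) X =
      cont y (length xs + 2) * permanent (V - {w}) B + cont y (length xs + 1) * permanent (V - {u, w}) B"
    unfolding arc_permanent_self[OF W(1,3), symmetric] e[OF assms(3)] ear p2 q2 r2 by simp
  have "permanent (V \<union> set xs - {u, w}) X =
      permanent (V \<union> set xs) (X(u := \<lambda>v. of_bool (v = w), w := \<lambda>v. of_bool (v = u)))"
    using permanent_two_arcs[OF W assms(4), of X] by simp
  also have "\<dots> = permanent (V \<union> set xs) (ear V (B(u := \<lambda>v. of_bool (v = w), w := \<lambda>v. of_bool (v = u))) y u xs w 0 0)"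
  proof (rule permanent_cong)
    fix v z assume vz: "v \<in> V \<union> set xs" "z \<in> V \<union> set xs"
    show "(X(u := \<lambda>v. of_bool (v = w), w := \<lambda>v. of_bool (v = u))) v z =
        ear V (B(u := \<lambda>v. of_bool (v = w), w := \<lambda>v. of_bool (v = u))) y u xs w 0 0 v z"
      using ear_upd_end[OF assms(2-4,6,2) vz, of "B(u := \<lambda>v. of_bool (v = w))" y 0 1, symmetric]
        ear_upd_start[OF assms(2-4,6,3) vz, of B y 1 1] unfolding X_def by (cases "v = w") auto
  qed
  also have "\<dots> = cont y (length xs + 2) * permanent (V - {u, w}) B"
    unfolding ear using permanent_two_arcs[OF assms(1-4), of B] by simp
  finally show "permanent (V \<union> set xs - {u, w}) X = cont y (length xs + 2) * permanent (V - {u, w}) B" .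
qed

lemma walk_edges_subset:
  "walk_edges (u # xs @ [w]) \<subseteq> insert u (insert w (set xs)) \<times> insert u (insert w (set xs))"
  unfolding walk_edges_def by (auto dest: walk_arcsD)

lemma permanent_adj_ear:
  fixes d :: "'a \<Rightarrow> 'b::comm_ring_1"
  assumes "finite V" "u \<in> V" "w \<in> V" "u \<noteq> w" "distinct xs" "set xs \<inter> V = {}"
    and "E \<subseteq> V \<times> V" "xs = [] \<longrightarrow> (u, w) \<notin> E \<and> (w, u) \<notin> E"
    and "\<forall>x\<in>set xs. d x = y"
  defines "X \<equiv> adj_matrix (E \<union> walk_edges (u # xs @ [w])) d" and "B \<equiv> adj_matrix E d"
    and "V' \<equiv> V \<union> set xs"
  shows "permanent V' X = cont y (length xs + 2) * permanent V B +
       cont y (length xs + 1) * (permanent (V - {u}) B + permanent (V - {w}) B) +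
       cont y (length xs) * permanent (V - {u, w}) B +
       arc_permanent V B u w + arc_permanent V B w u"
    and "arc_permanent V' X u w = cont y (length xs + 2) * arc_permanent V B u w + permanent (V - {u, w}) B"
    and "arc_permanent V' X w u = cont y (length xs + 2) * arc_permanent V B w u + permanent (V - {u, w}) B"
    and "permanent (V' - {u}) X =
      cont y (length xs + 2) * permanent (V - {u}) B + cont y (length xs + 1) * permanent (V - {u, w}) B"
    and "permanent (V' - {w}) X =
      cont y (length xs + 2) * permanent (V - {w}) B + cont y (length xs + 1) * permanent (V - {u, w}) B"
    and "permanent (V' - {u, w}) X = cont y (length xs + 2) * permanent (V - {u, w}) B"
proof -
  have eq: "X v z = ear V B y u xs w 1 1 v z" if "v \<in> V'" "z \<in> V'" for v z
    using adj_matrix_ear[of u V w xs E d y v z] assms(2-9) that unfolding X_def B_def V'_def by blast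
  have sub: "permanent S X = permanent S (ear V B y u xs w 1 1)" if "S \<subseteq> V'" for S
    by (rule permanent_cong) (use eq that in blast)
  have arc: "arc_permanent V' X s t = arc_permanent V' (ear V B y u xs w 1 1) s t" for s t
    by (rule arc_permanent_cong) (use eq in blast)
  note thms = permanent_ear[OF assms(1-6), of B y 1 1] arc_permanent_ear[OF assms(1-6), where y=y and B=B]
  have S: "V' \<subseteq> V'" "V' - {u} \<subseteq> V'" "V' - {w} \<subseteq> V'" "V' - {u, w} \<subseteq> V'" by auto
  show "permanent V' X = cont y (length xs + 2) * permanent V B +
       cont y (length xs + 1) * (permanent (V - {u}) B + permanent (V - {w}) B) +
       cont y (length xs) * permanent (V - {u, w}) B +
       arc_permanent V B u w + arc_permanent V B w u"
    unfolding sub[OF S(1)] unfolding V'_def thms(1) by simp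
  show "arc_permanent V' X u w = cont y (length xs + 2) * arc_permanent V B u w + permanent (V - {u, w}) B"
    unfolding arc unfolding V'_def by (rule thms(2))
  show "arc_permanent V' X w u = cont y (length xs + 2) * arc_permanent V B w u + permanent (V - {u, w}) B"
    unfolding arc unfolding V'_def by (rule thms(3))
  show "permanent (V' - {u}) X =
      cont y (length xs + 2) * permanent (V - {u}) B + cont y (length xs + 1) * permanent (V - {u, w}) B"
    unfolding sub[OF S(2)] unfolding V'_def by (rule thms(4))
  show "permanent (V' - {w}) X =
      cont y (length xs + 2) * permanent (V - {w}) B + cont y (length xs + 1) * permanent (V - {u, w}) B"
    unfolding sub[OF S(3)] unfolding V'_def by (rule thms(5))
  show "permanent (V' - {u, w}) X = cont y (length xs + 2) * permanent (V - {u, w}) B"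
    unfolding sub[OF S(4)] unfolding V'_def by (rule thms(6))
qed

text \<open>The second equation is needed because the two cycles of a dumbbell hang on different
  vertices: the minor without the second vertex must be followed through the attachment of the first
  cycle.\<close>

lemma permanent_adj_loop:
  fixes d :: "'a \<Rightarrow> 'b::comm_ring_1"
  assumes "finite V" "u \<in> V" "distinct xs" "set xs \<inter> V = {}" "length xs \<ge> 2"
    and "E \<subseteq> V \<times> V" "\<forall>x\<in>set xs. d x = y"
  defines "X \<equiv> adj_matrix (E \<union> walk_edges (u # xs @ [u])) d" and "B \<equiv> adj_matrix E d"
    and "V' \<equiv> V \<union> set xs"
  shows "permanent V' X = cont y (length xs + 2) * permanent V B +
       2 * (cont y (length xs + 1) + 1) * permanent (V - {u}) B"
    and "t \<in> V \<Longrightarrow> t \<noteq> u \<Longrightarrow> permanent (V' - {t}) X = cont y (length xs + 2) * permanent (V - {t}) B +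
       2 * (cont y (length xs + 1) + 1) * permanent (V - {u, t}) B"
proof -
  have ne: "xs \<noteq> []" using assms(5) by auto
  have eq: "X v z = ear V B y u xs u 1 1 v z" if "v \<in> V'" "z \<in> V'" for v z
    using adj_matrix_ear[of u V u xs E d y v z] assms(2-7) ne that unfolding X_def B_def V'_def by blast
  have "permanent V' X = permanent V' (ear V B y u xs u 1 1)"
    by (rule permanent_cong) (use eq in blast)
  then show "permanent V' X = cont y (length xs + 2) * permanent V B +
       2 * (cont y (length xs + 1) + 1) * permanent (V - {u}) B"
    unfolding V'_def permanent_loop_ear[OF assms(1-5), of B y] .
  assume t: "t \<in> V" "t \<noteq> u"
  have e: "V' - {t} = (V - {t}) \<union> set xs" "V - {t} - {u} = V - {u, t}"
    using t assms(4) unfolding V'_def by auto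
  have "permanent (V' - {t}) X = permanent ((V - {t}) \<union> set xs) (ear (V - {t}) B y u xs u 1 1)"
    unfolding e
  proof (rule permanent_cong)
    fix v z assume vz: "v \<in> V - {t} \<union> set xs" "z \<in> V - {t} \<union> set xs"
    then have i: "v \<in> V - {t} \<longleftrightarrow> v \<in> V" "z \<in> V - {t} \<longleftrightarrow> z \<in> V"
      using assms(4) t by blast+
    have "X v z = ear V B y u xs u 1 1 v z"
      by (rule eq) (use vz in \<open>auto simp: V'_def\<close>)
    also have "\<dots> = ear (V - {t}) B y u xs u 1 1 v z"
      by (simp only: ear_def i)
    finally show "X v z = ear (V - {t}) B y u xs u 1 1 v z" .
  qed
  also have "\<dots> = cont y (length xs + 2) * permanent (V - {t}) B +
       2 * (cont y (length xs + 1) + 1) * permanent (V - {u, t}) B"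
    unfolding e(2)[symmetric] using assms t by (intro permanent_loop_ear) auto
  finally show "permanent (V' - {t}) X = cont y (length xs + 2) * permanent (V - {t}) B +
       2 * (cont y (length xs + 1) + 1) * permanent (V - {u, t}) B" .
qed

lemma permanent_adj_pair:
  assumes "u \<noteq> w"
  shows "permanent {u, w} (adj_matrix {} d) = d u * d w"
    and "permanent ({u, w} - {u}) (adj_matrix {} d) = d w"
    and "permanent ({u, w} - {w}) (adj_matrix {} d) = d u"
    and "arc_permanent {u, w} (adj_matrix {} d) u w = 0"
    and "arc_permanent {u, w} (adj_matrix {} d) w u = 0"
proof -
  have 1: "permanent {x} X = X x x" for x and X :: "'a \<Rightarrow> 'a \<Rightarrow> 'b"
    by (subst permanent_row_unit) auto
  show "permanent {u, w} (adj_matrix {} d) = d u * d w"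
    using assms by (subst permanent_row_unit) (auto simp: 1 adj_matrix_def)
  have "{u, w} - {u} = {w}" "{u, w} - {w} = {u}" using assms by auto
  then show "permanent ({u, w} - {u}) (adj_matrix {} d) = d w"
    "permanent ({u, w} - {w}) (adj_matrix {} d) = d u"
    by (simp_all add: 1 adj_matrix_def)
  have "arc_permanent (insert u {w}) (adj_matrix {} d) u w =
      permanent {w} (\<lambda>v z. if z = w then adj_matrix {} d v u else adj_matrix {} d v z)"
    using assms by (intro arc_permanent_insert_from) auto
  then show "arc_permanent {u, w} (adj_matrix {} d) u w = 0"
    using assms by (simp add: 1 adj_matrix_def)
  have "arc_permanent (insert w {u}) (adj_matrix {} d) w u =
      permanent {u} (\<lambda>v z. if z = u then adj_matrix {} d v w else adj_matrix {} d v z)"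
    using assms by (intro arc_permanent_insert_from) auto
  then show "arc_permanent {u, w} (adj_matrix {} d) w u = 0"
    using assms by (simp add: 1 adj_matrix_def insert_commute)
qed

text \<open>Built from the two isolated vertices \<open>u\<close> and \<open>w\<close>: the path
  \<open>zs\<close> is an ear between them, and the cycles are closed ears at \<open>u\<close> and
  at \<open>w\<close>.\<close>

theorem permanent_dumbbell:
  fixes d :: "'a \<Rightarrow> 'b::comm_ring_1"
  assumes dist: "distinct (u # w # xs @ ys @ zs)" and len: "length xs \<ge> 2" "length ys \<ge> 2"
    and d: "d u = \<alpha>" "d w = \<alpha>" "\<And>x. x \<in> set (xs @ ys @ zs) \<Longrightarrow> d x = y"
  defines "E \<equiv> walk_edges (u # zs @ [w]) \<union> walk_edges (u # xs @ [u]) \<union> walk_edges (w # ys @ [w])"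
    and "c \<equiv> \<lambda>ps n. cont y (length ps + n)"
  shows "permanent ({u, w} \<union> set zs \<union> set xs \<union> set ys) (adj_matrix E d) =
    c ys 2 * (c xs 2 * (c zs 2 * \<alpha>\<^sup>2 + 2 * c zs 1 * \<alpha> + c zs 0) + 2 * (c xs 1 + 1) * (c zs 2 * \<alpha> + c zs 1)) +
    2 * (c ys 1 + 1) * (c xs 2 * (c zs 2 * \<alpha> + c zs 1) + 2 * (c xs 1 + 1) * c zs 2)"
proof -
  define V1 where "V1 = {u, w} \<union> set zs"
  define E1 where "E1 = {} \<union> walk_edges (u # zs @ [w])"
  have uw: "u \<noteq> w" using dist by auto
  have c0: "finite {u, w}" "u \<in> {u, w}" "w \<in> {u, w}" "distinct zs" "set zs \<inter> {u, w} = {}"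
      "({} :: ('a \<times> 'a) set) \<subseteq> {u, w} \<times> {u, w}" "zs = [] \<longrightarrow> (u, w) \<notin> {} \<and> (w, u) \<notin> {}" "\<forall>x\<in>set zs. d x = y"
    using dist d(3) by auto
  note ear1 = permanent_adj_ear[where d=d and y=y, OF c0(1-3) uw c0(4-8), folded V1_def, folded E1_def]
  note base = permanent_adj_pair[OF uw] Diff_cancel permanent_empty d(1,2)
  have p: "permanent V1 (adj_matrix E1 d) = c zs 2 * \<alpha>\<^sup>2 + 2 * c zs 1 * \<alpha> + c zs 0"
    unfolding c_def ear1(1) base by (simp add: algebra_simps power2_eq_square)
  have pu: "permanent (V1 - {u}) (adj_matrix E1 d) = c zs 2 * \<alpha> + c zs 1"
    unfolding c_def ear1(4) base by simp
  have pw: "permanent (V1 - {w}) (adj_matrix E1 d) = c zs 2 * \<alpha> + c zs 1"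
    unfolding c_def ear1(5) base by simp
  have puw: "permanent (V1 - {u, w}) (adj_matrix E1 d) = c zs 2"
    unfolding c_def ear1(6) base by simp
  have E1: "E1 \<subseteq> V1 \<times> V1" using walk_edges_subset[of u zs w] unfolding E1_def V1_def by auto
  define V2 where "V2 = V1 \<union> set xs"
  define E2 where "E2 = E1 \<union> walk_edges (u # xs @ [u])"
  have V1: "finite V1" "u \<in> V1" "w \<in> V1" "set xs \<inter> V1 = {}" "distinct xs"
      "\<forall>x\<in>set xs. d x = y" using dist d(3) by (auto simp: V1_def)
  note loop = permanent_adj_loop[where d=d and y=y, OF V1(1,2) V1(5,4) len(1) E1 V1(6), folded V2_def, folded E2_def]
  have q: "permanent V2 (adj_matrix E2 d) =
        c xs 2 * (c zs 2 * \<alpha>\<^sup>2 + 2 * c zs 1 * \<alpha> + c zs 0) + 2 * (c xs 1 + 1) * (c zs 2 * \<alpha> + c zs 1)"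
    unfolding loop(1) p pu by (simp only: c_def)
  have qw: "permanent (V2 - {w}) (adj_matrix E2 d) =
        c xs 2 * (c zs 2 * \<alpha> + c zs 1) + 2 * (c xs 1 + 1) * c zs 2"
    unfolding loop(2)[OF V1(3) uw[symmetric]] pw puw by (simp only: c_def)
  have "E2 \<subseteq> V2 \<times> V2" using E1 V1 walk_edges_subset[of u xs u] unfolding E2_def V2_def by auto
  moreover have "finite V2" "w \<in> V2" "distinct ys" "set ys \<inter> V2 = {}" "\<forall>x\<in>set ys. d x = y"
    using V1 dist d(3) by (auto simp: V2_def V1_def)
  ultimately have "permanent (V2 \<union> set ys) (adj_matrix (E2 \<union> walk_edges (w # ys @ [w])) d) =
      c ys 2 * permanent V2 (adj_matrix E2 d) + 2 * (c ys 1 + 1) * permanent (V2 - {w}) (adj_matrix E2 d)"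
    unfolding c_def using len(2) by (intro permanent_adj_loop(1)) auto
  moreover have "V2 \<union> set ys = {u, w} \<union> set zs \<union> set xs \<union> set ys" "E2 \<union> walk_edges (w # ys @ [w]) = E"
    unfolding V2_def V1_def E2_def E1_def E_def by auto
  ultimately show ?thesis unfolding q qw by (simp only:)
qed

text \<open>Three ears are attached successively to the isolated vertices \<open>u\<close> and
  \<open>w\<close>. Only the first may be a single edge, since a simple graph has at most one edge
  between them.\<close>

theorem permanent_theta:
  fixes d :: "'a \<Rightarrow> 'b::comm_ring_1"
  assumes dist: "distinct (u # w # xs @ ys @ zs)" and ne: "ys \<noteq> []" "zs \<noteq> []"
    and d: "d u = \<alpha>" "d w = \<alpha>" "\<And>x. x \<in> set (xs @ ys @ zs) \<Longrightarrow> d x = y"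
  defines "E \<equiv> walk_edges (u # xs @ [w]) \<union> walk_edges (u # ys @ [w]) \<union> walk_edges (u # zs @ [w])"
    and "c \<equiv> \<lambda>ps n. cont y (length ps + n)"
  shows "permanent ({u, w} \<union> set xs \<union> set ys \<union> set zs) (adj_matrix E d) =
    c zs 2 * (c ys 2 * (c xs 2 * \<alpha>\<^sup>2 + 2 * c xs 1 * \<alpha> + c xs 0) + 2 * c ys 1 * (c xs 2 * \<alpha> + c xs 1) +
      c ys 0 * c xs 2 + 2) +
    2 * c zs 1 * (c ys 2 * (c xs 2 * \<alpha> + c xs 1) + c ys 1 * c xs 2) +
    c zs 0 * c ys 2 * c xs 2 + 2 * (c ys 2 + c xs 2)"
proof -
  define V1 where "V1 = {u, w} \<union> set xs"
  define E1 where "E1 = {} \<union> walk_edges (u # xs @ [w])"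
  have uw: "u \<noteq> w" using dist by auto
  have c0: "finite {u, w}" "u \<in> {u, w}" "w \<in> {u, w}" "distinct xs" "set xs \<inter> {u, w} = {}"
      "({} :: ('a \<times> 'a) set) \<subseteq> {u, w} \<times> {u, w}" "xs = [] \<longrightarrow> (u, w) \<notin> {} \<and> (w, u) \<notin> {}" "\<forall>x\<in>set xs. d x = y"
    using dist d(3) by auto
  note ear1 = permanent_adj_ear[where d=d and y=y, OF c0(1-3) uw c0(4-8), folded V1_def, folded E1_def]
  note base = permanent_adj_pair[OF uw] Diff_cancel permanent_empty d(1,2)
  have p: "permanent V1 (adj_matrix E1 d) = c xs 2 * \<alpha>\<^sup>2 + 2 * c xs 1 * \<alpha> + c xs 0"
    unfolding c_def ear1(1) base by (simp add: algebra_simps power2_eq_square)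
  have pu: "permanent (V1 - {u}) (adj_matrix E1 d) = c xs 2 * \<alpha> + c xs 1"
    unfolding c_def ear1(4) base by simp
  have pw: "permanent (V1 - {w}) (adj_matrix E1 d) = c xs 2 * \<alpha> + c xs 1"
    unfolding c_def ear1(5) base by simp
  have puw: "permanent (V1 - {u, w}) (adj_matrix E1 d) = c xs 2"
    unfolding c_def ear1(6) base by simp
  have pa: "arc_permanent V1 (adj_matrix E1 d) u w = 1" "arc_permanent V1 (adj_matrix E1 d) w u = 1"
    unfolding ear1(2,3) base by simp_all
  have E1: "E1 \<subseteq> V1 \<times> V1" using walk_edges_subset[of u xs w] unfolding E1_def V1_def by auto
  define V2 where "V2 = V1 \<union> set ys"
  define E2 where "E2 = E1 \<union> walk_edges (u # ys @ [w])"
  have V1: "finite V1" "u \<in> V1" "w \<in> V1" "set ys \<inter> V1 = {}" "distinct ys"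
      "\<forall>x\<in>set ys. d x = y" using dist d(3) by (auto simp: V1_def)
  have nil: "ys = [] \<longrightarrow> (u, w) \<notin> E1 \<and> (w, u) \<notin> E1" using ne by simp
  note ear2 = permanent_adj_ear[where d=d and y=y, OF V1(1-3) uw V1(5,4) E1 nil V1(6), folded V2_def, folded E2_def]
  have q: "permanent V2 (adj_matrix E2 d) =
        c ys 2 * (c xs 2 * \<alpha>\<^sup>2 + 2 * c xs 1 * \<alpha> + c xs 0) + 2 * c ys 1 * (c xs 2 * \<alpha> + c xs 1) + c ys 0 * c xs 2 + 2"
    unfolding ear2(1) p pu pw puw pa unfolding c_def by (simp add: algebra_simps power2_eq_square)
  have qu: "permanent (V2 - {u}) (adj_matrix E2 d) = c ys 2 * (c xs 2 * \<alpha> + c xs 1) + c ys 1 * c xs 2"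
    unfolding ear2(4) pu puw unfolding c_def by simp
  have qw: "permanent (V2 - {w}) (adj_matrix E2 d) = c ys 2 * (c xs 2 * \<alpha> + c xs 1) + c ys 1 * c xs 2"
    unfolding ear2(5) pw puw unfolding c_def by simp
  have quw: "permanent (V2 - {u, w}) (adj_matrix E2 d) = c ys 2 * c xs 2"
    unfolding ear2(6) puw unfolding c_def by simp
  have qa: "arc_permanent V2 (adj_matrix E2 d) u w = c ys 2 + c xs 2"
      "arc_permanent V2 (adj_matrix E2 d) w u = c ys 2 + c xs 2"
    unfolding ear2(2,3) pa puw unfolding c_def by simp_all
  have "E2 \<subseteq> V2 \<times> V2" using E1 V1 walk_edges_subset[of u ys w] unfolding E2_def V2_def by auto
  moreover have "finite V2" "u \<in> V2" "w \<in> V2" "distinct zs" "set zs \<inter> V2 = {}" "\<forall>x\<in>set zs. d x = y"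
    using V1 dist d(3) by (auto simp: V2_def V1_def)
  ultimately have "permanent (V2 \<union> set zs) (adj_matrix (E2 \<union> walk_edges (u # zs @ [w])) d) =
     c zs 2 * permanent V2 (adj_matrix E2 d) +
       c zs 1 * (permanent (V2 - {u}) (adj_matrix E2 d) + permanent (V2 - {w}) (adj_matrix E2 d)) +
       c zs 0 * permanent (V2 - {u, w}) (adj_matrix E2 d) +
       arc_permanent V2 (adj_matrix E2 d) u w + arc_permanent V2 (adj_matrix E2 d) w u"
    unfolding c_def add_0_right[of "length zs"] using uw ne by (intro permanent_adj_ear(1)) auto
  moreover have "V2 \<union> set zs = {u, w} \<union> set xs \<union> set ys \<union> set zs" "E2 \<union> walk_edges (u # zs @ [w]) = E"
    unfolding V2_def V1_def E2_def E1_def E_def by auto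
  ultimately have "permanent ({u, w} \<union> set xs \<union> set ys \<union> set zs) (adj_matrix E d) =
     c zs 2 * permanent V2 (adj_matrix E2 d) +
       c zs 1 * (permanent (V2 - {u}) (adj_matrix E2 d) + permanent (V2 - {w}) (adj_matrix E2 d)) +
       c zs 0 * permanent (V2 - {u, w}) (adj_matrix E2 d) +
       arc_permanent V2 (adj_matrix E2 d) u w + arc_permanent V2 (adj_matrix E2 d) w u"
    by (simp only:)
  then show ?thesis unfolding q qu qw quw qa by (simp add: algebra_simps power2_eq_square)
qed

theorem permanent_cycle:
  fixes d :: "'a \<Rightarrow> 'b::comm_ring_1"
  assumes "distinct (u # xs)" "length xs \<ge> 2" "\<And>x. x \<in> set (u # xs) \<Longrightarrow> d x = y"
  shows "permanent (insert u (set xs)) (adj_matrix (walk_edges (u # xs @ [u])) d) =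
    cont y (length xs + 2) * y + 2 * (cont y (length xs + 1) + 1)"
proof -
  have 1: "permanent {u} (adj_matrix {} d) = y"
    by (subst permanent_row_unit) (use assms in \<open>auto simp: adj_matrix_def\<close>)
  have "permanent ({u} \<union> set xs) (adj_matrix ({} \<union> walk_edges (u # xs @ [u])) d) =
     cont y (length xs + 2) * permanent {u} (adj_matrix {} d) +
       2 * (cont y (length xs + 1) + 1) * permanent ({u} - {u}) (adj_matrix {} d)"
    by (rule permanent_adj_loop(1)) (use assms in auto)
  then show ?thesis by (simp only: 1) simp
qed

section \<open>Evaluation at real points and the substitution \<open>1 / w - w\<close>\<close>

text \<open>The substitution \<open>1 / w - w\<close> is not polynomial in \<open>w\<close>.
  Identities are therefore verified at real points \<open>w > 0\<close>, and
  \<open>reval_eqI\<close> lifts them to integer polynomials.\<close>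

definition reval :: "int poly \<Rightarrow> real \<Rightarrow> real" where
  "reval p x = poly (map_poly real_of_int p) x"

lemma reval_simps [simp]:
  "reval 0 x = 0" "reval 1 x = 1" "reval (pCons c p) x = c + x * reval p x"
  "reval (p + q) x = reval p x + reval q x"
  "reval (p - q) x = reval p x - reval q x"
  "reval (- p) x = - reval p x"
  "reval (smult c p) x = c * reval p x"
  "reval (p * q) x = reval p x * reval q x"
proof -
  show "reval 0 x = 0" "reval 1 x = 1" "reval (pCons c p) x = c + x * reval p x"
    by (simp_all add: reval_def map_poly_pCons)
  have "map_poly real_of_int (p + q) = map_poly real_of_int p + map_poly real_of_int q"
    "map_poly real_of_int (p - q) = map_poly real_of_int p - map_poly real_of_int q"
    "map_poly real_of_int (- p) = - map_poly real_of_int p"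
    "map_poly real_of_int (smult c p) = smult (real_of_int c) (map_poly real_of_int p)"
    "map_poly real_of_int (p * q) = map_poly real_of_int p * map_poly real_of_int q"
    by (auto intro!: poly_eqI simp: coeff_map_poly coeff_mult)
  then show "reval (p + q) x = reval p x + reval q x"
    "reval (p - q) x = reval p x - reval q x"
    "reval (- p) x = - reval p x"
    "reval (smult c p) x = c * reval p x"
    "reval (p * q) x = reval p x * reval q x"
    by (simp_all add: reval_def)
qed

lemma reval_numeral [simp]: "reval (numeral n) x = numeral n"
  by (simp add: numeral_poly)

lemma reval_power [simp]: "reval (p ^ n) x = reval p x ^ n"
  by (induction n) simp_all

lemma reval_sum: "reval (\<Sum>i\<in>S. f i) x = (\<Sum>i\<in>S. reval (f i) x)"
  by (induction S rule: infinite_finite_induct) simp_all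

lemma reval_prod: "reval (\<Prod>i\<in>S. f i) x = (\<Prod>i\<in>S. reval (f i) x)"
  by (induction S rule: infinite_finite_induct) simp_all

lemma reval_eqI:
  assumes "\<And>w. 0 < w \<Longrightarrow> reval p w = reval q w"
  shows "p = q"
proof -
  have "{0<..} \<subseteq> {w. poly (map_poly real_of_int p - map_poly real_of_int q) w = 0}"
    using assms by (auto simp: reval_def)
  then have "infinite {w. poly (map_poly real_of_int p - map_poly real_of_int q) w = 0}"
    using infinite_Ioi[of "0::real"] finite_subset by blast
  then have "map_poly real_of_int p = map_poly real_of_int q"
    using poly_roots_finite[of "map_poly real_of_int p - map_poly real_of_int q"] by force
  then have "real_of_int (coeff p n) = real_of_int (coeff q n)" for n
    by (metis coeff_map_poly of_int_0)
  then show ?thesis by (intro poly_eqI) simp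
qed

lemma reval_permanent: "reval (permanent V X) x = permanent V (\<lambda>u v. reval (X u v) x)"
  by (simp add: permanent_def reval_sum reval_prod)

text \<open>\<open>x I - L = x I - D + A\<close>, so the adjacency entries keep their positive
  sign.\<close>

lemma reval_laplacian_permanental_poly:
  assumes "pair_graph H"
  shows "reval (laplacian_permanental_poly H) x =
    permanent (pverts H) (adj_matrix (parcs H) (\<lambda>v. x - real (out_degree (with_proj H) v)))"
  unfolding laplacian_permanental_poly_def reval_permanent
proof (rule permanent_cong)
  interpret pair_graph H by fact
  fix u v
  have "(u, u) \<notin> parcs H" using pair_no_loops[of "(u, u)"] by auto
  then show "reval ((if u = v then [:0, 1:] else 0) - [:laplacian_matrix H u v:]) x =
      adj_matrix (parcs H) (\<lambda>v. x - real (out_degree (with_proj H) v)) u v"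
    by (auto simp: laplacian_matrix_def degree_matrix_def adjacency_matrix_def adj_matrix_def)
qed

text \<open>The recurrence \<open>t^2 = y t + 1\<close> has the roots \<open>1/w\<close> and
  \<open>-w\<close>. The initial values 1 and 0 give them the weights \<open>w^2 / (1 + w^2)\<close>
  and \<open>1 / (1 + w^2)\<close>.\<close>

lemma cont_closed:
  fixes w :: real
  assumes "w \<noteq> 0"
  shows "(1 + w\<^sup>2) * w ^ m * cont (1 / w - w) m = w\<^sup>2 + (- w\<^sup>2) ^ m"
proof (induction m rule: less_induct)
  case (less m)
  consider "m = 0" | "m = 1" | n where "m = Suc (Suc n)"
    by (metis One_nat_def not0_implies_Suc)
  then show ?case
  proof cases
    case 3
    have "(1 + w\<^sup>2) * w ^ m * cont (1 / w - w) m =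
      (1 - w\<^sup>2) * ((1 + w\<^sup>2) * w ^ Suc n * cont (1 / w - w) (Suc n)) + w\<^sup>2 * ((1 + w\<^sup>2) * w ^ n * cont (1 / w - w) n)"
      using assms unfolding 3 by (simp add: field_simps power2_eq_square)
    also have "\<dots> = (1 - w\<^sup>2) * (w\<^sup>2 + (- w\<^sup>2) ^ Suc n) + w\<^sup>2 * (w\<^sup>2 + (- w\<^sup>2) ^ n)"
      using less.IH[of n] less.IH[of "Suc n"] 3 by simp
    also have "\<dots> = w\<^sup>2 + (- w\<^sup>2) ^ m"
      unfolding 3 by (simp add: algebra_simps)
    finally show ?thesis .
  qed auto
qed

definition pA :: "int poly" where "pA = [:1, -1, 2:]"
definition pB :: "int poly" where "pB = [:1, 1:]"
definition pC :: "int poly" where "pC = [:2, 1, 1:]"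
definition pD :: "int poly" where "pD = [:1, 0, 1:]"
definition pM :: "int poly" where "pM = [:1, -1:]"
definition pW :: "int poly" where "pW = [:0, 1:]"

text \<open>\<open>w^k\<close> times the permanent of the cycle with diagonal
  \<open>1/w - w\<close>: the sum of the \<open>k\<close>-th powers of both roots, and 2 for the two
  orientations of the cycle.\<close>

definition cycle_poly :: "nat \<Rightarrow> int poly" where
  "cycle_poly k = 1 + 2 * pW ^ k + (- pW\<^sup>2) ^ k"

text \<open>Let \<open>P\<close> be the permanent of the cycle with entry \<open>1/w - w - 1\<close>
  at its attachment vertex and \<open>1/w - w\<close> elsewhere, and \<open>P'\<close> that of the
  cycle without this vertex. Then \<open>lolly a\<close> is \<open>(1 + w^2) w^a (P + w P')\<close>,
  the amplitude with which the cycle feeds the root \<open>1/w\<close> of an attached path.\<close>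

definition lolly :: "nat \<Rightarrow> int poly" where
  "lolly a = pA + 2 * pD * pW ^ a + (- pW\<^sup>2) ^ a * pB"

text \<open>The amplitude for the other root \<open>-w\<close>; in the notation above it is
  \<open>(1 + w^2) w^(a - 2) (P' - w P)\<close>.\<close>

definition lolly' :: "nat \<Rightarrow> int poly" where
  "lolly' a = pM - 2 * pD * pW ^ (a - 1) - (-1) ^ a * pW ^ (2 * a - 1) * pC"

text \<open>One summand for each root of the path recurrence; along the connecting path the
  contributions of the two roots differ by a power of their quotient \<open>- w^2\<close>.\<close>

definition dumbbell_poly :: "nat \<Rightarrow> nat \<Rightarrow> nat \<Rightarrow> int poly" where
  "dumbbell_poly a b r = lolly a * lolly b + (- pW\<^sup>2) ^ r * lolly' a * lolly' b"

text \<open>The three parameters count the edges of the paths, whereas \<open>r\<close> in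
  \<open>dumbbell_poly\<close> counts vertices. A theta path therefore corresponds to
  \<open>r = l + 1\<close>, and its leading term is \<open>(- w^2)^(l + 1)\<close>.\<close>

definition theta_poly :: "nat \<Rightarrow> nat \<Rightarrow> nat \<Rightarrow> int poly" where
  "theta_poly l1 l2 l3 = pA\<^sup>2 +
     2 * pD\<^sup>2 * (pW ^ (l2 + l3) * (1 - (- pW\<^sup>2) ^ l1) + pW ^ (l1 + l3) * (1 - (- pW\<^sup>2) ^ l2) + pW ^ (l1 + l2) * (1 - (- pW\<^sup>2) ^ l3)) +
     pM\<^sup>2 * ((- pW\<^sup>2) ^ (l1 + 1) + (- pW\<^sup>2) ^ (l2 + 1) + (- pW\<^sup>2) ^ (l3 + 1)) +
     pB\<^sup>2 * ((- pW\<^sup>2) ^ (l2 + l3) + (- pW\<^sup>2) ^ (l1 + l3) + (- pW\<^sup>2) ^ (l1 + l2)) -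
     pC\<^sup>2 * (- pW\<^sup>2) ^ (l1 + l2 + l3)"

lemma reval_pW [simp]: "reval pW w = w"
  and reval_pA [simp]: "reval pA w = 1 - w + 2 * w\<^sup>2"
  and reval_pB [simp]: "reval pB w = 1 + w"
  and reval_pC [simp]: "reval pC w = 2 + w + w\<^sup>2"
  and reval_pD [simp]: "reval pD w = 1 + w\<^sup>2"
  and reval_pM [simp]: "reval pM w = 1 - w"
  by (simp_all add: pA_def pB_def pC_def pD_def pM_def pW_def power2_eq_square algebra_simps)

text \<open>\<open>y\<close> and \<open>\<alpha>\<close> are the diagonal entries of vertices of
  degree 2 and 3, after writing the variable of the Laplacian polynomial as
  \<open>1/w - w + 2\<close>.\<close>

context
  fixes w y \<alpha> :: real
  assumes w: "w > 0"
  defines "y \<equiv> 1 / w - w" and "\<alpha> \<equiv> 1 / w - w - 1"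
begin

lemma cycle_value:
  "w ^ (k + 1) * (cont y (k + 2) * y + 2 * (cont y (k + 1) + 1)) = reval (cycle_poly (k + 1)) w"
proof -
  let ?p = "w ^ (k + 1)" and ?q = "(- w\<^sup>2) ^ (k + 1)"
  have "(1 + w\<^sup>2) * w ^ (k + 2) * cont y (k + 2) = w\<^sup>2 + (- w\<^sup>2) ^ (k + 2)"
    "(1 + w\<^sup>2) * w ^ (k + 1) * cont y (k + 1) = w\<^sup>2 + ?q"
    unfolding y_def using w by (intro cont_closed; simp)+
  then have c: "(1 + w\<^sup>2) * (w * ?p) * cont y (k + 2) = w\<^sup>2 - w\<^sup>2 * ?q"
    "(1 + w\<^sup>2) * ?p * cont y (k + 1) = w\<^sup>2 + ?q"
    by (simp_all add: algebra_simps)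
  have yw: "w * y = 1 - w\<^sup>2" using w by (simp add: y_def field_simps power2_eq_square)
  have "w * ((1 + w\<^sup>2) * ?p * cont y (k + 2)) = w * (w - w * ?q)"
    using c(1) by (simp only: ac_simps power2_eq_square right_diff_distrib)
  then have c1: "(1 + w\<^sup>2) * ?p * cont y (k + 2) = w - w * ?q" using w by simp
  have "(1 + w\<^sup>2) * (?p * (cont y (k + 2) * y + 2 * (cont y (k + 1) + 1))) =
      ((1 + w\<^sup>2) * ?p * cont y (k + 2)) * y + 2 * ((1 + w\<^sup>2) * ?p * cont y (k + 1)) + 2 * (1 + w\<^sup>2) * ?p"
    by (simp only: algebra_simps)
  also have "\<dots> = (1 - ?q) * (w * y) + 2 * (w\<^sup>2 + ?q) + 2 * (1 + w\<^sup>2) * ?p"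
    unfolding c1 c(2) by (simp only: algebra_simps)
  also have "\<dots> = (1 + w\<^sup>2) * (1 + 2 * ?p + ?q)"
    unfolding yw by (simp only: algebra_simps)
  finally have "(1 + w\<^sup>2) * (?p * (cont y (k + 2) * y + 2 * (cont y (k + 1) + 1))) = (1 + w\<^sup>2) * (1 + 2 * ?p + ?q)" .
  moreover have "1 + w\<^sup>2 \<noteq> 0" using w by (metis add_pos_pos less_irrefl zero_less_one zero_less_power)
  ultimately show ?thesis by (simp add: cycle_poly_def)
qed

lemma cont_values:
  fixes k :: nat
  defines "D \<equiv> 1 + w\<^sup>2" and "p \<equiv> w ^ (k + 1)" and "q \<equiv> (- w\<^sup>2) ^ (k + 1)"
  shows "D * p * cont y (k + 2) = w * (1 - q)"
    and "D * p * cont y (k + 1) = w\<^sup>2 + q"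
    and "w * (D * p * cont y k) = w ^ 4 - q"
proof -
  have c: "D * w ^ (k + 2) * cont y (k + 2) = w\<^sup>2 + (- w\<^sup>2) ^ (k + 2)"
    "D * w ^ (k + 1) * cont y (k + 1) = w\<^sup>2 + (- w\<^sup>2) ^ (k + 1)"
    "D * w ^ k * cont y k = w\<^sup>2 + (- w\<^sup>2) ^ k"
    unfolding y_def D_def using w by (intro cont_closed; simp)+
  have "w * (D * p * cont y (k + 2)) = w * (w * (1 - q))"
    using c(1) by (simp add: p_def q_def algebra_simps power2_eq_square)
  then show "D * p * cont y (k + 2) = w * (1 - q)" using w by simp
  show "D * p * cont y (k + 1) = w\<^sup>2 + q" using c(2) by (simp add: p_def q_def)
  have "w * (D * p * cont y k) = w\<^sup>2 * (D * w ^ k * cont y k)"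
    by (simp add: p_def power2_eq_square)
  also have "\<dots> = w ^ 4 - q" unfolding c(3) q_def by (simp add: algebra_simps power2_eq_square power4_eq_xxxx)
  finally show "w * (D * p * cont y k) = w ^ 4 - q" .
qed

lemma dumbbell_value:
  fixes k1 k2 k3 :: nat
  defines "c \<equiv> cont y"
  shows "w ^ (k1 + k2 + k3 + 2) * (1 + w\<^sup>2) ^ 3 *
   (c (k2 + 2) * (c (k1 + 2) * (c (k3 + 2) * \<alpha>\<^sup>2 + 2 * c (k3 + 1) * \<alpha> + c (k3 + 0)) + 2 * (c (k1 + 1) + 1) * (c (k3 + 2) * \<alpha> + c (k3 + 1))) +
    2 * (c (k2 + 1) + 1) * (c (k1 + 2) * (c (k3 + 2) * \<alpha> + c (k3 + 1)) + 2 * (c (k1 + 1) + 1) * c (k3 + 2))) =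
   reval (dumbbell_poly (k1 + 1) (k2 + 1) (k3 + 2)) w"
proof -
  define D where "D = 1 + w\<^sup>2"
  define p where "p = (\<lambda>k. w ^ (k + 1))"
  define q where "q = (\<lambda>k. (- w\<^sup>2) ^ (k + 1))"
  have c2: "D * p k * c (k + 2) = w * (1 - q k)" and c1: "D * p k * c (k + 1) = w\<^sup>2 + q k"
    and c0: "w * (D * p k * c k) = w ^ 4 - q k" for k
    using cont_values[of k] by (simp_all only: D_def p_def q_def c_def)
  have wa: "w * \<alpha> = 1 - w - w\<^sup>2" using w by (simp add: \<alpha>_def field_simps power2_eq_square)
  define x2 x1 y2 y1 z2 z1 z0 where "x2 = D * p k1 * c (k1 + 2)" and "x1 = D * p k1 * c (k1 + 1)"
    and "y2 = D * p k2 * c (k2 + 2)" and "y1 = D * p k2 * c (k2 + 1)"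
    and "z2 = D * p k3 * c (k3 + 2)" and "z1 = D * p k3 * c (k3 + 1)" and "z0 = D * p k3 * c k3"
  \<comment> \<open>The identity is proved after multiplication by \<open>w^2\<close>. One factor
    \<open>w\<close> is spent here; the other serves to clear \<open>\<alpha>\<close> and
    \<open>z0\<close>, which are polynomial in \<open>w\<close> only after multiplication by
    \<open>w\<close>.\<close>
  have pw: "w * w ^ (k1 + k2 + k3 + 2) = p k1 * p k2 * p k3" by (simp add: p_def power_add)
  have "w\<^sup>2 * (w ^ (k1 + k2 + k3 + 2) * D ^ 3 *
   (c (k2 + 2) * (c (k1 + 2) * (c (k3 + 2) * \<alpha>\<^sup>2 + 2 * c (k3 + 1) * \<alpha> + c (k3 + 0)) + 2 * (c (k1 + 1) + 1) * (c (k3 + 2) * \<alpha> + c (k3 + 1))) +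
    2 * (c (k2 + 1) + 1) * (c (k1 + 2) * (c (k3 + 2) * \<alpha> + c (k3 + 1)) + 2 * (c (k1 + 1) + 1) * c (k3 + 2)))) =
    w * ((w * w ^ (k1 + k2 + k3 + 2)) * D ^ 3 *
   (c (k2 + 2) * (c (k1 + 2) * (c (k3 + 2) * \<alpha>\<^sup>2 + 2 * c (k3 + 1) * \<alpha> + c (k3 + 0)) + 2 * (c (k1 + 1) + 1) * (c (k3 + 2) * \<alpha> + c (k3 + 1))) +
    2 * (c (k2 + 1) + 1) * (c (k1 + 2) * (c (k3 + 2) * \<alpha> + c (k3 + 1)) + 2 * (c (k1 + 1) + 1) * c (k3 + 2))))"
    by (simp only: power2_eq_square ac_simps)
  also have "\<dots> = w * (y2 * (x2 * (z2 * \<alpha>\<^sup>2 + 2 * z1 * \<alpha> + z0) + 2 * (x1 + D * p k1) * (z2 * \<alpha> + z1)) +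
    2 * (y1 + D * p k2) * (x2 * (z2 * \<alpha> + z1) + 2 * (x1 + D * p k1) * z2))"
    unfolding pw x2_def x1_def y2_def y1_def z2_def z1_def z0_def add_0_right by algebra
  also have "\<dots> = w\<^sup>2 * (reval (dumbbell_poly (k1 + 1) (k2 + 1) (k3 + 2)) w)"
  proof -
    have r: "reval (lolly (k + 1)) w = 1 - w + 2 * w\<^sup>2 + 2 * D * p k + q k * (1 + w)" for k
      by (simp add: lolly_def D_def p_def q_def)
    have r': "w * reval (lolly' (k + 1)) w = w * (1 - w) - 2 * D * p k - q k * (2 + w + w\<^sup>2)" for k
    proof -
      have "q k = (-1) ^ (k + 1) * w ^ (2 * k + 2)"
        unfolding q_def power_minus[of "w\<^sup>2"] power_mult[symmetric] by simp
      then show ?thesis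
        by (simp add: lolly'_def D_def p_def algebra_simps)
    qed
    have r'': "(- w\<^sup>2) ^ (k3 + 2) = - (w\<^sup>2 * q k3)" by (simp add: q_def)
    have "reval (dumbbell_poly (k1 + 1) (k2 + 1) (k3 + 2)) w =
      reval (lolly (k1 + 1)) w * reval (lolly (k2 + 1)) w - q k3 * (w * reval (lolly' (k1 + 1)) w) * (w * reval (lolly' (k2 + 1)) w)"
    proof -
      have "reval (dumbbell_poly (k1 + 1) (k2 + 1) (k3 + 2)) w =
        reval (lolly (k1 + 1)) w * reval (lolly (k2 + 1)) w +
        (- w\<^sup>2) ^ (k3 + 2) * reval (lolly' (k1 + 1)) w * reval (lolly' (k2 + 1)) w"
        by (simp only: dumbbell_poly_def reval_simps reval_power reval_pW)
      then show ?thesis unfolding r'' by algebra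
    qed
    also have "w\<^sup>2 * \<dots> = w * (y2 * (x2 * (z2 * \<alpha>\<^sup>2 + 2 * z1 * \<alpha> + z0) + 2 * (x1 + D * p k1) * (z2 * \<alpha> + z1)) +
    2 * (y1 + D * p k2) * (x2 * (z2 * \<alpha> + z1) + 2 * (x1 + D * p k1) * z2))"
    proof -
      have e: "x2 = w * (1 - q k1)" "x1 = w\<^sup>2 + q k1" "y2 = w * (1 - q k2)" "y1 = w\<^sup>2 + q k2"
        "z2 = w * (1 - q k3)" "z1 = w\<^sup>2 + q k3" "w * z0 = w ^ 4 - q k3"
        unfolding x2_def x1_def y2_def y1_def z2_def z1_def z0_def by (simp_all only: c2 c1 c0)
      have "w * (y2 * (x2 * (z2 * \<alpha>\<^sup>2 + 2 * z1 * \<alpha> + z0) + 2 * (x1 + D * p k1) * (z2 * \<alpha> + z1)) +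
          2 * (y1 + D * p k2) * (x2 * (z2 * \<alpha> + z1) + 2 * (x1 + D * p k1) * z2)) =
        w\<^sup>2 * ((1 - q k2) * ((1 - q k1) * ((1 - q k3) * (w * \<alpha>)\<^sup>2 + 2 * z1 * (w * \<alpha>) + w * z0) +
            2 * (x1 + D * p k1) * ((1 - q k3) * (w * \<alpha>) + z1)) +
          2 * (y1 + D * p k2) * ((1 - q k1) * ((1 - q k3) * (w * \<alpha>) + z1) + 2 * (x1 + D * p k1) * (1 - q k3)))"
        unfolding e(1,3,5) by algebra
      also have "\<dots> = w\<^sup>2 * ((1 - w + 2 * w\<^sup>2 + 2 * D * p k1 + q k1 * (1 + w)) *
          (1 - w + 2 * w\<^sup>2 + 2 * D * p k2 + q k2 * (1 + w)) -
          q k3 * (w * (1 - w) - 2 * D * p k1 - q k1 * (2 + w + w\<^sup>2)) *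
          (w * (1 - w) - 2 * D * p k2 - q k2 * (2 + w + w\<^sup>2)))"
        unfolding wa e(2,4,6,7) D_def by algebra
      finally show ?thesis unfolding r r' by simp
    qed
    finally show ?thesis by simp
  qed
  finally show ?thesis using w by (simp add: D_def)
qed

lemma theta_value:
  fixes k1 k2 k3 :: nat
  defines "c \<equiv> cont y"
  shows "w ^ (k1 + k2 + k3 + 2) * (1 + w\<^sup>2) ^ 3 *
   (c (k3 + 2) * (c (k2 + 2) * (c (k1 + 2) * \<alpha>\<^sup>2 + 2 * c (k1 + 1) * \<alpha> + c (k1 + 0)) + 2 * c (k2 + 1) * (c (k1 + 2) * \<alpha> + c (k1 + 1)) +
      c (k2 + 0) * c (k1 + 2) + 2) +
    2 * c (k3 + 1) * (c (k2 + 2) * (c (k1 + 2) * \<alpha> + c (k1 + 1)) + c (k2 + 1) * c (k1 + 2)) +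
    c (k3 + 0) * c (k2 + 2) * c (k1 + 2) + 2 * (c (k2 + 2) + c (k1 + 2))) =
   reval (theta_poly (k1 + 1) (k2 + 1) (k3 + 1)) w"
proof -
  define D where "D = 1 + w\<^sup>2"
  define p where "p = (\<lambda>k. w ^ (k + 1))"
  define q where "q = (\<lambda>k. (- w\<^sup>2) ^ (k + 1))"
  have c2: "D * p k * c (k + 2) = w * (1 - q k)" and c1: "D * p k * c (k + 1) = w\<^sup>2 + q k"
    and c0: "w * (D * p k * c k) = w ^ 4 - q k" for k
    using cont_values[of k] by (simp_all only: D_def p_def q_def c_def)
  have wa: "w * \<alpha> = 1 - w - w\<^sup>2" using w by (simp add: \<alpha>_def field_simps power2_eq_square)
  define x2 x1 x0 y2 y1 y0 z2 z1 z0 where "x2 = D * p k1 * c (k1 + 2)" and "x1 = D * p k1 * c (k1 + 1)" and "x0 = D * p k1 * c k1"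
    and "y2 = D * p k2 * c (k2 + 2)" and "y1 = D * p k2 * c (k2 + 1)" and "y0 = D * p k2 * c k2"
    and "z2 = D * p k3 * c (k3 + 2)" and "z1 = D * p k3 * c (k3 + 1)" and "z0 = D * p k3 * c k3"
  have pw: "w * w ^ (k1 + k2 + k3 + 2) = p k1 * p k2 * p k3" by (simp add: p_def power_add)
  have "w\<^sup>2 * (w ^ (k1 + k2 + k3 + 2) * D ^ 3 *
    (c (k3 + 2) * (c (k2 + 2) * (c (k1 + 2) * \<alpha>\<^sup>2 + 2 * c (k1 + 1) * \<alpha> + c (k1 + 0)) + 2 * c (k2 + 1) * (c (k1 + 2) * \<alpha> + c (k1 + 1)) +
      c (k2 + 0) * c (k1 + 2) + 2) +
    2 * c (k3 + 1) * (c (k2 + 2) * (c (k1 + 2) * \<alpha> + c (k1 + 1)) + c (k2 + 1) * c (k1 + 2)) +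
    c (k3 + 0) * c (k2 + 2) * c (k1 + 2) + 2 * (c (k2 + 2) + c (k1 + 2)))) =
    w * ((w * w ^ (k1 + k2 + k3 + 2)) * D ^ 3 *
    (c (k3 + 2) * (c (k2 + 2) * (c (k1 + 2) * \<alpha>\<^sup>2 + 2 * c (k1 + 1) * \<alpha> + c (k1 + 0)) + 2 * c (k2 + 1) * (c (k1 + 2) * \<alpha> + c (k1 + 1)) +
      c (k2 + 0) * c (k1 + 2) + 2) +
    2 * c (k3 + 1) * (c (k2 + 2) * (c (k1 + 2) * \<alpha> + c (k1 + 1)) + c (k2 + 1) * c (k1 + 2)) +
    c (k3 + 0) * c (k2 + 2) * c (k1 + 2) + 2 * (c (k2 + 2) + c (k1 + 2))))"
    by (simp only: power2_eq_square ac_simps)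
  also have "\<dots> = w * (z2 * (y2 * (x2 * \<alpha>\<^sup>2 + 2 * x1 * \<alpha> + x0) + 2 * y1 * (x2 * \<alpha> + x1) + y0 * x2 + 2 * D\<^sup>2 * p k1 * p k2) +
    2 * z1 * (y2 * (x2 * \<alpha> + x1) + y1 * x2) + z0 * y2 * x2 + 2 * (y2 * D\<^sup>2 * p k1 * p k3 + x2 * D\<^sup>2 * p k2 * p k3))"
    unfolding pw x2_def x1_def x0_def y2_def y1_def y0_def z2_def z1_def z0_def add_0_right by algebra
  also have "\<dots> = w\<^sup>2 * (reval (theta_poly (k1 + 1) (k2 + 1) (k3 + 1)) w)"
  proof -
    have th: "reval (theta_poly (k1 + 1) (k2 + 1) (k3 + 1)) w = (1 - w + 2 * w\<^sup>2)\<^sup>2 +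
     2 * D\<^sup>2 * (p k2 * p k3 * (1 - q k1) + p k1 * p k3 * (1 - q k2) + p k1 * p k2 * (1 - q k3)) +
     (1 - w)\<^sup>2 * (- w\<^sup>2 * q k1 - w\<^sup>2 * q k2 - w\<^sup>2 * q k3) +
     (1 + w)\<^sup>2 * (q k2 * q k3 + q k1 * q k3 + q k1 * q k2) -
     (2 + w + w\<^sup>2)\<^sup>2 * (q k1 * q k2 * q k3)"
      unfolding theta_poly_def p_def q_def D_def power_add[symmetric]
      by (simp add: power_add)
    have e: "x2 = w * (1 - q k1)" "x1 = w\<^sup>2 + q k1" "y2 = w * (1 - q k2)" "y1 = w\<^sup>2 + q k2"
        "z2 = w * (1 - q k3)" "z1 = w\<^sup>2 + q k3" and e0: "w * z0 = w ^ 4 - q k3" "w * x0 = w ^ 4 - q k1" "w * y0 = w ^ 4 - q k2"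
        unfolding x2_def x1_def x0_def y2_def y1_def y0_def z2_def z1_def z0_def by (simp_all only: c2 c1 c0)
    have "w * (z2 * (y2 * (x2 * \<alpha>\<^sup>2 + 2 * x1 * \<alpha> + x0) + 2 * y1 * (x2 * \<alpha> + x1) + y0 * x2 + 2 * D\<^sup>2 * p k1 * p k2) +
      2 * z1 * (y2 * (x2 * \<alpha> + x1) + y1 * x2) + z0 * y2 * x2 + 2 * (y2 * D\<^sup>2 * p k1 * p k3 + x2 * D\<^sup>2 * p k2 * p k3)) =
      w\<^sup>2 * ((1 - q k3) * ((1 - q k2) * ((1 - q k1) * (w * \<alpha>)\<^sup>2 + 2 * x1 * (w * \<alpha>) + w * x0) +
        2 * y1 * ((1 - q k1) * (w * \<alpha>) + x1) + (w * y0) * (1 - q k1) + 2 * D\<^sup>2 * p k1 * p k2) +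
      2 * z1 * ((1 - q k2) * ((1 - q k1) * (w * \<alpha>) + x1) + y1 * (1 - q k1)) + (w * z0) * (1 - q k2) * (1 - q k1) +
      2 * ((1 - q k2) * D\<^sup>2 * p k1 * p k3 + (1 - q k1) * D\<^sup>2 * p k2 * p k3))"
      unfolding e(1,3,5) by algebra
    also have "\<dots> = w\<^sup>2 * ((1 - w + 2 * w\<^sup>2)\<^sup>2 +
     2 * D\<^sup>2 * (p k2 * p k3 * (1 - q k1) + p k1 * p k3 * (1 - q k2) + p k1 * p k2 * (1 - q k3)) +
     (1 - w)\<^sup>2 * (- w\<^sup>2 * q k1 - w\<^sup>2 * q k2 - w\<^sup>2 * q k3) +
     (1 + w)\<^sup>2 * (q k2 * q k3 + q k1 * q k3 + q k1 * q k2) -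
     (2 + w + w\<^sup>2)\<^sup>2 * (q k1 * q k2 * q k3))"
      unfolding wa e(2,4,6) e0 by algebra
    finally show ?thesis by (simp only: th)
  qed
  finally show ?thesis using w by (simp add: D_def)
qed

end

section \<open>Coefficients of low order\<close>

lemma pW_power: "pW ^ n = monom 1 n"
  by (simp add: pW_def monom_altdef)

lemma coeff_pW_power: "coeff (pW ^ n) j = of_bool (j = n)"
  by (simp add: pW_power)

lemma coeff_pW_power_mult: "coeff (pW ^ n * p) j = (if j < n then 0 else coeff p (j - n))"
  by (simp add: pW_power coeff_monom_mult)

lemma coeff_pW_power_mult_add [simp]: "coeff (pW ^ n * p) (n + j) = coeff p j"
  by (simp add: coeff_pW_power_mult)

lemma pW_power_split: "g \<le> a \<Longrightarrow> pW ^ a = pW ^ g * pW ^ (a - g)"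
  by (simp add: power_add[symmetric])

lemma neg_pW2_power: "(- pW\<^sup>2) ^ r = (-1) ^ r * pW ^ (2 * r)"
  by (subst power_minus) (simp add: power_mult)

lemma coeff_neg_one_power_mult: "coeff ((-1) ^ r * p) n = (-1) ^ r * coeff p (n::nat)" for p :: "int poly"
  by (cases "even r") auto

lemma coeff_AD_mult:
  "coeff (pA * pD * p) 0 = coeff p 0"
  "coeff (pA * pD * p) 1 = coeff p 1 - coeff p 0"
  "coeff (pA * pD * p) 2 = coeff p 2 - coeff p 1 + 3 * coeff p 0"
  "coeff (pA * pD * p) 3 = coeff p 3 - coeff p 2 + 3 * coeff p 1 - coeff p 0"
  by (simp_all add: pA_def pD_def coeff_pCons eval_nat_numeral)

lemma coeff_A2_mult:
  "coeff (pA\<^sup>2 * p) 0 = coeff p 0"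
  "coeff (pA\<^sup>2 * p) 1 = coeff p 1 - 2 * coeff p 0"
  "coeff (pA\<^sup>2 * p) 2 = coeff p 2 - 2 * coeff p 1 + 5 * coeff p 0"
  "coeff (pA\<^sup>2 * p) 3 = coeff p 3 - 2 * coeff p 2 + 5 * coeff p 1 - 4 * coeff p 0"
  by (simp_all add: pA_def power2_eq_square coeff_pCons eval_nat_numeral)

lemma coeff_D2_mult:
  "coeff (pD\<^sup>2 * p) 0 = coeff p 0"
  "coeff (pD\<^sup>2 * p) 1 = coeff p 1"
  "coeff (pD\<^sup>2 * p) 2 = coeff p 2 + 2 * coeff p 0"
  "coeff (pD\<^sup>2 * p) 3 = coeff p 3 + 2 * coeff p 1"
  by (simp_all add: pD_def power2_eq_square coeff_pCons eval_nat_numeral)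

lemma coeff_0_simps:
  "coeff pA 0 = 1" "coeff pB 0 = 1" "coeff pC 0 = 2" "coeff pD 0 = 1" "coeff pM 0 = 1" "coeff (pW ^ n) 0 = of_bool (n = 0)"
  "coeff (2 :: int poly) 0 = 2" "coeff (4 :: int poly) 0 = 4"
  by (auto simp: pA_def pB_def pC_def pD_def pM_def coeff_pW_power numeral_poly)

text \<open>A path term \<open>(- w^2)^r (1 - w)^2\<close> lives in the orders \<open>2 r\<close> to
  \<open>2 r + 2\<close> only, with coefficients 1, -2, 1 up to sign.\<close>

definition path_coeff :: "nat \<Rightarrow> nat \<Rightarrow> int" where
  "path_coeff r n = (-1) ^ r * (of_bool (n = 2 * r) - 2 * of_bool (n = 2 * r + 1) + of_bool (n = 2 * r + 2))"

lemma coeff_path: "coeff ((- pW\<^sup>2) ^ r * pM\<^sup>2) n = path_coeff r n"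
proof -
  have M2: "pM\<^sup>2 = 1 - 2 * pW + pW\<^sup>2"
    by (simp add: pM_def pW_def power2_eq_square numeral_poly one_pCons)
  have "(- pW\<^sup>2) ^ r * pM\<^sup>2 = (-1) ^ r * (pW ^ (2 * r) - 2 * pW ^ (2 * r + 1) + pW ^ (2 * r + 2))"
    unfolding neg_pW2_power power_add M2 by (simp only: algebra_simps power_one_right)
  then show ?thesis
    unfolding path_coeff_def by (simp add: coeff_neg_one_power_mult coeff_pW_power numeral_poly del: power_Suc)
qed

text \<open>Up to order \<open>g + 3\<close>, for \<open>g \<ge> 3\<close>, the quadratic terms of the products below only
  matter for \<open>g = 3\<close>; there they are a function of the number of cycles of length \<open>g\<close>.\<close>

definition quad :: "nat \<Rightarrow> int \<Rightarrow> int" where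
  "quad g x = of_bool (g = 3) * (2 * x\<^sup>2 - 3 * x)"

definition cyc_sum :: "nat \<Rightarrow> nat list \<Rightarrow> int poly" where
  "cyc_sum g ks = (\<Sum>k\<leftarrow>ks. pW ^ (k - g))"

lemma cyc_sum_simps [simp]: "cyc_sum g [] = 0" "cyc_sum g (k # ks) = pW ^ (k - g) + cyc_sum g ks"
  by (simp_all add: cyc_sum_def)

lemma coeff_cyc_sum: "\<forall>k\<in>set ks. g \<le> k \<Longrightarrow> coeff (cyc_sum g ks) j = int (count_list ks (g + j))"
  by (induction ks) (auto simp: coeff_pW_power)

text \<open>The term \<open>(- w^2)^k\<close> has order \<open>2 k\<close>, which is at least
  \<open>g + 3\<close>, with equality only for \<open>g = k = 3\<close>.\<close>

lemma cycle_poly_head: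
  assumes "3 \<le> g" "g \<le> k"
  obtains n where "cycle_poly k = 1 + pW ^ g * (2 * pW ^ (k - g) + pW ^ 3 * n)"
    "coeff n 0 = quad g (of_bool (k = g))"
proof
  let ?n = "(-1) ^ k * pW ^ (2 * k - g - 3) :: int poly"
  have "pW ^ (2 * k) = pW ^ g * (pW ^ 3 * pW ^ (2 * k - g - 3))"
    using assms by (simp add: power_add[symmetric])
  then show "cycle_poly k = 1 + pW ^ g * (2 * pW ^ (k - g) + pW ^ 3 * ?n)"
    unfolding cycle_poly_def neg_pW2_power using assms by (simp add: pW_power_split[of g k] algebra_simps)
  show "coeff ?n 0 = quad g (of_bool (k = g))"
  proof (cases "g = 3 \<and> k = 3")
    case False
    then have "2 * k - g - 3 \<noteq> 0" "\<not> (g = 3 \<and> k = g)" using assms by auto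
    then show ?thesis by (auto simp: coeff_neg_one_power_mult coeff_mult_0 coeff_0_simps quad_def)
  qed (auto simp: coeff_neg_one_power_mult coeff_pW_power quad_def)
qed

text \<open>For \<open>x\<close> triangles, order 6 receives -1 from each term
  \<open>(- w^2)^3\<close> and 4 from each pair of terms \<open>2 w^3\<close>, in total
  \<open>2 x^2 - 3 x\<close>. Joining two collections adds the mixed pairs.\<close>

lemma quad_add: "quad g (x + y) = quad g x + quad g y + 4 * of_bool (g = 3) * x * y"
  by (simp add: quad_def power2_eq_square algebra_simps)

lemma prod_cycle_poly_head:
  assumes "3 \<le> g" "\<forall>k\<in>set ks. g \<le> k"
  obtains n where "prod_list (map cycle_poly ks) = 1 + pW ^ g * (2 * cyc_sum g ks + pW ^ 3 * n)"
    "coeff n 0 = quad g (int (count_list ks g))"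
  using assms(2)
proof (induction ks arbitrary: thesis)
  case Nil
  show ?case by (rule Nil.prems(1)[of 0]) (simp_all add: quad_def)
next
  case (Cons k ks)
  obtain n where n: "prod_list (map cycle_poly ks) = 1 + pW ^ g * (2 * cyc_sum g ks + pW ^ 3 * n)"
    "coeff n 0 = quad g (int (count_list ks g))"
    using Cons.IH Cons.prems(2) by (metis list.set_intros(2))
  have "g \<le> k" using Cons.prems(2) by simp
  obtain m where m: "cycle_poly k = 1 + pW ^ g * (2 * pW ^ (k - g) + pW ^ 3 * m)"
    "coeff m 0 = quad g (of_bool (k = g))"
    using cycle_poly_head[OF assms(1) \<open>g \<le> k\<close>] .
  let ?p = "2 * pW ^ (k - g) + pW ^ 3 * m" and ?q = "2 * cyc_sum g ks + pW ^ 3 * n"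
  have g: "pW ^ g = pW ^ 3 * pW ^ (g - 3)" using pW_power_split[OF assms(1)] .
  show ?case
  proof (rule Cons.prems(1))
    show "prod_list (map cycle_poly (k # ks)) =
        1 + pW ^ g * (2 * cyc_sum g (k # ks) + pW ^ 3 * (m + n + pW ^ (g - 3) * ?p * ?q))"
      unfolding list.map prod_list.Cons n(1) m(1) cyc_sum_simps g by (simp only: algebra_simps)
    show "coeff (m + n + pW ^ (g - 3) * ?p * ?q) 0 = quad g (int (count_list (k # ks) g))"
      using n(2) m(2) coeff_cyc_sum[of ks g 0] Cons.prems(2) assms(1)
        quad_add[of g "of_bool (k = g)" "int (count_list ks g)"]
      by (auto simp: coeff_mult_0 coeff_0_simps add.commute)
  qed
qed

lemma lolly_head:
  assumes "3 \<le> g" "g \<le> a"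
  obtains n where "lolly a = pA + pW ^ g * (2 * pD * pW ^ (a - g) + pW ^ 3 * n)"
    "coeff n 0 = quad g (of_bool (a = g))"
proof
  let ?n = "(-1) ^ a * (pW ^ (2 * a - g - 3) * pB) :: int poly"
  have "pW ^ (2 * a) = pW ^ g * (pW ^ 3 * pW ^ (2 * a - g - 3))"
    using assms by (simp add: power_add[symmetric])
  then show "lolly a = pA + pW ^ g * (2 * pD * pW ^ (a - g) + pW ^ 3 * ?n)"
    unfolding lolly_def neg_pW2_power using assms by (simp add: pW_power_split[of g a] algebra_simps)
  show "coeff ?n 0 = quad g (of_bool (a = g))"
  proof (cases "g = 3 \<and> a = 3")
    case False
    then have "2 * a - g - 3 \<noteq> 0" "\<not> (g = 3 \<and> a = g)" using assms by auto
    then show ?thesis by (auto simp: coeff_neg_one_power_mult coeff_mult_0 coeff_0_simps quad_def)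
  qed (auto simp: coeff_neg_one_power_mult coeff_mult_0 coeff_0_simps coeff_pW_power quad_def)
qed

lemma lolly'_head:
  assumes "3 \<le> g" "g \<le> a"
  obtains n where "lolly' a = pM - pW ^ (g - 1) * n" "coeff n 0 = 2 * of_bool (a = g)"
proof
  let ?n = "2 * pD * pW ^ (a - g) + (-1) ^ a * (pW ^ (2 * a - g) * pC) :: int poly"
  have "pW ^ (2 * a - 1) = pW ^ (g - 1) * pW ^ (2 * a - g)" "pW ^ (a - 1) = pW ^ (g - 1) * pW ^ (a - g)"
    using assms by (simp_all add: power_add[symmetric])
  then show "lolly' a = pM - pW ^ (g - 1) * ?n"
    unfolding lolly'_def by (simp add: algebra_simps)
  show "coeff ?n 0 = 2 * of_bool (a = g)"
    using assms by (auto simp: coeff_neg_one_power_mult coeff_mult_0 coeff_0_simps)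
qed

text \<open>A mixed term of the path and a lollipop cycle of length \<open>g\<close> has order
  \<open>2 r + g - 1\<close>. It reaches \<open>g + 3\<close> exactly for \<open>r = 2\<close>,
  which explains the correction in the last coefficient.\<close>

lemma dumbbell_poly_head:
  assumes "3 \<le> g" "g \<le> a" "g \<le> b" "2 \<le> r"
  obtains n where "dumbbell_poly a b r = pA\<^sup>2 + (- pW\<^sup>2) ^ r * pM\<^sup>2 +
      pW ^ g * (2 * (pA * pD * (pW ^ (a - g) + pW ^ (b - g))) + pW ^ 3 * n)"
    "coeff n 0 = quad g (of_bool (a = g) + of_bool (b = g)) - 2 * of_bool (r = 2) * (of_bool (a = g) + of_bool (b = g))"
proof -
  obtain na where na: "lolly a = pA + pW ^ g * (2 * pD * pW ^ (a - g) + pW ^ 3 * na)" "coeff na 0 = quad g (of_bool (a = g))"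
    using lolly_head[OF assms(1,2)] .
  obtain nb where nb: "lolly b = pA + pW ^ g * (2 * pD * pW ^ (b - g) + pW ^ 3 * nb)" "coeff nb 0 = quad g (of_bool (b = g))"
    using lolly_head[OF assms(1,3)] .
  obtain ma where ma: "lolly' a = pM - pW ^ (g - 1) * ma" "coeff ma 0 = 2 * of_bool (a = g)"
    using lolly'_head[OF assms(1,2)] .
  obtain mb where mb: "lolly' b = pM - pW ^ (g - 1) * mb" "coeff mb 0 = 2 * of_bool (b = g)"
    using lolly'_head[OF assms(1,3)] .
  let ?p = "2 * pD * pW ^ (a - g) + pW ^ 3 * na" and ?q = "2 * pD * pW ^ (b - g) + pW ^ 3 * nb"
  let ?s = "(-1) ^ r * (pW ^ (2 * r - 4) * (pW ^ (g - 1) * ma * mb - pM * (ma + mb))) :: int poly"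
  let ?n = "pA * (na + nb) + pW ^ (g - 3) * ?p * ?q + ?s"
  have g: "pW ^ g = pW ^ 3 * pW ^ (g - 3)" using pW_power_split[OF assms(1)] .
  have pq: "(- pW\<^sup>2) ^ r * pW ^ (g - 1) = (-1) ^ r * (pW ^ g * (pW ^ 3 * pW ^ (2 * r - 4)))"
    unfolding neg_pW2_power mult.assoc power_add[symmetric]
    using assms by (intro arg_cong2[where f = "(*)"] arg_cong2[where f="(^)"] refl) auto
  \<comment> \<open>An identity for arbitrary ring elements, so that \<open>algebra\<close> does not
    meet powers with variable exponents; the premise is the only relation between them that is
    needed.\<close>
  have gen: "P * (M - Q * x) * (M - Q * y) = P * M\<^sup>2 + G * (T * (e * (U * (Q * x * y - M * (x + y)))))"
    if "P * Q = e * (G * (T * U))" for P Q G T e U M x y :: "int poly"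
    using that by algebra
  have s: "(- pW\<^sup>2) ^ r * lolly' a * lolly' b = (- pW\<^sup>2) ^ r * pM\<^sup>2 + pW ^ g * (pW ^ 3 * ?s)"
    unfolding ma(1) mb(1) by (rule gen[OF pq])
  have "lolly a * lolly b = pA\<^sup>2 + pW ^ g * (2 * (pA * pD * (pW ^ (a - g) + pW ^ (b - g))) +
      pW ^ 3 * (pA * (na + nb) + pW ^ (g - 3) * ?p * ?q))"
  proof -
    have gen: "(A + G * (2 * D * x + T * u)) * (A + G * (2 * D * y + T * v)) =
        A\<^sup>2 + G * (2 * (A * D * (x + y)) + T * (A * (u + v) + H * (2 * D * x + T * u) * (2 * D * y + T * v)))"
      if "G = T * H" for A G D T H x y u v :: "int poly"
      using that by algebra
    show ?thesis unfolding na(1) nb(1) by (rule gen[OF g])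
  qed
  then have "dumbbell_poly a b r = pA\<^sup>2 + (- pW\<^sup>2) ^ r * pM\<^sup>2 +
      pW ^ g * (2 * (pA * pD * (pW ^ (a - g) + pW ^ (b - g))) + pW ^ 3 * ?n)"
    unfolding dumbbell_poly_def s by (simp only: algebra_simps)
  moreover have "coeff ?n 0 = quad g (of_bool (a = g) + of_bool (b = g)) - 2 * of_bool (r = 2) * (of_bool (a = g) + of_bool (b = g))"
    using assms na(2) nb(2) ma(2) mb(2)
    by (auto simp: coeff_neg_one_power_mult coeff_mult_0 coeff_0_simps quad_add)
  ultimately show ?thesis by (rule that)
qed

section \<open>Congruence modulo 2 and square roots\<close>

definition eq2 :: "int poly \<Rightarrow> int poly \<Rightarrow> bool" where
  "eq2 p q \<longleftrightarrow> 2 dvd p - q"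

lemma eq2_refl [simp]: "eq2 p p"
  by (simp add: eq2_def)

lemma eq2_sym: "eq2 p q \<Longrightarrow> eq2 q p"
  unfolding eq2_def by (metis dvd_minus_iff minus_diff_eq)

lemma eq2_trans [trans]: "eq2 p q \<Longrightarrow> eq2 q r \<Longrightarrow> eq2 p r"
  unfolding eq2_def using dvd_add by fastforce

lemma eq2_add: "eq2 p q \<Longrightarrow> eq2 p' q' \<Longrightarrow> eq2 (p + p') (q + q')"
  unfolding eq2_def by (metis add_diff_add dvd_add)

lemma eq2_mult: "eq2 p q \<Longrightarrow> eq2 p' q' \<Longrightarrow> eq2 (p * p') (q * q')"
proof -
  assume "eq2 p q" "eq2 p' q'"
  then have "2 dvd (p - q) * p' + q * (p' - q')" unfolding eq2_def by auto
  then show ?thesis unfolding eq2_def by (simp add: algebra_simps)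
qed

lemma eq2_power: "eq2 p q \<Longrightarrow> eq2 (p ^ n) (q ^ n)"
  by (induction n) (auto intro: eq2_mult)

lemma eq2_minus: "eq2 (- p) p"
proof -
  have "- p - p = 2 * (- p)" by simp
  then show ?thesis unfolding eq2_def by (metis dvd_triv_left)
qed

lemma eq2_diff: "eq2 p q \<Longrightarrow> eq2 p' q' \<Longrightarrow> eq2 (p - p') (q + q')"
  using eq2_add[of p q "- p'" q'] eq2_trans[OF eq2_minus[of p']] by simp

lemma eq2_add_double: "eq2 p q \<Longrightarrow> eq2 (p + 2 * r) q"
  using eq2_add[of p q "2 * r" 0] by (simp add: eq2_def)

lemma eq2_square_add: "eq2 ((p + q)\<^sup>2) (p\<^sup>2 + q\<^sup>2)"
  unfolding eq2_def power2_sum by (simp add: mult.assoc)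

lemma prime_elem_2_poly: "prime_elem (2 :: int poly)"
  unfolding numeral_poly prime_elem_const_poly_iff by (simp add: prime_imp_prime_elem)

text \<open>Modulo 2, \<open>p^2 - q^2\<close> agrees with \<open>(p - q)^2\<close>, and 2 is a
  prime element of the integer polynomials.\<close>

lemma eq2_square_cancel: "eq2 (p\<^sup>2) (q\<^sup>2) \<Longrightarrow> eq2 p q"
proof -
  assume "eq2 (p\<^sup>2) (q\<^sup>2)"
  then have "2 dvd (p\<^sup>2 - q\<^sup>2) - 2 * (q * (p - q))"
    unfolding eq2_def by (rule dvd_diff) (rule dvd_triv_left)
  also have "(p\<^sup>2 - q\<^sup>2) - 2 * (q * (p - q)) = (p - q) * (p - q)" by algebra
  finally show "eq2 p q"
    unfolding eq2_def prime_elem_dvd_mult_iff[OF prime_elem_2_poly] by simp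
qed

lemma eq2_mult_cancel: "eq2 (c * p) (c * q) \<Longrightarrow> odd (coeff c n) \<Longrightarrow> eq2 p q"
proof -
  assume *: "eq2 (c * p) (c * q)" and n: "odd (coeff c n)"
  have "\<not> 2 dvd c"
    using n unfolding numeral_poly const_poly_dvd_iff by auto
  moreover have "2 dvd c * (p - q)" using * by (simp add: eq2_def algebra_simps)
  ultimately show ?thesis
    unfolding eq2_def prime_elem_dvd_mult_iff[OF prime_elem_2_poly] by simp
qed

lemma eq2_coeff: "eq2 p q \<Longrightarrow> even (coeff p n - coeff q n)"
  unfolding eq2_def numeral_poly const_poly_dvd_iff by simp

lemma eq2_neg_pW2_power: "eq2 ((- pW\<^sup>2) ^ r) ((pW ^ r)\<^sup>2)"
  using eq2_power[OF eq2_minus, of "pW\<^sup>2" r] by (simp add: power_mult[symmetric] mult.commute)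

text \<open>Modulo 2 the constants collapse to \<open>1 + w\<close>, up to a factor \<open>w\<close>
  in \<open>pC\<close>. This is why \<open>lolly\<close> and \<open>lolly'\<close> become congruent
  and the dumbbell polynomial becomes a product.\<close>

lemma eq2_head: "eq2 pA (1 + pW)" "eq2 pB (1 + pW)" "eq2 pM (1 + pW)" "eq2 pC (pW * (1 + pW))"
proof -
  have "pA - (1 + pW) = 2 * [:0, -1, 1:]" "pB - (1 + pW) = 0" "pM - (1 + pW) = 2 * [:0, -1:]"
    "pC - pW * (1 + pW) = 2 * 1"
    by (simp_all add: pA_def pB_def pM_def pC_def pW_def numeral_poly one_pCons)
  then show "eq2 pA (1 + pW)" "eq2 pB (1 + pW)" "eq2 pM (1 + pW)" "eq2 pC (pW * (1 + pW))"
    unfolding eq2_def by (metis dvd_0_right dvd_triv_left)+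
qed

abbreviation U :: "nat \<Rightarrow> int poly" where "U k \<equiv> 1 + pW ^ k"

lemma eq2_U_square: "eq2 (1 + (pW ^ k)\<^sup>2) ((U k)\<^sup>2)"
  using eq2_sym[OF eq2_square_add[of 1 "pW ^ k"]] by simp

lemma eq2_cycle_poly: "eq2 (cycle_poly k) ((U k)\<^sup>2)"
proof -
  have "cycle_poly k = (1 + (- pW\<^sup>2) ^ k) + 2 * pW ^ k" by (simp add: cycle_poly_def)
  also have "eq2 \<dots> (1 + (pW ^ k)\<^sup>2)"
    by (intro eq2_add_double eq2_add eq2_refl eq2_neg_pW2_power)
  also have "eq2 \<dots> ((U k)\<^sup>2)" by (rule eq2_U_square)
  finally show ?thesis .
qed

lemma eq2_prod_cycle_poly: "eq2 (prod_list (map cycle_poly ks)) ((prod_list (map U ks))\<^sup>2)"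
  by (induction ks) (auto simp: power_mult_distrib intro!: eq2_mult eq2_cycle_poly)

lemma eq2_lolly: "eq2 (lolly a) ((1 + pW) * (U a)\<^sup>2)"
proof -
  have "lolly a = (pA + (- pW\<^sup>2) ^ a * pB) + 2 * (pD * pW ^ a)" by (simp add: lolly_def)
  also have "eq2 \<dots> ((1 + pW) + (pW ^ a)\<^sup>2 * (1 + pW))"
    by (intro eq2_add_double eq2_add eq2_mult eq2_neg_pW2_power eq2_head)
  also have "\<dots> = (1 + pW) * (1 + (pW ^ a)\<^sup>2)" by (simp add: algebra_simps)
  also have "eq2 \<dots> ((1 + pW) * (U a)\<^sup>2)" by (intro eq2_mult eq2_refl eq2_U_square)
  finally show ?thesis .
qed

lemma eq2_lolly':
  assumes "0 < a"
  shows "eq2 (lolly' a) ((1 + pW) * (U a)\<^sup>2)"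
proof -
  have s: "eq2 ((-1) ^ a * p) p" for p
    using eq2_minus[of p] by (cases "even a") auto
  have "lolly' a = (pM - (-1) ^ a * (pW ^ (2 * a - 1) * pC)) + 2 * (- pD * pW ^ (a - 1))"
    by (simp add: lolly'_def algebra_simps)
  also have "eq2 \<dots> ((1 + pW) + pW ^ (2 * a - 1) * (pW * (1 + pW)))"
    by (intro eq2_add_double eq2_diff eq2_trans[OF s] eq2_mult eq2_refl eq2_head)
  also have "pW ^ (2 * a - 1) * (pW * (1 + pW)) = (pW ^ a)\<^sup>2 * (1 + pW)"
  proof -
    have "pW ^ (2 * a - 1) * pW = pW ^ (2 * a)"
      using assms by (metis mult_pos_pos pos2 power_minus_mult)
    then show ?thesis by (simp add: mult.assoc[symmetric] power_mult mult.commute[of 2])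
  qed
  also have "(1 + pW) + (pW ^ a)\<^sup>2 * (1 + pW) = (1 + pW) * (1 + (pW ^ a)\<^sup>2)" by (simp add: algebra_simps)
  also have "eq2 \<dots> ((1 + pW) * (U a)\<^sup>2)" by (intro eq2_mult eq2_refl eq2_U_square)
  finally show ?thesis .
qed

text \<open>Since \<open>lolly\<close> and \<open>lolly'\<close> agree modulo 2, the two summands of
  the dumbbell polynomial share all their factors except the path factor and add up to a multiple of
  \<open>1 + w^(2 r)\<close>, again a square.\<close>

lemma eq2_dumbbell_poly:
  assumes "0 < a" "0 < b"
  shows "eq2 (dumbbell_poly a b r) (((1 + pW) * (U a * U b * U r))\<^sup>2)"
proof -
  let ?p = "((1 + pW) * (U a)\<^sup>2) * ((1 + pW) * (U b)\<^sup>2)"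
  have "eq2 (dumbbell_poly a b r) (?p + (pW ^ r)\<^sup>2 * ((1 + pW) * (U a)\<^sup>2) * ((1 + pW) * (U b)\<^sup>2))"
    unfolding dumbbell_poly_def
    by (intro eq2_add eq2_mult eq2_neg_pW2_power eq2_lolly eq2_lolly' assms)
  also have "?p + (pW ^ r)\<^sup>2 * ((1 + pW) * (U a)\<^sup>2) * ((1 + pW) * (U b)\<^sup>2) = ?p * (1 + (pW ^ r)\<^sup>2)"
    by (simp add: algebra_simps)
  also have "eq2 \<dots> (?p * (U r)\<^sup>2)" by (intro eq2_mult eq2_refl eq2_U_square)
  also have "?p * (U r)\<^sup>2 = ((1 + pW) * (U a * U b * U r))\<^sup>2"
    by (simp only: power_mult_distrib power2_eq_square ac_simps)
  finally show ?thesis .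
qed

definition theta_root :: "nat \<Rightarrow> nat \<Rightarrow> nat \<Rightarrow> int poly" where
  "theta_root l1 l2 l3 = 1 + (pW ^ (l1 + 1) + pW ^ (l2 + 1) + pW ^ (l3 + 1)) +
     (pW ^ (l2 + l3) + pW ^ (l1 + l3) + pW ^ (l1 + l2)) + pW ^ (l1 + l2 + l3 + 1)"

text \<open>The terms with \<open>2 pD^2\<close> vanish. The others are \<open>(1 + w)^2\<close>
  times a sum of squares, and modulo 2 a sum of squares is the square of the sum.\<close>

lemma eq2_theta_poly: "eq2 (theta_poly l1 l2 l3) (((1 + pW) * theta_root l1 l2 l3)\<^sup>2)"
proof -
  let ?q = "\<lambda>n. (- pW\<^sup>2) ^ n" and ?s = "\<lambda>n. (pW ^ n)\<^sup>2" and ?B = "(1 + pW)\<^sup>2"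
  have 3: "eq2 (?q i + ?q j + ?q k) (?s i + ?s j + ?s k)" for i j k
    by (intro eq2_add eq2_neg_pW2_power)
  note sq = eq2_head[THEN eq2_power[where n = 2]]
  have a: "theta_poly l1 l2 l3 = (pA\<^sup>2 + pM\<^sup>2 * (?q (l1 + 1) + ?q (l2 + 1) + ?q (l3 + 1)) +
      pB\<^sup>2 * (?q (l2 + l3) + ?q (l1 + l3) + ?q (l1 + l2)) - pC\<^sup>2 * ?q (l1 + l2 + l3)) +
      2 * (pD\<^sup>2 * (pW ^ (l2 + l3) * (1 - ?q l1) + pW ^ (l1 + l3) * (1 - ?q l2) + pW ^ (l1 + l2) * (1 - ?q l3)))"
    unfolding theta_poly_def by (simp only: algebra_simps)
  have b: "eq2 ((pA\<^sup>2 + pM\<^sup>2 * (?q (l1 + 1) + ?q (l2 + 1) + ?q (l3 + 1)) +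
      pB\<^sup>2 * (?q (l2 + l3) + ?q (l1 + l3) + ?q (l1 + l2)) - pC\<^sup>2 * ?q (l1 + l2 + l3)) +
      2 * (pD\<^sup>2 * (pW ^ (l2 + l3) * (1 - ?q l1) + pW ^ (l1 + l3) * (1 - ?q l2) + pW ^ (l1 + l2) * (1 - ?q l3)))) (?B + ?B * (?s (l1 + 1) + ?s (l2 + 1) + ?s (l3 + 1)) +
      ?B * (?s (l2 + l3) + ?s (l1 + l3) + ?s (l1 + l2)) + (pW * (1 + pW))\<^sup>2 * ?s (l1 + l2 + l3))"
    by (rule eq2_add_double, rule eq2_diff, rule eq2_add, rule eq2_add, rule sq(1), rule eq2_mult, rule sq(3), rule 3,
      rule eq2_mult, rule sq(2), rule 3, rule eq2_mult, rule sq(4), rule eq2_neg_pW2_power)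
  have c: "?B + ?B * (?s (l1 + 1) + ?s (l2 + 1) + ?s (l3 + 1)) +
      ?B * (?s (l2 + l3) + ?s (l1 + l3) + ?s (l1 + l2)) + (pW * (1 + pW))\<^sup>2 * ?s (l1 + l2 + l3) = ?B * ((1\<^sup>2 + (?s (l1 + 1) + ?s (l2 + 1) + ?s (l3 + 1)) +
      (?s (l2 + l3) + ?s (l1 + l3) + ?s (l1 + l2))) + ?s (l1 + l2 + l3 + 1))"
  proof -
    have e: "?s (l1 + l2 + l3 + 1) = pW\<^sup>2 * ?s (l1 + l2 + l3)"
      by (subst Suc_eq_plus1[symmetric], subst power_Suc, rule power_mult_distrib)
    show ?thesis unfolding e power_mult_distrib[of pW "1 + pW"] by (simp only: distrib_left one_power2 mult_1_right ac_simps)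
  qed
  have d: "eq2 (?B * ((1\<^sup>2 + (?s (l1 + 1) + ?s (l2 + 1) + ?s (l3 + 1)) +
      (?s (l2 + l3) + ?s (l1 + l3) + ?s (l1 + l2))) + ?s (l1 + l2 + l3 + 1))) (?B * (theta_root l1 l2 l3)\<^sup>2)"
  proof (rule eq2_mult[OF eq2_refl], rule eq2_sym)
    have sq3: "eq2 ((x + y + z)\<^sup>2) (x\<^sup>2 + y\<^sup>2 + z\<^sup>2)" for x y z
      by (rule eq2_trans[OF eq2_square_add]) (intro eq2_add eq2_square_add eq2_refl)
    have "eq2 ((x + (y1 + y2 + y3) + (z1 + z2 + z3) + u)\<^sup>2)
      (x\<^sup>2 + (y1\<^sup>2 + y2\<^sup>2 + y3\<^sup>2) + (z1\<^sup>2 + z2\<^sup>2 + z3\<^sup>2) + u\<^sup>2)" for x y1 y2 y3 z1 z2 z3 u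
      by (rule eq2_trans[OF eq2_square_add], intro eq2_add eq2_refl, rule eq2_trans[OF sq3], intro eq2_add sq3 eq2_refl)
    then show "eq2 ((theta_root l1 l2 l3)\<^sup>2) (1\<^sup>2 + (?s (l1 + 1) + ?s (l2 + 1) + ?s (l3 + 1)) +
      (?s (l2 + l3) + ?s (l1 + l3) + ?s (l1 + l2)) + ?s (l1 + l2 + l3 + 1))"
      unfolding theta_root_def .
  qed
  have e: "?B * (theta_root l1 l2 l3)\<^sup>2 = ((1 + pW) * theta_root l1 l2 l3)\<^sup>2"
    by (simp add: power_mult_distrib)
  show ?thesis
    using eq2_trans[OF b[unfolded c] d] unfolding a e .
qed

lemma eq2_root_cancel:
  assumes "eq2 p (((1 + pW) * q)\<^sup>2)" "eq2 p' (((1 + pW) * q')\<^sup>2)" "p = p' * prod_list (map cycle_poly ks)"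
  shows "eq2 q (q' * prod_list (map U ks))"
proof -
  have "eq2 (((1 + pW) * q)\<^sup>2) p" by (rule eq2_sym[OF assms(1)])
  also have "eq2 p (((1 + pW) * q')\<^sup>2 * (prod_list (map U ks))\<^sup>2)"
    unfolding assms(3) by (intro eq2_mult assms(2) eq2_prod_cycle_poly)
  also have "\<dots> = ((1 + pW) * (q' * prod_list (map U ks)))\<^sup>2"
    by (simp only: power_mult_distrib ac_simps)
  finally have "eq2 ((1 + pW) * q) ((1 + pW) * (q' * prod_list (map U ks)))"
    by (rule eq2_square_cancel)
  moreover have "odd (coeff (1 + pW) 0)" by (simp add: pW_def)
  ultimately show ?thesis by (rule eq2_mult_cancel)
qed

lemma prod_U_head:
  assumes "0 < g" "\<forall>k\<in>set ks. g \<le> k"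
  obtains n where "prod_list (map U ks) = 1 + pW ^ g * n" "coeff n 0 = int (count_list ks g)"
  using assms(2)
proof (induction ks arbitrary: thesis)
  case Nil
  show ?case by (rule Nil.prems(1)[of 0]) simp_all
next
  case (Cons k ks)
  obtain n where n: "prod_list (map U ks) = 1 + pW ^ g * n" "coeff n 0 = int (count_list ks g)"
    using Cons.IH Cons.prems(2) by (metis list.set_intros(2))
  have k: "pW ^ k = pW ^ g * pW ^ (k - g)" using Cons.prems(2) by (intro pW_power_split) simp
  show ?case
  proof (rule Cons.prems(1))
    show "prod_list (map U (k # ks)) = 1 + pW ^ g * (n + pW ^ (k - g) + pW ^ g * (pW ^ (k - g) * n))"
      unfolding list.map prod_list.Cons n(1) k by (simp only: algebra_simps)
    show "coeff (n + pW ^ (k - g) + pW ^ g * (pW ^ (k - g) * n)) 0 = int (count_list (k # ks) g)"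
      using n(2) Cons.prems(2) assms(1) by (auto simp: coeff_mult_0 coeff_0_simps)
  qed
qed

lemma U_pair_head:
  assumes "0 < g" "g \<le> a" "g \<le> b"
  obtains n where "U a * U b = 1 + pW ^ g * n" "coeff n 0 = of_bool (a = g) + of_bool (b = g)"
proof -
  have "\<forall>k\<in>set [a, b]. g \<le> k" using assms by simp
  from prod_U_head[OF assms(1) this] obtain n where
    "prod_list (map U [a, b]) = 1 + pW ^ g * n" "coeff n 0 = int (count_list [a, b] g)" .
  then show ?thesis using that[of n] by (simp split: if_splits)
qed

section \<open>Dumbbells against dumbbells with additional cycles\<close>

lemma coeff_low:
  assumes "e \<le> g"
  shows "coeff (p + pW ^ g * q) e = coeff p e + of_bool (e = g) * coeff q 0"
  using assms by (auto simp: coeff_pW_power_mult)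

lemma coeff_U: "0 < e \<Longrightarrow> coeff (U r) e = of_bool (r = e)"
  by (auto simp: coeff_pW_power)

definition lolly_count :: "nat \<Rightarrow> nat \<Rightarrow> nat \<Rightarrow> int" where
  "lolly_count a b n = of_bool (a = n) + of_bool (b = n)"

lemma coeff_lolly_sum:
  "g \<le> a \<Longrightarrow> g \<le> b \<Longrightarrow> coeff (pW ^ (a - g) + pW ^ (b - g)) j = lolly_count a b (g + j)"
  by (auto simp: coeff_pW_power lolly_count_def)

lemma coeff_pW3_mult:
  "coeff (pW ^ 3 * p) 0 = 0" "coeff (pW ^ 3 * p) 1 = 0" "coeff (pW ^ 3 * p) 2 = 0" "coeff (pW ^ 3 * p) 3 = coeff p 0"
  by (simp_all add: coeff_pW_power_mult)

lemma coeff_double: "coeff (2 * p) n = 2 * coeff (p :: int poly) n"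
  by (simp add: numeral_poly)

text \<open>The list \<open>rs\<close> is \<open>[r]\<close> for a dumbbell and contains the three
  path lengths plus 1 for a theta graph. Since every member is at least 2, products of path and
  cycle terms have order at least \<open>g + 4\<close> and do not reach the coefficients
  considered.\<close>

lemma mult_cycles_head:
  assumes "3 \<le> g" "\<forall>k\<in>set ks. g \<le> k" "\<forall>i\<in>set rs. 2 \<le> i"
    and "p = pA\<^sup>2 + (\<Sum>i\<leftarrow>rs. (- pW\<^sup>2) ^ i * pM\<^sup>2) + pW ^ g * (2 * q + pW ^ 3 * n)"
  obtains n' where "p * prod_list (map cycle_poly ks) = pA\<^sup>2 + (\<Sum>i\<leftarrow>rs. (- pW\<^sup>2) ^ i * pM\<^sup>2) +
      pW ^ g * (2 * (q + pA\<^sup>2 * cyc_sum g ks) + pW ^ 3 * n')"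
    "coeff n' 0 = coeff n 0 + quad g (int (count_list ks g)) + 4 * of_bool (g = 3) * coeff q 0 * int (count_list ks g)"
proof -
  obtain z where z: "prod_list (map cycle_poly ks) = 1 + pW ^ g * (2 * cyc_sum g ks + pW ^ 3 * z)"
    "coeff z 0 = quad g (int (count_list ks g))"
    using prod_cycle_poly_head[OF assms(1,2)] .
  let ?Q = "2 * cyc_sum g ks + pW ^ 3 * z" and ?P = "2 * q + pW ^ 3 * n"
  have g: "pW ^ g = pW ^ 3 * pW ^ (g - 3)" using pW_power_split[OF assms(1)] .
  have "\<exists>s. (\<Sum>i\<leftarrow>rs. (- pW\<^sup>2) ^ i * pM\<^sup>2) = pW ^ 3 * s \<and> coeff s 0 = 0"
    using assms(3)
  proof (induction rs)
    case Nil
    show ?case by (rule exI[of _ 0]) simp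
  next
    case (Cons i rs)
    then obtain s where s: "(\<Sum>i\<leftarrow>rs. (- pW\<^sup>2) ^ i * pM\<^sup>2) = pW ^ 3 * s" "coeff s 0 = 0" by auto
    have i: "pW ^ (2 * i) = pW ^ 3 * pW ^ (2 * i - 3)" using Cons.prems by (intro pW_power_split) simp
    have "(- pW\<^sup>2) ^ i * pM\<^sup>2 = pW ^ 3 * ((-1) ^ i * (pW ^ (2 * i - 3) * pM\<^sup>2))"
      unfolding neg_pW2_power i by (simp only: ac_simps)
    then have "(\<Sum>i\<leftarrow>i # rs. (- pW\<^sup>2) ^ i * pM\<^sup>2) = pW ^ 3 * ((-1) ^ i * (pW ^ (2 * i - 3) * pM\<^sup>2) + s)"
      by (simp only: list.map sum_list.Cons s(1) distrib_left)
    moreover have "coeff ((-1) ^ i * (pW ^ (2 * i - 3) * pM\<^sup>2) + s) 0 = 0"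
      using s(2) Cons.prems by (simp add: coeff_neg_one_power_mult coeff_mult_0 coeff_0_simps)
    ultimately show ?case by blast
  qed
  then obtain s where s: "(\<Sum>i\<leftarrow>rs. (- pW\<^sup>2) ^ i * pM\<^sup>2) = pW ^ 3 * s" "coeff s 0 = 0" by auto
  let ?n = "n + pA\<^sup>2 * z + s * ?Q + pW ^ (g - 3) * ?P * ?Q"
  have gen: "(A + T * s + G * (2 * q + T * n)) * (1 + G * (2 * c + T * z)) =
      A + T * s + G * (2 * (q + A * c) + T * (n + A * z + s * (2 * c + T * z) + H * (2 * q + T * n) * (2 * c + T * z)))"
    if "G = T * H" for A T s G q n c z H :: "int poly"
    using that by algebra
  have "p * prod_list (map cycle_poly ks) = pA\<^sup>2 + (\<Sum>i\<leftarrow>rs. (- pW\<^sup>2) ^ i * pM\<^sup>2) +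
      pW ^ g * (2 * (q + pA\<^sup>2 * cyc_sum g ks) + pW ^ 3 * ?n)"
    unfolding assms(4) z(1) s(1) by (rule gen[OF g])
  moreover have "coeff ?n 0 = coeff n 0 + quad g (int (count_list ks g)) + 4 * of_bool (g = 3) * coeff q 0 * int (count_list ks g)"
    using z(2) s(2) assms(1) coeff_cyc_sum[OF assms(2), of 0]
    by (auto simp: coeff_mult_0 coeff_0_simps power2_eq_square)
  ultimately show ?thesis by (rule that)
qed

lemma coeff_paths: "coeff (\<Sum>i\<leftarrow>rs. (- pW\<^sup>2) ^ i * pM\<^sup>2) n = (\<Sum>i\<leftarrow>rs. path_coeff i n)"
  by (induction rs) (simp_all add: coeff_path)

lemma head_coeff_eq:
  assumes "pA\<^sup>2 + (\<Sum>i\<leftarrow>rs. (- pW\<^sup>2) ^ i * pM\<^sup>2) + pW ^ g * (2 * p + pW ^ 3 * n) =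
     pA\<^sup>2 + (\<Sum>i\<leftarrow>rs'. (- pW\<^sup>2) ^ i * pM\<^sup>2) + pW ^ g * (2 * q + pW ^ 3 * n')"
  shows "(\<Sum>i\<leftarrow>rs. path_coeff i g) + 2 * coeff p 0 = (\<Sum>i\<leftarrow>rs'. path_coeff i g) + 2 * coeff q 0"
    "(\<Sum>i\<leftarrow>rs. path_coeff i (g + 1)) + 2 * coeff p 1 = (\<Sum>i\<leftarrow>rs'. path_coeff i (g + 1)) + 2 * coeff q 1"
    "(\<Sum>i\<leftarrow>rs. path_coeff i (g + 2)) + 2 * coeff p 2 = (\<Sum>i\<leftarrow>rs'. path_coeff i (g + 2)) + 2 * coeff q 2"
    "(\<Sum>i\<leftarrow>rs. path_coeff i (g + 3)) + 2 * coeff p 3 + coeff n 0 =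
     (\<Sum>i\<leftarrow>rs'. path_coeff i (g + 3)) + 2 * coeff q 3 + coeff n' 0"
proof -
  have "coeff (pA\<^sup>2 + (\<Sum>i\<leftarrow>rs. (- pW\<^sup>2) ^ i * pM\<^sup>2) + pW ^ g * (2 * p + pW ^ 3 * n)) (g + j) =
     coeff (pA\<^sup>2 + (\<Sum>i\<leftarrow>rs'. (- pW\<^sup>2) ^ i * pM\<^sup>2) + pW ^ g * (2 * q + pW ^ 3 * n')) (g + j)" for j
    by (simp only: assms)
  then have j: "(\<Sum>i\<leftarrow>rs. path_coeff i (g + j)) + (2 * coeff p j + coeff (pW ^ 3 * n) j) =
     (\<Sum>i\<leftarrow>rs'. path_coeff i (g + j)) + (2 * coeff q j + coeff (pW ^ 3 * n') j)" for j
    unfolding coeff_add coeff_paths coeff_pW_power_mult_add coeff_double by (simp add: add.assoc)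
  show "(\<Sum>i\<leftarrow>rs. path_coeff i g) + 2 * coeff p 0 = (\<Sum>i\<leftarrow>rs'. path_coeff i g) + 2 * coeff q 0"
    using j[of 0] unfolding coeff_pW3_mult by simp
  show "(\<Sum>i\<leftarrow>rs. path_coeff i (g + 1)) + 2 * coeff p 1 = (\<Sum>i\<leftarrow>rs'. path_coeff i (g + 1)) + 2 * coeff q 1"
    using j[of 1] unfolding coeff_pW3_mult by simp
  show "(\<Sum>i\<leftarrow>rs. path_coeff i (g + 2)) + 2 * coeff p 2 = (\<Sum>i\<leftarrow>rs'. path_coeff i (g + 2)) + 2 * coeff q 2"
    using j[of 2] unfolding coeff_pW3_mult by simp
  show "(\<Sum>i\<leftarrow>rs. path_coeff i (g + 3)) + 2 * coeff p 3 + coeff n 0 =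
     (\<Sum>i\<leftarrow>rs'. path_coeff i (g + 3)) + 2 * coeff q 3 + coeff n' 0"
    using j[of 3] unfolding coeff_pW3_mult by simp
qed

lemma path_coeff_0: "n < 2 * r \<Longrightarrow> path_coeff r n = 0"
  by (simp add: path_coeff_def)

text \<open>In the square root modulo 2 a path shows at order \<open>r\<close> rather than
  \<open>2 r\<close>, and cycles show no earlier than \<open>g\<close>. Path orders up to
  \<open>g\<close> can thus be compared before they matter in the integer coefficients.\<close>

lemma root_parity_dumbbell:
  assumes "eq2 (U a * U b * U r) (U a' * U b' * U r' * prod_list (map U ks))"
    and "0 < r" "0 < r'" "0 < e" "e \<le> g" "g \<le> a" "g \<le> b" "g \<le> a'" "g \<le> b'" "\<forall>k\<in>set ks. g \<le> k"
  shows "even (of_bool (r = e) - of_bool (r' = e) +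
    of_bool (e = g) * (lolly_count a b g - lolly_count a' b' g - int (count_list ks g)))"
proof -
  have g: "0 < g" using assms by simp
  obtain m where m: "U a * U b = 1 + pW ^ g * m" "coeff m 0 = of_bool (a = g) + of_bool (b = g)"
    using U_pair_head[OF g assms(6,7)] .
  obtain m' where m': "U a' * U b' = 1 + pW ^ g * m'" "coeff m' 0 = of_bool (a' = g) + of_bool (b' = g)"
    using U_pair_head[OF g assms(8,9)] .
  obtain n where n: "prod_list (map U ks) = 1 + pW ^ g * n" "coeff n 0 = int (count_list ks g)"
    using prod_U_head[OF g assms(10)] .
  have c1: "coeff (U a * U b * U r) e = of_bool (r = e) + of_bool (e = g) * (coeff m 0 * coeff (U r) 0)"
  proof -
    have "U a * U b * U r = U r + pW ^ g * (m * U r)" unfolding m(1) by (simp only: algebra_simps)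
    then show ?thesis using assms(4,5) by (simp only: coeff_low coeff_U coeff_mult_0)
  qed
  have c2: "coeff (U a' * U b' * U r' * prod_list (map U ks)) e =
      of_bool (r' = e) + of_bool (e = g) * ((coeff m' 0 + coeff n 0) * coeff (U r') 0)"
  proof -
    have "U a' * U b' * U r' * prod_list (map U ks) = U r' + pW ^ g * ((m' + n + pW ^ g * (m' * n)) * U r')"
      unfolding m'(1) n(1) by (simp only: algebra_simps)
    moreover have "coeff ((m' + n + pW ^ g * (m' * n)) * U r') 0 = (coeff m' 0 + coeff n 0) * coeff (U r') 0"
      using g unfolding coeff_mult_0 coeff_add[of "m' + n"] coeff_add[of m'] by (simp add: coeff_pW_power)
    ultimately show ?thesis using assms(4,5) by (simp only: coeff_low coeff_U)
  qed
  have ev: "even (coeff (U a * U b * U r) e - coeff (U a' * U b' * U r' * prod_list (map U ks)) e)"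
    by (rule eq2_coeff[OF assms(1)])
  have one: "coeff (U r) 0 = 1" "coeff (U r') 0 = 1"
    using assms(2,3) by (simp_all add: coeff_pW_power)
  have eq: "coeff (U a * U b * U r) e - coeff (U a' * U b' * U r' * prod_list (map U ks)) e =
    of_bool (r = e) - of_bool (r' = e) +
    of_bool (e = g) * (lolly_count a b g - lolly_count a' b' g - int (count_list ks g))"
    unfolding c1 c2 m(2) m'(2) n(2) one lolly_count_def by (simp only: algebra_simps)
  show ?thesis using ev unfolding eq .
qed

lemma lolly_count_bounds:
  "0 \<le> lolly_count a b n" "lolly_count a b n \<le> 2"
  by (auto simp: lolly_count_def)

lemma lolly_count_rest:
  assumes "distinct [n1, n2, n3]"
  shows "lolly_count a b n1 + lolly_count a b n2 + lolly_count a b n3 \<le> 2"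
  using assms by (auto simp: lolly_count_def)

lemma path_cases:
  fixes r r' N :: nat
  assumes "\<And>e. 0 < e \<Longrightarrow> e \<le> N \<Longrightarrow> even (of_bool (r = e) - of_bool (r' = e) :: int)" "0 < r" "0 < r'"
  shows "r = r' \<or> (N < r \<and> N < r')"
proof (cases "r = r'")
  case False
  have "N < r"
    using assms(1)[of r] assms(2) False by (cases "r \<le> N") auto
  moreover have "N < r'"
    using assms(1)[of r'] assms(3) False by (cases "r' \<le> N") auto
  ultimately show ?thesis by simp
qed simp

text \<open>The key obstruction: an unmatched lollipop cycle of length \<open>g\<close> would have to be matched by a
  cycle component, and then the coefficient of order \<open>g + 3\<close> forces a negative number of cycle
  components of length \<open>g + 3\<close>.\<close>

lemma dumbbell_common_cycle:
  assumes E: "dumbbell_poly a b r = dumbbell_poly a' b' r' * prod_list (map cycle_poly ks)"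
    and ge: "3 \<le> g" "g \<le> a" "g \<le> b" "g \<le> a'" "g \<le> b'" "\<forall>k\<in>set ks. g \<le> k" and r: "2 \<le> r" "2 \<le> r'"
    and att: "g = a \<or> g = b \<or> g = a' \<or> g = b' \<or> g \<in> set ks"
  shows "{a, b} \<inter> {a', b'} \<noteq> {}"
proof
  assume disj: "{a, b} \<inter> {a', b'} = {}"
  define \<mu> where "\<mu> = (\<lambda>j. lolly_count a b (g + j))"
  define \<nu> where "\<nu> = (\<lambda>j. lolly_count a' b' (g + j))"
  define \<kappa> where "\<kappa> = (\<lambda>j. int (count_list ks (g + j)))"
  have R: "eq2 (U a * U b * U r) (U a' * U b' * U r' * prod_list (map U ks))"
    using eq2_dumbbell_poly[of a b r] eq2_dumbbell_poly[of a' b' r'] ge by (intro eq2_root_cancel[OF _ _ E]) auto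
  note par = root_parity_dumbbell[OF R _ _ _ _ ge(2-6)]
  obtain n where n: "dumbbell_poly a b r = pA\<^sup>2 + (- pW\<^sup>2) ^ r * pM\<^sup>2 +
      pW ^ g * (2 * (pA * pD * (pW ^ (a - g) + pW ^ (b - g))) + pW ^ 3 * n)"
    "coeff n 0 = quad g (of_bool (a = g) + of_bool (b = g)) - 2 * of_bool (r = 2) * (of_bool (a = g) + of_bool (b = g))"
    using dumbbell_poly_head[OF ge(1-3) r(1)] .
  obtain n' where n': "dumbbell_poly a' b' r' = pA\<^sup>2 + (- pW\<^sup>2) ^ r' * pM\<^sup>2 +
      pW ^ g * (2 * (pA * pD * (pW ^ (a' - g) + pW ^ (b' - g))) + pW ^ 3 * n')"
    "coeff n' 0 = quad g (of_bool (a' = g) + of_bool (b' = g)) - 2 * of_bool (r' = 2) * (of_bool (a' = g) + of_bool (b' = g))"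
    using dumbbell_poly_head[OF ge(1,4,5) r(2)] .
  have n'': "dumbbell_poly a' b' r' = pA\<^sup>2 + (\<Sum>i\<leftarrow>[r']. (- pW\<^sup>2) ^ i * pM\<^sup>2) +
      pW ^ g * (2 * (pA * pD * (pW ^ (a' - g) + pW ^ (b' - g))) + pW ^ 3 * n')"
    using n'(1) by simp
  have r2: "\<forall>i\<in>set [r']. 2 \<le> i" using r by simp
  obtain z where z: "dumbbell_poly a' b' r' * prod_list (map cycle_poly ks) = pA\<^sup>2 + (\<Sum>i\<leftarrow>[r']. (- pW\<^sup>2) ^ i * pM\<^sup>2) +
      pW ^ g * (2 * (pA * pD * (pW ^ (a' - g) + pW ^ (b' - g)) + pA\<^sup>2 * cyc_sum g ks) + pW ^ 3 * z)"
    "coeff z 0 = coeff n' 0 + quad g (int (count_list ks g)) +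
      4 * of_bool (g = 3) * coeff (pA * pD * (pW ^ (a' - g) + pW ^ (b' - g))) 0 * int (count_list ks g)"
    using mult_cycles_head[OF ge(1,6) r2 n''] .
  have "pA\<^sup>2 + (\<Sum>i\<leftarrow>[r]. (- pW\<^sup>2) ^ i * pM\<^sup>2) +
      pW ^ g * (2 * (pA * pD * (pW ^ (a - g) + pW ^ (b - g))) + pW ^ 3 * n) = pA\<^sup>2 + (\<Sum>i\<leftarrow>[r']. (- pW\<^sup>2) ^ i * pM\<^sup>2) +
      pW ^ g * (2 * (pA * pD * (pW ^ (a' - g) + pW ^ (b' - g)) + pA\<^sup>2 * cyc_sum g ks) + pW ^ 3 * z)"
    using E n(1) z(1) by simp
  note eqs = head_coeff_eq[OF this, unfolded coeff_add[of "pA * pD * _"] coeff_AD_mult coeff_A2_mult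
      coeff_lolly_sum[OF ge(2,3)] coeff_lolly_sum[OF ge(4,5)] coeff_cyc_sum[OF ge(6)]]
  have c: "path_coeff r g + 2 * \<mu> 0 = path_coeff r' g + 2 * (\<nu> 0 + \<kappa> 0)"
    "path_coeff r (g + 1) + 2 * (\<mu> 1 - \<mu> 0) = path_coeff r' (g + 1) + 2 * (\<nu> 1 - \<nu> 0 + (\<kappa> 1 - 2 * \<kappa> 0))"
    "path_coeff r (g + 2) + 2 * (\<mu> 2 - \<mu> 1 + 3 * \<mu> 0) =
      path_coeff r' (g + 2) + 2 * (\<nu> 2 - \<nu> 1 + 3 * \<nu> 0 + (\<kappa> 2 - 2 * \<kappa> 1 + 5 * \<kappa> 0))"
    "path_coeff r (g + 3) + 2 * (\<mu> 3 - \<mu> 2 + 3 * \<mu> 1 - \<mu> 0) + coeff n 0 =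
      path_coeff r' (g + 3) + 2 * (\<nu> 3 - \<nu> 2 + 3 * \<nu> 1 - \<nu> 0 + (\<kappa> 3 - 2 * \<kappa> 2 + 5 * \<kappa> 1 - 4 * \<kappa> 0)) + coeff z 0"
    using eqs by (simp_all add: \<mu>_def \<nu>_def \<kappa>_def)
  have n0: "coeff n 0 = quad g (\<mu> 0) - 2 * of_bool (r = 2) * \<mu> 0"
    using n(2) by (simp add: \<mu>_def lolly_count_def)
  have z0: "coeff z 0 = quad g (\<nu> 0 + \<kappa> 0) - 2 * of_bool (r' = 2) * \<nu> 0"
  proof -
    have "coeff n' 0 = quad g (\<nu> 0) - 2 * of_bool (r' = 2) * \<nu> 0"
      unfolding n'(2) by (simp add: \<nu>_def lolly_count_def)
    moreover have "coeff (pA * pD * (pW ^ (a' - g) + pW ^ (b' - g))) 0 = \<nu> 0" "int (count_list ks g) = \<kappa> 0"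
      unfolding coeff_AD_mult coeff_lolly_sum[OF ge(4,5)] by (simp_all add: \<nu>_def \<kappa>_def)
    ultimately show ?thesis unfolding z(2) quad_add[of g "\<nu> 0"] by simp
  qed
  \<comment> \<open>At order \<open>g\<close> the parity relation still involves the cycles, so only
    smaller orders are used. This suffices for the integer coefficient at \<open>g\<close>: if the
    path orders differ, both are at least \<open>g\<close> and their terms start at
    \<open>2 g\<close> or later.\<close>
  have "r = r' \<or> (g - 1 < r \<and> g - 1 < r')"
  proof (rule path_cases)
    fix e assume "0 < e" "e \<le> g - 1"
    moreover from this have "e \<noteq> g" "e \<le> g" using ge(1) by auto
    ultimately show "even (of_bool (r = e) - of_bool (r' = e) :: int)"
      using par[of e] r ge(1) by simp
  qed (use r in auto)
  then have "path_coeff r g = path_coeff r' g"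
    using ge(1) by (auto simp: path_coeff_0)
  then have m0: "\<mu> 0 = \<nu> 0 + \<kappa> 0" using c(1) by simp
  have m0': "lolly_count a b g - lolly_count a' b' g - int (count_list ks g) = 0"
    using m0 by (simp add: \<mu>_def \<nu>_def \<kappa>_def)
  \<comment> \<open>By \<open>m0'\<close> the cycles drop out of the parity relation at order
    \<open>g\<close>, so it can be used there too. Different path orders now exceed
    \<open>g\<close>, and their terms start beyond \<open>g + 3\<close>.\<close>
  have "r = r' \<or> (g < r \<and> g < r')"
  proof (rule path_cases)
    fix e assume "0 < e" "e \<le> g"
    then show "even (of_bool (r = e) - of_bool (r' = e) :: int)"
      using par[of e] r unfolding m0' by simp
  qed (use r in auto)
  then have p: "path_coeff r (g + j) = path_coeff r' (g + j)" if "j \<le> 3" for j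
    using ge(1) that by (auto simp: path_coeff_0)
  have pos: "0 \<le> \<kappa> j" "0 \<le> \<nu> j" for j
    by (simp_all add: \<kappa>_def \<nu>_def lolly_count_bounds)
  have "\<mu> 0 = 0 \<or> \<nu> 0 = 0"
    using disj by (auto simp: \<mu>_def \<nu>_def lolly_count_def)
  \<comment> \<open>Some cycle of length \<open>g\<close> occurs by \<open>att\<close>; by
    \<open>m0\<close> one on the right-hand side forces a lollipop cycle of length \<open>g\<close>
    on the left.\<close>
  moreover have "\<mu> 0 > 0"
  proof -
    have "\<mu> 0 > 0 \<or> \<nu> 0 > 0 \<or> \<kappa> 0 > 0"
      using att by (auto simp: \<mu>_def \<nu>_def \<kappa>_def lolly_count_def count_list_0_iff)
    then show ?thesis using m0 pos[of 0] by linarith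
  qed
  ultimately have nu0: "\<nu> 0 = 0" by auto
  define X where "X = 2 * of_bool (r = 2) * \<mu> 0"
  have "\<mu> 0 + \<mu> 2 + \<mu> 3 \<le> 2"
    using lolly_count_rest[of "g + 0" "g + 2" "g + 3" a b] by (simp add: \<mu>_def)
  \<comment> \<open>Elimination of \<open>\<kappa> 1\<close> and \<open>\<kappa> 2\<close>; the
    coefficients 1, 1, 0, -2 of \<open>pD / pA\<close> appear at \<open>\<mu> 3\<close>,
    \<open>\<mu> 2\<close>, \<open>\<mu> 1\<close>, \<open>\<mu> 0\<close>. The quadratic terms
    cancel by \<open>m0\<close>. At most two lollipop cycles are available, so
    \<open>\<kappa> 3\<close> is negative.\<close>
  moreover have "2 * \<kappa> 3 = 2 * (\<mu> 2 + \<mu> 3 - \<nu> 2 - \<nu> 3 - 2 * \<mu> 0) - X"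
    using c(2-4) m0 nu0 p[of 1] p[of 2] p[of 3] n0 z0 unfolding X_def by simp
  moreover have "0 \<le> X" using \<open>\<mu> 0 > 0\<close> by (simp add: X_def)
  moreover have "1 \<le> \<mu> 0" "0 \<le> \<kappa> 3" "0 \<le> \<nu> 2" "0 \<le> \<nu> 3" using \<open>\<mu> 0 > 0\<close> pos by auto
  ultimately show False by (smt (verit))
qed

lemma coeff_pW_0: "coeff pW 0 = 0"
  by (simp add: pW_def)

lemma coeff_mult_low:
  "coeff (p * q) 0 = coeff p 0 * coeff q 0"
  "coeff (p * q) 1 = coeff p 0 * coeff q 1 + coeff p 1 * coeff q 0"
  "coeff (p * q) 2 = coeff p 0 * coeff q 2 + coeff p 1 * coeff q 1 + coeff p 2 * coeff q 0"
  "coeff (p * q) 3 = coeff p 0 * coeff q 3 + coeff p 1 * coeff q 2 + coeff p 2 * coeff q 1 + coeff p 3 * coeff q 0"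
  by (simp_all add: coeff_mult numeral_eq_Suc)

lemma coeff_A_mult:
  "coeff (pA * p) 0 = coeff p 0"
  "coeff (pA * p) 1 = coeff p 1 - coeff p 0"
  "coeff (pA * p) 2 = coeff p 2 - coeff p 1 + 2 * coeff p 0"
  "coeff (pA * p) 3 = coeff p 3 - coeff p 2 + 2 * coeff p 1"
  by (simp_all add: pA_def coeff_pCons eval_nat_numeral)

lemma coeff_D_mult:
  "coeff (pD * p) 0 = coeff p 0"
  "coeff (pD * p) 1 = coeff p 1"
  "coeff (pD * p) 2 = coeff p 2 + coeff p 0"
  "coeff (pD * p) 3 = coeff p 3 + coeff p 1"
  by (simp_all add: pD_def coeff_pCons eval_nat_numeral)

lemma lolly_coeff_0: "0 < a \<Longrightarrow> coeff (lolly a) 0 = 1"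
  and lolly'_coeff_0: "1 < a \<Longrightarrow> coeff (lolly' a) 0 = 1"
proof -
  assume "0 < a"
  then show "coeff (lolly a) 0 = 1"
    unfolding lolly_def neg_pW2_power
    by (simp add: coeff_neg_one_power_mult coeff_mult_0 coeff_0_simps mult.assoc)
next
  assume "1 < a"
  then show "coeff (lolly' a) 0 = 1"
    unfolding lolly'_def
    by (simp add: coeff_neg_one_power_mult coeff_mult_0 coeff_0_simps mult.assoc)
qed

lemma root_parity_lolly:
  assumes "eq2 (U b * U r) (U b' * U r' * prod_list (map U ks))"
    and "0 < r" "0 < r'" "0 < e" "e \<le> g" "g \<le> b" "g \<le> b'" "\<forall>k\<in>set ks. g \<le> k"
  shows "even (of_bool (r = e) - of_bool (r' = e) +
    of_bool (e = g) * (of_bool (b = g) - of_bool (b' = g) - int (count_list ks g)))"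
proof -
  \<comment> \<open>A dummy cycle longer than \<open>g\<close> on both sides reduces the claim to
    the relation for two cycles without changing the counts at \<open>g\<close>.\<close>
  let ?a = "g + 1"
  have "eq2 (U ?a * (U b * U r)) (U ?a * (U b' * U r' * prod_list (map U ks)))"
    by (rule eq2_mult[OF eq2_refl assms(1)])
  then have "eq2 (U ?a * U b * U r) (U ?a * U b' * U r' * prod_list (map U ks))"
    by (simp only: mult.assoc)
  from root_parity_dumbbell[OF this assms(2-5) _ assms(6) _ assms(7,8)] show ?thesis
    by (simp add: lolly_count_def)
qed

lemma lolly_diff_head:
  assumes "3 \<le> g" "g \<le> b" "g \<le> b'" "\<forall>k\<in>set ks. g \<le> k"
  obtains n where "lolly b - lolly b' * prod_list (map cycle_poly ks) =
      pW ^ g * (2 * (pD * (pW ^ (b - g) - pW ^ (b' - g)) - pA * cyc_sum g ks) + pW ^ 3 * n)"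
    "coeff n 0 = quad g (of_bool (b = g)) - quad g (of_bool (b' = g) + int (count_list ks g))"
proof -
  obtain n where n: "lolly b = pA + pW ^ g * (2 * pD * pW ^ (b - g) + pW ^ 3 * n)" "coeff n 0 = quad g (of_bool (b = g))"
    using lolly_head[OF assms(1,2)] .
  obtain n' where n': "lolly b' = pA + pW ^ g * (2 * pD * pW ^ (b' - g) + pW ^ 3 * n')" "coeff n' 0 = quad g (of_bool (b' = g))"
    using lolly_head[OF assms(1,3)] .
  obtain z where z: "prod_list (map cycle_poly ks) = 1 + pW ^ g * (2 * cyc_sum g ks + pW ^ 3 * z)"
    "coeff z 0 = quad g (int (count_list ks g))"
    using prod_cycle_poly_head[OF assms(1,4)] .
  have g: "pW ^ g = pW ^ 3 * pW ^ (g - 3)" using pW_power_split[OF assms(1)] .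
  let ?P = "2 * pD * pW ^ (b' - g) + pW ^ 3 * n'" and ?Q = "2 * cyc_sum g ks + pW ^ 3 * z"
  have gen: "A + G * (2 * D * x + T * n) - (A + G * (2 * D * x' + T * n')) * (1 + G * (2 * c + T * z)) =
    G * (2 * (D * (x - x') - A * c) + T * (n - n' - A * z - H * (2 * D * x' + T * n') * (2 * c + T * z)))"
    if "G = T * H" for A G D x T n x' n' c z H :: "int poly"
    using that by algebra
  have "lolly b - lolly b' * prod_list (map cycle_poly ks) =
      pW ^ g * (2 * (pD * (pW ^ (b - g) - pW ^ (b' - g)) - pA * cyc_sum g ks) +
        pW ^ 3 * (n - n' - pA * z - pW ^ (g - 3) * ?P * ?Q))"
    unfolding n(1) n'(1) z(1) by (rule gen[OF g])
  moreover have "coeff (n - n' - pA * z - pW ^ (g - 3) * ?P * ?Q) 0 =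
      quad g (of_bool (b = g)) - quad g (of_bool (b' = g) + int (count_list ks g))"
    using n(2) n'(2) z(2) assms(1,3) coeff_cyc_sum[OF assms(4), of 0] quad_add[of g "of_bool (b' = g)" "int (count_list ks g)"]
    by (auto simp: coeff_mult_0 coeff_0_simps)
  ultimately show ?thesis by (rule that)
qed

text \<open>The shared cycle may be shorter than \<open>g\<close>, so the expansion above order
  \<open>g\<close> does not apply to the whole polynomials. Instead the equation is grouped by the
  factors \<open>lolly a\<close> and \<open>lolly' a\<close>, whose constant coefficient 1 lets the
  lowest orders of the cofactors be compared; modulo 2 the factor of the shared cycle
  cancels.\<close>

lemma dumbbell_second_cycle:
  assumes E: "dumbbell_poly a b r = dumbbell_poly a b' r' * prod_list (map cycle_poly ks)"
    and a: "3 \<le> a" and ge: "3 \<le> g" "g \<le> b" "g \<le> b'" "\<forall>k\<in>set ks. g \<le> k" and r: "2 \<le> r" "2 \<le> r'"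
    and att: "g = b \<or> g = b' \<or> g \<in> set ks"
  shows "b = b'"
proof (rule ccontr)
  assume ne: "b \<noteq> b'"
  let ?Z = "prod_list (map cycle_poly ks)"
  define L where "L = (\<lambda>j. of_bool (b = g + j) - of_bool (b' = g + j) :: int)"
  define \<kappa> where "\<kappa> = (\<lambda>j. int (count_list ks (g + j)))"
  have "eq2 (U a * U b * U r) (U a * U b' * U r' * prod_list (map U ks))"
    using eq2_dumbbell_poly[of a b r] eq2_dumbbell_poly[of a b' r'] ge a by (intro eq2_root_cancel[OF _ _ E]) auto
  then have "eq2 (U a * (U b * U r)) (U a * (U b' * U r' * prod_list (map U ks)))"
    by (simp only: mult.assoc)
  moreover have "odd (coeff (U a) 0)" using a by (simp add: coeff_pW_power)
  ultimately have R: "eq2 (U b * U r) (U b' * U r' * prod_list (map U ks))"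
    by (rule eq2_mult_cancel)
  note par = root_parity_lolly[OF R _ _ _ _ ge(2-4)]
  obtain n where n: "lolly b - lolly b' * ?Z =
      pW ^ g * (2 * (pD * (pW ^ (b - g) - pW ^ (b' - g)) - pA * cyc_sum g ks) + pW ^ 3 * n)"
    "coeff n 0 = quad g (of_bool (b = g)) - quad g (of_bool (b' = g) + int (count_list ks g))"
    using lolly_diff_head[OF ge] .
  let ?Y = "pD * (pW ^ (b - g) - pW ^ (b' - g)) - pA * cyc_sum g ks"
  have dL: "coeff (pW ^ (b - g) - pW ^ (b' - g)) j = L j" for j
    using ge(2,3) by (auto simp: coeff_pW_power L_def)
  have Y: "coeff ?Y 0 = L 0 - \<kappa> 0" "coeff ?Y 1 = L 1 - (\<kappa> 1 - \<kappa> 0)"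
      "coeff ?Y 2 = L 2 + L 0 - (\<kappa> 2 - \<kappa> 1 + 2 * \<kappa> 0)" "coeff ?Y 3 = L 3 + L 1 - (\<kappa> 3 - \<kappa> 2 + 2 * \<kappa> 1)"
    unfolding coeff_diff[of "pD * _"] coeff_D_mult coeff_A_mult dL coeff_cyc_sum[OF ge(4)] \<kappa>_def by simp_all
  have X0: "coeff (lolly a) 0 = 1" using a by (simp add: lolly_coeff_0)
  have main: "lolly a * (lolly b - lolly b' * ?Z) + lolly' a * ((- pW\<^sup>2) ^ r * lolly' b - (- pW\<^sup>2) ^ r' * lolly' b' * ?Z) = 0"
  proof -
    have gen: "x * (b - c * z) + x' * (\<rho> * b' - \<rho>' * c' * z) = 0"
      if "x * b + \<rho> * x' * b' = (x * c + \<rho>' * x' * c') * z" for x x' b b' c c' z \<rho> \<rho>' :: "int poly"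
      using that by algebra
    show ?thesis by (rule gen[OF E[unfolded dumbbell_poly_def]])
  qed
  have kap: "0 \<le> \<kappa> j" for j by (simp add: \<kappa>_def)
  have rr: "r = r' \<or> (g - 1 < r \<and> g - 1 < r')"
  proof (rule path_cases)
    fix e assume "0 < e" "e \<le> g - 1"
    moreover from this have "e \<noteq> g" "e \<le> g" using ge(1) by auto
    ultimately show "even (of_bool (r = e) - of_bool (r' = e) :: int)"
      using par[of e] r ge(1) by simp
  qed (use r in auto)
  obtain u where u: "lolly' b = pM - pW ^ (g - 1) * u" "coeff u 0 = 2 * of_bool (b = g)"
    using lolly'_head[OF ge(1,2)] .
  obtain u' where u': "lolly' b' = pM - pW ^ (g - 1) * u'" "coeff u' 0 = 2 * of_bool (b' = g)"
    using lolly'_head[OF ge(1,3)] .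
  obtain z where z: "?Z = 1 + pW ^ g * (2 * cyc_sum g ks + pW ^ 3 * z)"
    using prod_cycle_poly_head[OF ge(1,4)] by blast
  let ?c = "2 * cyc_sum g ks + pW ^ 3 * z"
  \<comment> \<open>For equal path orders the leading terms \<open>pM\<close> cancel, and the
    difference starts at order \<open>2 r + g - 1\<close>, at least \<open>g + 3\<close>.\<close>
  have path: "\<exists>s. (- pW\<^sup>2) ^ r * lolly' b - (- pW\<^sup>2) ^ r' * lolly' b' * ?Z = pW ^ g * (pW ^ 3 * s) \<and>
      coeff s 0 = - 2 * of_bool (r = 2) * L 0" if "r = r'"
  proof -
    have e: "pW ^ (2 * r) = pW * (pW ^ 3 * pW ^ (2 * r - 4))" and g: "pW ^ g = pW * pW ^ (g - 1)"
      using r ge(1) by (simp_all add: power_add[symmetric] power_Suc[symmetric] del: power_Suc)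
    have gen: "(e * (w * (T * R))) * (M - Q * u) - (e * (w * (T * R))) * (M - Q * u') * (1 + (w * Q) * c) =
        (w * Q) * (T * (e * (R * (u' - u - (M - Q * u') * (w * c)))))" for e w T R M Q u u' c :: "int poly"
      by algebra
    have "(- pW\<^sup>2) ^ r * lolly' b - (- pW\<^sup>2) ^ r * lolly' b' * ?Z =
      pW ^ g * (pW ^ 3 * ((-1) ^ r * (pW ^ (2 * r - 4) * (u' - u - (pM - pW ^ (g - 1) * u') * (pW * ?c)))))"
      unfolding neg_pW2_power e u(1) u'(1) z g by (rule gen)
    moreover have "coeff ((-1) ^ r * (pW ^ (2 * r - 4) * (u' - u - (pM - pW ^ (g - 1) * u') * (pW * ?c)))) 0 = - 2 * of_bool (r = 2) * L 0"
      using r u(2) u'(2) by (auto simp: coeff_neg_one_power_mult coeff_mult_0 coeff_0_simps coeff_pW_0 L_def)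
    ultimately show ?thesis using that by auto
  qed
  have path': "\<exists>s. (- pW\<^sup>2) ^ r * lolly' b - (- pW\<^sup>2) ^ r' * lolly' b' * ?Z = pW ^ g * (pW ^ 3 * s) \<and>
      coeff s 0 = 0" if "g + 3 < 2 * r" "g + 3 < 2 * r'"
  proof -
    have e: "pW ^ (2 * r) = pW ^ g * (pW ^ 3 * pW ^ (2 * r - g - 3))" "pW ^ (2 * r') = pW ^ g * (pW ^ 3 * pW ^ (2 * r' - g - 3))"
      using that by (simp_all add: power_add[symmetric])
    have gen: "(e * (G * (T * R))) * x - (e' * (G * (T * R'))) * y * z = G * (T * (e * (R * x) - e' * (R' * (y * z))))"
      for e e' G T R R' x y z :: "int poly" by algebra
    have "(- pW\<^sup>2) ^ r * lolly' b - (- pW\<^sup>2) ^ r' * lolly' b' * ?Z =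
      pW ^ g * (pW ^ 3 * ((-1) ^ r * (pW ^ (2 * r - g - 3) * lolly' b) - (-1) ^ r' * (pW ^ (2 * r' - g - 3) * (lolly' b' * ?Z))))"
      unfolding neg_pW2_power e by (rule gen)
    moreover have "coeff ((-1) ^ r * (pW ^ (2 * r - g - 3) * lolly' b) - (-1) ^ r' * (pW ^ (2 * r' - g - 3) * (lolly' b' * ?Z))) 0 = 0"
      using that by (simp add: coeff_neg_one_power_mult coeff_mult_0 coeff_0_simps)
    ultimately show ?thesis by blast
  qed
  \<comment> \<open>Path orders are matched only below \<open>g\<close> so far. This already removes
    the path difference at order \<open>g\<close> and gives the constant coefficient of
    \<open>?Y\<close>, which then extends the matching to \<open>g\<close>.\<close>
  have "\<exists>s. (- pW\<^sup>2) ^ r * lolly' b - (- pW\<^sup>2) ^ r' * lolly' b' * ?Z = pW ^ g * s \<and> coeff s 0 = 0"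
  proof (cases "r = r'")
    case True
    from path[OF this] obtain s where "(- pW\<^sup>2) ^ r * lolly' b - (- pW\<^sup>2) ^ r' * lolly' b' * ?Z = pW ^ g * (pW ^ 3 * s)" by blast
    moreover have "coeff (pW ^ 3 * s) 0 = 0" by (rule coeff_pW3_mult)
    ultimately show ?thesis by blast
  next
    case False
    then have "2 * r = g + (2 * r - g)" "2 * r' = g + (2 * r' - g)" "2 * r - g \<noteq> 0" "2 * r' - g \<noteq> 0" using rr ge(1) by auto
    then have e: "pW ^ (2 * r) = pW ^ g * pW ^ (2 * r - g)" "pW ^ (2 * r') = pW ^ g * pW ^ (2 * r' - g)" and
      nz: "2 * r - g \<noteq> 0" "2 * r' - g \<noteq> 0"
      by (metis power_add)+
    have gen: "(e * (G * R)) * x - (e' * (G * R')) * y * z = G * (e * (R * x) - e' * (R' * (y * z)))"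
      for e e' G R R' x y z :: "int poly" by algebra
    have "(- pW\<^sup>2) ^ r * lolly' b - (- pW\<^sup>2) ^ r' * lolly' b' * ?Z =
      pW ^ g * ((-1) ^ r * (pW ^ (2 * r - g) * lolly' b) - (-1) ^ r' * (pW ^ (2 * r' - g) * (lolly' b' * ?Z)))"
      unfolding neg_pW2_power e by (rule gen)
    moreover have "coeff ((-1) ^ r * (pW ^ (2 * r - g) * lolly' b) - (-1) ^ r' * (pW ^ (2 * r' - g) * (lolly' b' * ?Z))) 0 = 0"
      using nz by (simp add: coeff_neg_one_power_mult coeff_mult_0 coeff_0_simps)
    ultimately show ?thesis by blast
  qed
  then obtain s where s: "(- pW\<^sup>2) ^ r * lolly' b - (- pW\<^sup>2) ^ r' * lolly' b' * ?Z = pW ^ g * s" "coeff s 0 = 0" by blast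
  have "pW ^ g * (lolly a * (2 * ?Y + pW ^ 3 * n) + lolly' a * s) = 0"
    using main unfolding n(1) s(1) by (simp only: algebra_simps)
  moreover have W0: "pW ^ g \<noteq> 0" by (simp add: pW_def)
  ultimately have "coeff (lolly a * (2 * ?Y + pW ^ 3 * n) + lolly' a * s) 0 = 0" by (metis coeff_0 mult_eq_0_iff)
  then have Y0: "coeff ?Y 0 = 0"
    unfolding coeff_add coeff_mult_low(1)[of "lolly a"] coeff_mult_low(1)[of "lolly' a"] coeff_pW3_mult coeff_double X0 s(2)
    by simp
  then have L0: "L 0 = \<kappa> 0" using Y(1) by simp
  \<comment> \<open>\<open>L 0 = \<kappa> 0\<close> removes the cycles from the parity relation at
    order \<open>g\<close>.\<close>
  have rr: "r = r' \<or> (g < r \<and> g < r')"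
  proof (rule path_cases)
    fix e assume "0 < e" "e \<le> g"
    moreover have "of_bool (b = g) - of_bool (b' = g) - int (count_list ks g) = 0"
      using L0 by (simp add: L_def \<kappa>_def)
    ultimately show "even (of_bool (r = e) - of_bool (r' = e) :: int)"
      using par[of e] r by simp
  qed (use r in auto)
  have "\<exists>s X. (- pW\<^sup>2) ^ r * lolly' b - (- pW\<^sup>2) ^ r' * lolly' b' * ?Z = pW ^ g * (pW ^ 3 * s) \<and>
      coeff s 0 = - 2 * X * L 0 \<and> 0 \<le> X"
  proof (cases "r = r'")
    case True
    then show ?thesis using path by force
  next
    case False
    then have "g + 3 < 2 * r" "g + 3 < 2 * r'" using rr ge(1) by auto
    from path'[OF this] show ?thesis by force
  qed
  then obtain t X where t: "(- pW\<^sup>2) ^ r * lolly' b - (- pW\<^sup>2) ^ r' * lolly' b' * ?Z = pW ^ g * (pW ^ 3 * t)"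
      "coeff t 0 = - 2 * X * L 0" "0 \<le> X" by blast
  have "pW ^ g * (lolly a * (2 * ?Y + pW ^ 3 * n) + pW ^ 3 * (lolly' a * t)) = 0"
    using main unfolding n(1) t(1) by (simp only: algebra_simps)
  then have "coeff (lolly a * (2 * ?Y + pW ^ 3 * n) + pW ^ 3 * (lolly' a * t)) j = 0" for j
    using W0 by (metis coeff_0 mult_eq_0_iff)
  note c = this[of 1, unfolded coeff_add coeff_mult_low(2)[of "lolly a"] coeff_pW3_mult coeff_double X0 Y0]
    this[of 2, unfolded coeff_add coeff_mult_low(3)[of "lolly a"] coeff_pW3_mult coeff_double X0 Y0]
    this[of 3, unfolded coeff_add coeff_mult_low(4)[of "lolly a"] coeff_pW3_mult coeff_double X0 Y0]
  have Y1: "coeff ?Y 1 = 0" using c(1) by simp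
  have Y2: "coeff ?Y 2 = 0" using c(2) Y1 by simp
  have "2 * coeff ?Y 3 + coeff n 0 + coeff (lolly' a * t) 0 = 0" using c(3) Y1 Y2 by simp
  moreover have "coeff (lolly' a * t) 0 = - 2 * X * L 0"
    unfolding coeff_mult_0 t(2) using a by (simp add: lolly'_coeff_0)
  moreover have "coeff n 0 = 0"
  proof -
    have "of_bool (b' = g) + int (count_list ks g) = of_bool (b = g)"
      using L0 by (simp add: L_def \<kappa>_def)
    then show ?thesis unfolding n(2) by simp
  qed
  ultimately have Y3: "coeff ?Y 3 = X * L 0" by simp
  have "L 0 = 1"
  proof -
    have "b = g \<or> b' = g \<or> \<kappa> 0 > 0"
      using att by (auto simp: \<kappa>_def count_list_0_iff)
    moreover have "L 0 = of_bool (b = g) - of_bool (b' = g)" by (simp add: L_def)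
    ultimately show ?thesis using L0 kap[of 0] ne by (cases "b = g"; cases "b' = g") auto
  qed
  then have "b = g" by (cases "b = g"; cases "b' = g") (simp_all add: L_def)
  then have L: "L 2 \<le> 0" "L 3 \<le> 0" by (simp_all add: L_def)
  \<comment> \<open>The same elimination as for two unmatched cycles: \<open>L\<close> is multiplied
    by \<open>pD / pA\<close>. Since \<open>b = g\<close>, neither \<open>L 2\<close> nor
    \<open>L 3\<close> can be positive.\<close>
  have "\<kappa> 3 = L 3 + L 2 - 2 - X"
    using Y Y1 Y2 Y3 L0 \<open>L 0 = 1\<close> by simp
  then show False using L t(3) kap[of 3] by linarith
qed

text \<open>The size hypothesis makes the path on the right strictly shorter. Both sides then differ
  at the smaller of \<open>2 r'\<close> and \<open>g\<close>, the shortest additional cycle: the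
  coefficient there is 1 or -1, twice a positive count, or an odd sum of both kinds.\<close>

lemma dumbbell_no_cycles:
  assumes E: "dumbbell_poly a b r = dumbbell_poly a b r' * prod_list (map cycle_poly ks)"
    and "3 \<le> a" "3 \<le> b" "\<forall>k\<in>set ks. 3 \<le> k" "2 \<le> r'" "r = r' + sum_list ks"
  shows "ks = []"
proof (rule ccontr)
  assume ne: "ks \<noteq> []"
  define g where "g = Min (set ks)"
  have g: "g \<in> set ks" "\<forall>k\<in>set ks. g \<le> k" using ne by (auto simp: g_def)
  then have g3: "3 \<le> g" using assms(4) by auto
  obtain z where z: "prod_list (map cycle_poly ks) = 1 + pW ^ g * (2 * cyc_sum g ks + pW ^ 3 * z)"
    using prod_cycle_poly_head[OF g3 g(2)] by blast
  let ?Q = "2 * cyc_sum g ks + pW ^ 3 * z" and ?X = "lolly a * lolly b" and ?y = "lolly' a * lolly' b"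
  have Q: "coeff ?Q 0 = 2 * int (count_list ks g)"
    unfolding coeff_add coeff_double coeff_pW3_mult coeff_cyc_sum[OF g(2)] by simp
  have kap: "count_list ks g > 0" using g(1) by (simp add: count_list_0_iff neq0_conv[symmetric])
  have X: "coeff ?X 0 = 1" and y: "coeff ?y 0 = 1"
    using assms(2,3) by (simp_all add: coeff_mult_0 lolly_coeff_0 lolly'_coeff_0)
  have rr: "r' < r"
  proof -
    have "0 < sum_list ks"
      using g(1) g3 member_le_sum_list[of g ks] by linarith
    then show ?thesis using assms(6) by simp
  qed
  have gen: "e * (R * (u * v)) = G * (x * q) + e' * (R' * (u * v)) + G * (e' * (R' * (u * v * q)))"
    if "x + e * R * u * v = (x + e' * R' * u * v) * (1 + G * q)" for e e' R R' u v x G q :: "int poly"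
    using that by algebra
  have eq: "(-1) ^ r * (pW ^ (2 * r) * ?y) = pW ^ g * (?X * ?Q) + (-1) ^ r' * (pW ^ (2 * r') * ?y) +
      pW ^ g * ((-1) ^ r' * (pW ^ (2 * r') * (?y * ?Q)))"
    by (rule gen) (use E in \<open>simp only: dumbbell_poly_def neg_pW2_power z mult.assoc\<close>)
  show False
  proof (cases "2 * r' < g")
    case True
    have "coeff ((-1) ^ r * (pW ^ (2 * r) * ?y)) (2 * r') = 0"
      using rr by (simp add: coeff_neg_one_power_mult coeff_pW_power_mult)
    moreover have "coeff (pW ^ g * (?X * ?Q) + (-1) ^ r' * (pW ^ (2 * r') * ?y) +
      pW ^ g * ((-1) ^ r' * (pW ^ (2 * r') * (?y * ?Q)))) (2 * r') = (-1) ^ r'"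
      using True y by (simp add: coeff_neg_one_power_mult coeff_pW_power_mult)
    ultimately have "(-1) ^ r' = (0 :: int)" unfolding eq by simp
    then show False by simp
  next
    case False
    have "coeff ((-1) ^ r * (pW ^ (2 * r) * ?y)) g = 0"
      using rr False by (simp add: coeff_neg_one_power_mult coeff_pW_power_mult)
    moreover have "coeff (pW ^ g * (?X * ?Q)) g = 2 * int (count_list ks g)"
      unfolding coeff_pW_power_mult using X Q by (simp add: coeff_mult_0)
    moreover have "coeff ((-1) ^ r' * (pW ^ (2 * r') * ?y)) g = of_bool (g = 2 * r') * (-1) ^ r'"
      using False y by (auto simp: coeff_neg_one_power_mult coeff_pW_power_mult)
    moreover have "coeff (pW ^ g * ((-1) ^ r' * (pW ^ (2 * r') * (?y * ?Q)))) g = 0"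
      using assms(5) by (simp add: coeff_neg_one_power_mult coeff_pW_power_mult)
    ultimately have "2 * int (count_list ks g) + of_bool (g = 2 * r') * (-1) ^ r' = 0"
      unfolding eq coeff_add by linarith
    then show False
    proof (cases "g = 2 * r'")
      case True
      with \<open>2 * int (count_list ks g) + of_bool (g = 2 * r') * (-1) ^ r' = 0\<close>
      have "2 * int (count_list ks g) = - ((-1) ^ r')" by simp
      then have "even ((-1 :: int) ^ r')" by (metis dvd_minus_iff dvd_triv_left)
      then show False by simp
    qed (use kap in auto)
  qed
qed

theorem dumbbell_poly_unique:
  assumes E: "dumbbell_poly a b r = dumbbell_poly a' b' r' * prod_list (map cycle_poly ks)"
    and ge: "3 \<le> a" "3 \<le> b" "3 \<le> a'" "3 \<le> b'" "\<forall>k\<in>set ks. 3 \<le> k" "2 \<le> r" "2 \<le> r'"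
    and size: "a + b + r = a' + b' + r' + sum_list ks"
  shows "ks = [] \<and> r = r' \<and> {a, b} = {a', b'} \<and> (a = a' \<and> b = b' \<or> a = b' \<and> b = a')"
proof -
  have sw: "dumbbell_poly x y z = dumbbell_poly y x z" for x y z
    by (simp add: dumbbell_poly_def mult.commute mult.left_commute)
  have common: "ks = [] \<and> r = r' \<and> y = y'"
    if E: "dumbbell_poly x y r = dumbbell_poly x y' r' * prod_list (map cycle_poly ks)"
      and xy: "3 \<le> x" "3 \<le> y" "3 \<le> y'" and sz: "y + r = y' + r' + sum_list ks" for x y y'
  proof -
    \<comment> \<open>The minimum leaves out the shared cycle \<open>x\<close>, which may be
      shorter.\<close>
    define g where "g = Min ({y, y'} \<union> set ks)"
    have g: "g \<in> {y, y'} \<union> set ks"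
      unfolding g_def by (rule Min_in) simp_all
    have g': "\<forall>k\<in>{y, y'} \<union> set ks. g \<le> k"
      unfolding g_def by (intro ballI Min_le) simp_all
    have "y = y'"
      by (rule dumbbell_second_cycle[OF E xy(1), of g]) (use g g' xy ge in auto)
    moreover from this have "ks = []"
      using dumbbell_no_cycles[of x y r r' ks] E xy ge sz by simp
    ultimately show ?thesis using sz by simp
  qed
  define g where "g = Min ({a, b, a', b'} \<union> set ks)"
  have g: "g \<in> {a, b, a', b'} \<union> set ks"
    unfolding g_def by (rule Min_in) simp_all
  have g': "\<forall>k\<in>{a, b, a', b'} \<union> set ks. g \<le> k"
    unfolding g_def by (intro ballI Min_le) simp_all
  have "{a, b} \<inter> {a', b'} \<noteq> {}"
    by (rule dumbbell_common_cycle[OF E, of g]) (use g g' ge in auto)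
  then consider "a = a'" | "a = b'" | "b = a'" | "b = b'" by auto
  then show ?thesis
  proof cases
    case 1
    then show ?thesis using common[of a b b'] E ge size by auto
  next
    case 2
    then show ?thesis using common[of a b a'] E ge size sw[of a' b' r'] by auto
  next
    case 3
    then show ?thesis using common[of b a b'] E ge size sw[of a b r] by auto
  next
    case 4
    then show ?thesis using common[of b a a'] E ge size sw[of a b r] sw[of a' b' r'] by auto
  qed
qed

section \<open>Dumbbells against theta graphs\<close>

text \<open>Besides the path terms and the three cycles, the lowest orders are
  \<open>2 (l1 + l2)\<close> and \<open>2 l1 + l2 + l3\<close>; the condition of the second
  conclusion pushes both beyond \<open>g + 3\<close>.\<close>

lemma theta_poly_head:
  assumes "3 \<le> g" "l1 \<le> l2" "l2 \<le> l3" "1 \<le> l1" "2 \<le> l2" "g \<le> l1 + l2"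
  obtains n where "theta_poly l1 l2 l3 = pA\<^sup>2 + (\<Sum>i\<leftarrow>[l1 + 1, l2 + 1, l3 + 1]. (- pW\<^sup>2) ^ i * pM\<^sup>2) +
      pW ^ g * (2 * (pD\<^sup>2 * (pW ^ (l2 + l3 - g) + pW ^ (l1 + l3 - g) + pW ^ (l1 + l2 - g))) + pW ^ 3 * n)"
    "g < l1 + l2 \<or> 4 \<le> g \<and> 2 \<le> l1 \<Longrightarrow> coeff n 0 = 0"
proof -
  let ?L = "l1 + l2 + l3"
  let ?n = "pB\<^sup>2 * ((-1) ^ (l2 + l3) * pW ^ (2 * (l2 + l3) - g - 3) + (-1) ^ (l1 + l3) * pW ^ (2 * (l1 + l3) - g - 3) +
        (-1) ^ (l1 + l2) * pW ^ (2 * (l1 + l2) - g - 3)) -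
      2 * pD\<^sup>2 * ((-1) ^ l1 * pW ^ (?L + l1 - g - 3) + (-1) ^ l2 * pW ^ (?L + l2 - g - 3) + (-1) ^ l3 * pW ^ (?L + l3 - g - 3)) -
      pC\<^sup>2 * ((-1) ^ ?L * pW ^ (2 * ?L - g - 3))"
  have s: "pW ^ m = pW ^ g * (pW ^ 3 * pW ^ (m - g - 3))" if "g + 3 \<le> m" for m
    using that by (simp add: power_add[symmetric])
  have q: "(- pW\<^sup>2) ^ m = pW ^ g * (pW ^ 3 * ((-1) ^ m * pW ^ (2 * m - g - 3)))" if "g + 3 \<le> 2 * m" for m
    unfolding neg_pW2_power s[OF that] by (simp only: ac_simps)
  have c: "pW ^ (m + m') * (- pW\<^sup>2) ^ k = pW ^ g * (pW ^ 3 * ((-1) ^ k * pW ^ (?L + k - g - 3)))"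
    if "m + m' + k = ?L" "g + 3 \<le> ?L + k" for m m' k
  proof -
    have "pW ^ (m + m') * pW ^ (2 * k) = pW ^ (?L + k)"
      unfolding power_add[symmetric] by (rule arg_cong[of _ _ "\<lambda>n. pW ^ n"]) (use that(1) in simp)
    then have "pW ^ (m + m') * (- pW\<^sup>2) ^ k = (-1) ^ k * pW ^ (?L + k)"
      unfolding neg_pW2_power by (metis mult.left_commute)
    then show ?thesis unfolding s[OF that(2)] by (simp only: ac_simps)
  qed
  have d: "pW ^ (l2 + l3) * (1 - (- pW\<^sup>2) ^ l1) = pW ^ g * (pW ^ (l2 + l3 - g) - pW ^ 3 * ((-1) ^ l1 * pW ^ (?L + l1 - g - 3)))"
    "pW ^ (l1 + l3) * (1 - (- pW\<^sup>2) ^ l2) = pW ^ g * (pW ^ (l1 + l3 - g) - pW ^ 3 * ((-1) ^ l2 * pW ^ (?L + l2 - g - 3)))"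
    "pW ^ (l1 + l2) * (1 - (- pW\<^sup>2) ^ l3) = pW ^ g * (pW ^ (l1 + l2 - g) - pW ^ 3 * ((-1) ^ l3 * pW ^ (?L + l3 - g - 3)))"
    using c[of l2 l3 l1] c[of l1 l3 l2] c[of l1 l2 l3] assms
      pW_power_split[of g "l2 + l3"] pW_power_split[of g "l1 + l3"] pW_power_split[of g "l1 + l2"]
    by (simp_all add: right_diff_distrib)
  have gen: "A + 2 * D * (G * (x1 - T * u1) + G * (x2 - T * u2) + G * (x3 - T * u3)) + M * (y1 + y2 + y3) +
      B * (G * (T * z1) + G * (T * z2) + G * (T * z3)) - C * (G * (T * w)) =
      A + (y1 * M + (y2 * M + (y3 * M + 0))) + G * (2 * (D * (x1 + x2 + x3)) + T * (B * (z1 + z2 + z3) - 2 * D * (u1 + u2 + u3) - C * w))"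
    for A D G T x1 x2 x3 u1 u2 u3 M y1 y2 y3 B z1 z2 z3 C w :: "int poly"
    by algebra
  have Q: "(- pW\<^sup>2) ^ (l2 + l3) = pW ^ g * (pW ^ 3 * ((-1) ^ (l2 + l3) * pW ^ (2 * (l2 + l3) - g - 3)))"
     "(- pW\<^sup>2) ^ (l1 + l3) = pW ^ g * (pW ^ 3 * ((-1) ^ (l1 + l3) * pW ^ (2 * (l1 + l3) - g - 3)))"
     "(- pW\<^sup>2) ^ (l1 + l2) = pW ^ g * (pW ^ 3 * ((-1) ^ (l1 + l2) * pW ^ (2 * (l1 + l2) - g - 3)))"
     "(- pW\<^sup>2) ^ ?L = pW ^ g * (pW ^ 3 * ((-1) ^ ?L * pW ^ (2 * ?L - g - 3)))"
    using assms by (intro q; simp)+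
  have "theta_poly l1 l2 l3 = pA\<^sup>2 + (\<Sum>i\<leftarrow>[l1 + 1, l2 + 1, l3 + 1]. (- pW\<^sup>2) ^ i * pM\<^sup>2) +
      pW ^ g * (2 * (pD\<^sup>2 * (pW ^ (l2 + l3 - g) + pW ^ (l1 + l3 - g) + pW ^ (l1 + l2 - g))) + pW ^ 3 * ?n)"
    unfolding theta_poly_def d Q list.map sum_list.Cons sum_list.Nil by (rule gen)
  moreover have "coeff ?n 0 = 0" if "g < l1 + l2 \<or> 4 \<le> g \<and> 2 \<le> l1"
  proof -
    have le: "g + 4 \<le> 2 * (l1 + l2) \<and> g + 4 \<le> ?L + l1"
      using that
    proof
      assume "g < l1 + l2"
      then show ?thesis using assms by auto
    next
      assume "4 \<le> g \<and> 2 \<le> l1"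
      then show ?thesis using assms by auto
    qed
    have z: "coeff (pW ^ (m - g - 3)) 0 = 0" if "g + 4 \<le> m" for m
      using that by (simp add: coeff_pW_power)
    have m: "g + 4 \<le> 2 * (l2 + l3)" "g + 4 \<le> 2 * (l1 + l3)" "g + 4 \<le> 2 * (l1 + l2)"
      "g + 4 \<le> ?L + l1" "g + 4 \<le> ?L + l2" "g + 4 \<le> ?L + l3" "g + 4 \<le> 2 * ?L"
      using le assms(2,3) by auto
    show ?thesis
      by (simp only: coeff_diff coeff_add coeff_mult_0 coeff_neg_one_power_mult m[THEN z] mult_zero_right add_0_right diff_0_right)
  qed
  ultimately show ?thesis by (rule that)
qed

text \<open>Any two of the three paths close up to a cycle; this is the multiplicity of
  \<open>n\<close> among these three lengths.\<close>

definition theta_count :: "nat \<Rightarrow> nat \<Rightarrow> nat \<Rightarrow> nat \<Rightarrow> int" where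
  "theta_count l1 l2 l3 n = of_bool (l2 + l3 = n) + of_bool (l1 + l3 = n) + of_bool (l1 + l2 = n)"

lemma coeff_theta_sum:
  "g \<le> l2 + l3 \<Longrightarrow> g \<le> l1 + l3 \<Longrightarrow> g \<le> l1 + l2 \<Longrightarrow>
    coeff (pW ^ (l2 + l3 - g) + pW ^ (l1 + l3 - g) + pW ^ (l1 + l2 - g)) j = theta_count l1 l2 l3 (g + j)"
proof -
  have "coeff (pW ^ (a - g)) j = of_bool (a = g + j)" if "g \<le> a" for a
    using that by (auto simp: coeff_pW_power)
  then show "g \<le> l2 + l3 \<Longrightarrow> g \<le> l1 + l3 \<Longrightarrow> g \<le> l1 + l2 \<Longrightarrow> ?thesis"
    unfolding coeff_add theta_count_def by (simp only:)
qed

lemma root_parity_theta: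
  assumes "eq2 (U a * U b * U r) (theta_root l1 l2 l3 * prod_list (map U ks))"
    and "0 < r" "0 < e" "e \<le> g" "g \<le> a" "g \<le> b" "g \<le> l1 + l2" "l1 \<le> l2" "l2 \<le> l3" "\<forall>k\<in>set ks. g \<le> k"
  shows "even (of_bool (r = e) - (of_bool (l1 + 1 = e) + of_bool (l2 + 1 = e) + of_bool (l3 + 1 = e)) +
    of_bool (e = g) * (lolly_count a b g - theta_count l1 l2 l3 g - int (count_list ks g)))"
proof -
  have g: "0 < g" using assms by simp
  obtain m where m: "U a * U b = 1 + pW ^ g * m" "coeff m 0 = of_bool (a = g) + of_bool (b = g)"
    using U_pair_head[OF g assms(5,6)] .
  obtain n where n: "prod_list (map U ks) = 1 + pW ^ g * n" "coeff n 0 = int (count_list ks g)"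
    using prod_U_head[OF g assms(10)] .
  have c1: "coeff (U a * U b * U r) e = of_bool (r = e) + of_bool (e = g) * (coeff m 0 * coeff (U r) 0)"
  proof -
    have "U a * U b * U r = U r + pW ^ g * (m * U r)" unfolding m(1) by (simp only: algebra_simps)
    then show ?thesis using assms(3,4) by (simp only: coeff_low coeff_U coeff_mult_0)
  qed
  let ?T = "1 + (pW ^ (l1 + 1) + pW ^ (l2 + 1) + pW ^ (l3 + 1))"
  let ?P = "(pW ^ (l2 + l3 - g) + pW ^ (l1 + l3 - g) + pW ^ (l1 + l2 - g)) + pW ^ (l1 + l2 + l3 + 1 - g)"
  have gen: "t * (1 + G * x) = T + G * (P + T * x + G * (P * x))" if "t = T + G * P" for t G x T P :: "int poly"
    using that by algebra
  have "theta_root l1 l2 l3 = ?T + pW ^ g * ?P"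
    unfolding theta_root_def using assms
    by (simp add: distrib_left pW_power_split[symmetric] del: power_Suc)
  then have "theta_root l1 l2 l3 * prod_list (map U ks) = ?T + pW ^ g * (?P + ?T * n + pW ^ g * (?P * n))"
    unfolding n(1) by (rule gen)
  moreover have "coeff (?P + ?T * n + pW ^ g * (?P * n)) 0 = theta_count l1 l2 l3 g + coeff n 0"
  proof -
    have "coeff ?P 0 = theta_count l1 l2 l3 g"
      unfolding coeff_add[of "pW ^ (l2 + l3 - g) + pW ^ (l1 + l3 - g) + pW ^ (l1 + l2 - g)"]
      using coeff_theta_sum[of g l2 l3 l1 0] assms by (simp add: coeff_pW_power)
    moreover have "coeff ?T 0 = 1" by (simp add: coeff_pW_power del: power_Suc)
    moreover have "coeff (pW ^ g) 0 = 0" using g by (simp add: coeff_pW_power)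
    ultimately show ?thesis
      unfolding coeff_add[of "?P + ?T * n"] coeff_add[of ?P "?T * n"] coeff_mult_0 by simp
  qed
  moreover have "coeff ?T e = of_bool (l1 + 1 = e) + of_bool (l2 + 1 = e) + of_bool (l3 + 1 = e)"
  proof -
    have "coeff (pW ^ (l + 1)) e = of_bool (l + 1 = e)" for l unfolding coeff_pW_power by auto
    moreover have "coeff (1 :: int poly) e = 0" using assms(3) by simp
    ultimately show ?thesis unfolding coeff_add by (simp only: add_0_left)
  qed
  ultimately have c2: "coeff (theta_root l1 l2 l3 * prod_list (map U ks)) e =
      of_bool (l1 + 1 = e) + of_bool (l2 + 1 = e) + of_bool (l3 + 1 = e) + of_bool (e = g) * (theta_count l1 l2 l3 g + coeff n 0)"
    using assms(4) by (simp only: coeff_low)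
  have ev: "even (coeff (U a * U b * U r) e - coeff (theta_root l1 l2 l3 * prod_list (map U ks)) e)"
    by (rule eq2_coeff[OF assms(1)])
  have one: "coeff (U r) 0 = 1"
    using assms(2) by (simp_all add: coeff_pW_power)
  have eq: "coeff (U a * U b * U r) e - coeff (theta_root l1 l2 l3 * prod_list (map U ks)) e =
    of_bool (r = e) - (of_bool (l1 + 1 = e) + of_bool (l2 + 1 = e) + of_bool (l3 + 1 = e)) +
    of_bool (e = g) * (lolly_count a b g - theta_count l1 l2 l3 g - int (count_list ks g))"
    unfolding c1 c2 m(2) n(2) one lolly_count_def by (simp only: algebra_simps)
  show ?thesis using ev unfolding eq .
qed

lemma path_coeff_le: "n \<le> 2 * r \<Longrightarrow> path_coeff r n = of_bool (n = 2 * r) * (-1) ^ r"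
  by (simp add: path_coeff_def)

lemma neg_one_power_bounds: "- 1 \<le> (-1 :: int) ^ r" "(-1 :: int) ^ r \<le> 1"
  by (cases "even r"; simp)+

text \<open>Three paths face one, so path terms need not cancel. Because of
  \<open>g \<le> l1 + l2\<close>, however, only the shortest theta path can contribute below order
  \<open>g + 2\<close>, and the parity relation pairs it with \<open>r\<close>. Hence
  \<open>\<Delta>\<close> vanishes at the first two orders, and only its values at
  \<open>g + 2\<close> and \<open>g + 3\<close> remain in the equations.\<close>

lemma theta_equations:
  assumes E: "dumbbell_poly a b r = theta_poly l1 l2 l3 * prod_list (map cycle_poly ks)"
    and ge: "3 \<le> g" "g \<le> a" "g \<le> b" "\<forall>k\<in>set ks. g \<le> k" "g \<le> l1 + l2" and r: "2 \<le> r"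
    and l: "l1 \<le> l2" "l2 \<le> l3" "1 \<le> l1" "2 \<le> l2"
  defines "\<mu> \<equiv> \<lambda>j. lolly_count a b (g + j)" and "\<tau> \<equiv> \<lambda>j. theta_count l1 l2 l3 (g + j)"
    and "\<kappa> \<equiv> \<lambda>j. int (count_list ks (g + j))"
    and "\<Delta> \<equiv> \<lambda>j. path_coeff r (g + j) - (path_coeff (l1 + 1) (g + j) + path_coeff (l2 + 1) (g + j) + path_coeff (l3 + 1) (g + j))"
  shows "\<mu> 0 = \<tau> 0 + \<kappa> 0"
    and "r = l1 + 1 \<or> g + 2 \<le> 2 * r \<and> g + 2 \<le> 2 * (l1 + 1)"
    and "\<mu> 1 - \<mu> 0 = \<tau> 1 + (\<kappa> 1 - 2 * \<kappa> 0)"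
    and "\<Delta> 2 + 2 * (\<mu> 2 - \<mu> 1 + 3 * \<mu> 0) = 2 * (\<tau> 2 + 2 * \<tau> 0 + (\<kappa> 2 - 2 * \<kappa> 1 + 5 * \<kappa> 0))"
    and "g < l1 + l2 \<or> 4 \<le> g \<and> 2 \<le> l1 \<Longrightarrow> g = 3 \<longrightarrow> \<tau> 0 = 0 \<Longrightarrow>
      \<Delta> 3 + 2 * (\<mu> 3 - \<mu> 2 + 3 * \<mu> 1 - \<mu> 0) - 2 * of_bool (r = 2) * \<mu> 0 =
      2 * (\<tau> 3 + 2 * \<tau> 1 + (\<kappa> 3 - 2 * \<kappa> 2 + 5 * \<kappa> 1 - 4 * \<kappa> 0))"
    and "\<And>e. 0 < e \<Longrightarrow> e \<le> g \<Longrightarrow>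
      even (of_bool (r = e) - (of_bool (l1 + 1 = e) + of_bool (l2 + 1 = e) + of_bool (l3 + 1 = e)) :: int)"
proof -
  have R: "eq2 (U a * U b * U r) (theta_root l1 l2 l3 * prod_list (map U ks))"
    using eq2_dumbbell_poly[of a b r] eq2_theta_poly[of l1 l2 l3] ge by (intro eq2_root_cancel[OF _ _ E]) auto
  have par: "even (of_bool (r = e) - (of_bool (l1 + 1 = e) + of_bool (l2 + 1 = e) + of_bool (l3 + 1 = e)) +
    of_bool (e = g) * (lolly_count a b g - theta_count l1 l2 l3 g - int (count_list ks g)))" if "0 < e" "e \<le> g" for e
    by (rule root_parity_theta[OF R _ that ge(2,3,5) l(1,2) ge(4)]) (use r in simp)
  obtain n where n: "dumbbell_poly a b r = pA\<^sup>2 + (- pW\<^sup>2) ^ r * pM\<^sup>2 +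
      pW ^ g * (2 * (pA * pD * (pW ^ (a - g) + pW ^ (b - g))) + pW ^ 3 * n)"
    "coeff n 0 = quad g (of_bool (a = g) + of_bool (b = g)) - 2 * of_bool (r = 2) * (of_bool (a = g) + of_bool (b = g))"
    using dumbbell_poly_head[OF ge(1-3) r] .
  obtain t where t: "theta_poly l1 l2 l3 = pA\<^sup>2 + (\<Sum>i\<leftarrow>[l1 + 1, l2 + 1, l3 + 1]. (- pW\<^sup>2) ^ i * pM\<^sup>2) +
      pW ^ g * (2 * (pD\<^sup>2 * (pW ^ (l2 + l3 - g) + pW ^ (l1 + l3 - g) + pW ^ (l1 + l2 - g))) + pW ^ 3 * t)"
    "g < l1 + l2 \<or> 4 \<le> g \<and> 2 \<le> l1 \<Longrightarrow> coeff t 0 = 0"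
    using theta_poly_head[OF ge(1) l ge(5)] by blast
  have rs: "\<forall>i\<in>set [l1 + 1, l2 + 1, l3 + 1]. 2 \<le> i" using l by simp
  obtain z where z: "theta_poly l1 l2 l3 * prod_list (map cycle_poly ks) = pA\<^sup>2 + (\<Sum>i\<leftarrow>[l1 + 1, l2 + 1, l3 + 1]. (- pW\<^sup>2) ^ i * pM\<^sup>2) +
      pW ^ g * (2 * (pD\<^sup>2 * (pW ^ (l2 + l3 - g) + pW ^ (l1 + l3 - g) + pW ^ (l1 + l2 - g)) + pA\<^sup>2 * cyc_sum g ks) + pW ^ 3 * z)"
    "coeff z 0 = coeff t 0 + quad g (int (count_list ks g)) +
      4 * of_bool (g = 3) * coeff (pD\<^sup>2 * (pW ^ (l2 + l3 - g) + pW ^ (l1 + l3 - g) + pW ^ (l1 + l2 - g))) 0 * int (count_list ks g)"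
    using mult_cycles_head[OF ge(1,4) rs t(1)] .
  have gl: "g \<le> l2 + l3" "g \<le> l1 + l3" "g \<le> l1 + l2" using ge(5) l by auto
  have "pA\<^sup>2 + (\<Sum>i\<leftarrow>[r]. (- pW\<^sup>2) ^ i * pM\<^sup>2) +
      pW ^ g * (2 * (pA * pD * (pW ^ (a - g) + pW ^ (b - g))) + pW ^ 3 * n) = pA\<^sup>2 + (\<Sum>i\<leftarrow>[l1 + 1, l2 + 1, l3 + 1]. (- pW\<^sup>2) ^ i * pM\<^sup>2) +
      pW ^ g * (2 * (pD\<^sup>2 * (pW ^ (l2 + l3 - g) + pW ^ (l1 + l3 - g) + pW ^ (l1 + l2 - g)) + pA\<^sup>2 * cyc_sum g ks) + pW ^ 3 * z)"
    using E n(1) z(1) by simp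
  note eqs = head_coeff_eq[OF this, unfolded coeff_add[of "pD\<^sup>2 * _"] coeff_AD_mult coeff_A2_mult coeff_D2_mult
      coeff_lolly_sum[OF ge(2,3)] coeff_theta_sum[OF gl] coeff_cyc_sum[OF ge(4)]]
  have c: "\<Delta> 0 + 2 * \<mu> 0 = 2 * (\<tau> 0 + \<kappa> 0)"
    "\<Delta> 1 + 2 * (\<mu> 1 - \<mu> 0) = 2 * (\<tau> 1 + (\<kappa> 1 - 2 * \<kappa> 0))"
    "\<Delta> 2 + 2 * (\<mu> 2 - \<mu> 1 + 3 * \<mu> 0) = 2 * (\<tau> 2 + 2 * \<tau> 0 + (\<kappa> 2 - 2 * \<kappa> 1 + 5 * \<kappa> 0))"
    "\<Delta> 3 + 2 * (\<mu> 3 - \<mu> 2 + 3 * \<mu> 1 - \<mu> 0) + coeff n 0 =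
      2 * (\<tau> 3 + 2 * \<tau> 1 + (\<kappa> 3 - 2 * \<kappa> 2 + 5 * \<kappa> 1 - 4 * \<kappa> 0)) + coeff z 0"
    using eqs by (simp_all add: \<mu>_def \<tau>_def \<kappa>_def \<Delta>_def)
  have par': "even (of_bool (r = e) - (of_bool (l1 + 1 = e) + of_bool (l2 + 1 = e) + of_bool (l3 + 1 = e)) :: int)"
    if "0 < e" "e < g" for e
    using par[of e] that by simp
  show rl: "r = l1 + 1 \<or> g + 2 \<le> 2 * r \<and> g + 2 \<le> 2 * (l1 + 1)"
  proof (rule ccontr)
    assume *: "\<not> ?thesis"
    then have ne: "r \<noteq> l1 + 1" by simp
    have "g + 2 \<le> 2 * (l1 + 1)"
    proof (rule ccontr)
      assume "\<not> ?thesis"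
      then have "l1 + 1 < g" "l2 \<noteq> l1" "l3 \<noteq> l1" using ge l by auto
      then show False using par'[of "l1 + 1"] ne by simp
    qed
    moreover have "g + 2 \<le> 2 * r"
    proof (rule ccontr)
      assume "\<not> ?thesis"
      then have "r < g" "l2 + 1 \<noteq> r" "l3 + 1 \<noteq> r" using ge l by auto
      then show False using par'[of r] ne r by simp
    qed
    ultimately show False using * by simp
  qed
  have D: "\<Delta> 0 = 0" "\<Delta> 1 = 0"
    using rl ge(5) l unfolding \<Delta>_def by (auto simp: path_coeff_0)
  show m0: "\<mu> 0 = \<tau> 0 + \<kappa> 0" and "\<mu> 1 - \<mu> 0 = \<tau> 1 + (\<kappa> 1 - 2 * \<kappa> 0)"
    using c(1,2) D by simp_all
  show "\<Delta> 2 + 2 * (\<mu> 2 - \<mu> 1 + 3 * \<mu> 0) = 2 * (\<tau> 2 + 2 * \<tau> 0 + (\<kappa> 2 - 2 * \<kappa> 1 + 5 * \<kappa> 0))"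
    by (rule c(3))
  show "even (of_bool (r = e) - (of_bool (l1 + 1 = e) + of_bool (l2 + 1 = e) + of_bool (l3 + 1 = e)) :: int)"
    if "0 < e" "e \<le> g" for e
  proof -
    have "lolly_count a b g - theta_count l1 l2 l3 g - int (count_list ks g) = 0"
      using m0 by (simp add: \<mu>_def \<tau>_def \<kappa>_def)
    then show ?thesis using par[OF that] by simp
  qed
  assume h: "g < l1 + l2 \<or> 4 \<le> g \<and> 2 \<le> l1" and g3: "g = 3 \<longrightarrow> \<tau> 0 = 0"
  have n0: "coeff n 0 = quad g (\<mu> 0) - 2 * of_bool (r = 2) * \<mu> 0"
    using n(2) by (simp add: \<mu>_def lolly_count_def)
  have "coeff z 0 = quad g (\<mu> 0)"
  proof -
    have "coeff (pD\<^sup>2 * (pW ^ (l2 + l3 - g) + pW ^ (l1 + l3 - g) + pW ^ (l1 + l2 - g))) 0 = \<tau> 0" "int (count_list ks g) = \<kappa> 0"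
      unfolding coeff_D2_mult coeff_theta_sum[OF gl] by (simp_all add: \<tau>_def \<kappa>_def)
    then show ?thesis using t(2)[OF h] g3 m0 unfolding z(2) by (cases "g = 3") (simp_all add: quad_def)
  qed
  then show "\<Delta> 3 + 2 * (\<mu> 3 - \<mu> 2 + 3 * \<mu> 1 - \<mu> 0) - 2 * of_bool (r = 2) * \<mu> 0 =
      2 * (\<tau> 3 + 2 * \<tau> 1 + (\<kappa> 3 - 2 * \<kappa> 2 + 5 * \<kappa> 1 - 4 * \<kappa> 0))"
    using c(4) n0 by simp
qed

lemma theta_count_nonneg: "0 \<le> theta_count l1 l2 l3 n"
  by (simp add: theta_count_def)

text \<open>A contribution of the second path at order \<open>g + 3\<close> needs
  \<open>2 (l2 + 1) = g + 3\<close>, which together with \<open>g < l1 + l2\<close> forces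
  \<open>l1 + l2 = g + 1\<close>; it is thus paid for by a theta cycle of length
  \<open>g + 1\<close>. The bound is small enough because such a cycle enters the final count with
  coefficient -1.\<close>

lemma path_coeff_diff_bound:
  assumes l: "l1 \<le> l2" "l2 \<le> l3" "g < l1 + l2" "0 < g"
    and rl: "r = l1 + 1 \<or> g + 2 \<le> 2 * r \<and> g + 2 \<le> 2 * (l1 + 1)"
    and par: "\<And>e. 0 < e \<Longrightarrow> e \<le> g \<Longrightarrow>
      even (of_bool (r = e) - (of_bool (l1 + 1 = e) + of_bool (l2 + 1 = e) + of_bool (l3 + 1 = e)) :: int)"
    and r: "0 < r" and g3: "3 \<le> g"
  defines "\<Delta> \<equiv> \<lambda>j. path_coeff r (g + j) - (path_coeff (l1 + 1) (g + j) + path_coeff (l2 + 1) (g + j) + path_coeff (l3 + 1) (g + j))"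
  shows "\<Delta> 2 = 0" "\<Delta> 3 \<le> 1 + 2 * theta_count l1 l2 l3 (g + 1)"
proof -
  have r23: "g + 3 \<le> 2 * (l2 + 1)" "g + 3 \<le> 2 * (l3 + 1)" using l by auto
  have rl3: "r = l1 + 1 \<or> g + 3 \<le> 2 * r \<and> g + 3 \<le> 2 * (l1 + 1)"
  proof (cases "r = l1 + 1")
    case False
    then have a: "g + 2 \<le> 2 * r" "g + 2 \<le> 2 * (l1 + 1)" using rl by auto
    have "2 * (l1 + 1) \<noteq> g + 2"
    proof
      assume e: "2 * (l1 + 1) = g + 2"
      then have "l1 + 1 \<le> g" "l2 + 1 \<noteq> l1 + 1" "l3 + 1 \<noteq> l1 + 1" using r23 g3 by auto
      then show False using par[of "l1 + 1"] False by simp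
    qed
    moreover have "2 * r \<noteq> g + 2"
    proof
      assume e: "2 * r = g + 2"
      then have "r \<le> g" "l2 + 1 \<noteq> r" "l3 + 1 \<noteq> r" using r23 g3 by auto
      then show False using par[of r] False r by simp
    qed
    ultimately show ?thesis using a by auto
  qed simp
  have z2: "path_coeff (l2 + 1) (g + 2) = 0" "path_coeff (l3 + 1) (g + 2) = 0"
    using r23 by (intro path_coeff_0; arith)+
  have "path_coeff r (g + 2) = path_coeff (l1 + 1) (g + 2)"
  proof (cases "r = l1 + 1")
    case False
    then have "g + 2 < 2 * r" "g + 2 < 2 * (l1 + 1)" using rl3 by auto
    then show ?thesis by (simp only: path_coeff_0)
  qed simp
  then show "\<Delta> 2 = 0" unfolding \<Delta>_def using z2 by simp
  have b: "- of_bool (g + 3 = 2 * i) \<le> path_coeff i (g + 3)" "path_coeff i (g + 3) \<le> of_bool (g + 3 = 2 * i)"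
    if "g + 3 \<le> 2 * i" for i
    using path_coeff_le[OF that] neg_one_power_bounds[of i] by (auto simp: of_bool_def)
  have T: "0 \<le> theta_count l1 l2 l3 (g + 1)" by (rule theta_count_nonneg)
  show "\<Delta> 3 \<le> 1 + 2 * theta_count l1 l2 l3 (g + 1)"
  proof (cases "g + 3 = 2 * (l2 + 1)")
    case True
    then have "l1 + l2 = g + 1" using l by auto
    then have t1: "1 \<le> theta_count l1 l2 l3 (g + 1)" by (simp add: theta_count_def)
    have b2: "- 1 \<le> path_coeff (l2 + 1) (g + 3)"
      using b(1)[OF r23(1)] unfolding of_bool_def by (rule order.trans[rotated]) simp
    have b3: "- path_coeff (l3 + 1) (g + 3) + 1 \<le> theta_count l1 l2 l3 (g + 1)"
    proof (cases "g + 3 = 2 * (l3 + 1)")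
      case True
      then have "l3 = l2" using \<open>g + 3 = 2 * (l2 + 1)\<close> by simp
      then have "2 \<le> theta_count l1 l2 l3 (g + 1)" using \<open>l1 + l2 = g + 1\<close> by (simp add: theta_count_def)
      moreover have "- 1 \<le> path_coeff (l3 + 1) (g + 3)"
        using b(1)[OF r23(2)] unfolding of_bool_def by (rule order.trans[rotated]) simp
      ultimately show ?thesis by arith
    next
      case False
      then have "0 \<le> path_coeff (l3 + 1) (g + 3)" using b(1)[OF r23(2)] by (simp only: of_bool_def if_False minus_zero)
      then show ?thesis using t1 by arith
    qed
    have "path_coeff r (g + 3) - path_coeff (l1 + 1) (g + 3) \<le> 2"
    proof (cases "r = l1 + 1")
      case False
      then have "g + 3 \<le> 2 * r" "g + 3 \<le> 2 * (l1 + 1)" using rl3 by auto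
      then show ?thesis using b(2)[of r] b(1)[of "l1 + 1"] by (auto simp: of_bool_def split: if_splits)
    qed simp
    then show ?thesis unfolding \<Delta>_def using b2 b3 t1 by arith
  next
    case False
    then have gt: "g + 3 < 2 * (l2 + 1)" using r23(1) by arith
    then have gt: "g + 3 < 2 * (l2 + 1)" "g + 3 < 2 * (l3 + 1)" using l(2) by arith+
    have "path_coeff r (g + 3) - path_coeff (l1 + 1) (g + 3) \<le> 1"
    proof (cases "r = l1 + 1")
      case r: False
      then have ge: "g + 3 \<le> 2 * r" "g + 3 \<le> 2 * (l1 + 1)" using rl3 by auto
      have "g + 3 \<noteq> 2 * (l1 + 1)"
      proof
        assume e: "g + 3 = 2 * (l1 + 1)"
        have "l1 + 1 \<le> g" using e g3 by arith
        moreover have "l2 + 1 \<noteq> l1 + 1" using e gt(1) by arith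
        moreover have "l3 + 1 \<noteq> l1 + 1" using e gt(2) by arith
        ultimately show False using par[of "l1 + 1"] r by simp
      qed
      then show ?thesis using b(2)[OF ge(1)] b(1)[OF ge(2)] by (auto simp: of_bool_def split: if_splits)
    qed simp
    moreover have "path_coeff (l2 + 1) (g + 3) = 0" "path_coeff (l3 + 1) (g + 3) = 0"
      using gt by (intro path_coeff_0; simp)+
    ultimately show ?thesis unfolding \<Delta>_def using T by arith
  qed
qed

text \<open>The terms of the two equal paths pair up and vanish modulo 2. What is left is the root
  of a cycle of length \<open>2 l\<close> and a path with \<open>m + 1\<close> vertices, so parity
  alone does not recognise this theta graph.\<close>

lemma theta_root_double: "eq2 (theta_root l l m) (U (2 * l) * U (m + 1))"
proof -
  have "theta_root l l m = U (2 * l) * U (m + 1) + 2 * (pW ^ (l + 1) + pW ^ (l + m))"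
  proof -
    have e: "pW ^ (l + l + m + 1) = pW ^ (2 * l) * pW ^ (m + 1)"
      unfolding power_add[symmetric] by (rule arg_cong[of _ _ "\<lambda>n. pW ^ n"]) simp
    have e': "pW ^ (l + l) = pW ^ (2 * l)"
      by (simp only: mult_2)
    have gen: "1 + (x + x + y) + (z + z + p) + p * y = (1 + p) * (1 + y) + 2 * (x + z)" for x y z p :: "int poly"
      by algebra
    show ?thesis unfolding theta_root_def e e' by (rule gen)
  qed
  then show ?thesis by (simp only: eq2_add_double eq2_refl)
qed

text \<open>For even \<open>l\<close> the theta polynomial of two equal paths differs from a dumbbell polynomial
  without its even cycles only by the last term.\<close>

lemma theta_poly_double:
  assumes "even l"
  shows "theta_poly l l m = (pA + pB * pW ^ (2 * l))\<^sup>2 - (- pW\<^sup>2) ^ m * (pW * pM - pC * pW ^ (2 * l))\<^sup>2 +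
    pW ^ (l + m) * (4 * pD\<^sup>2 * (1 - pW ^ (2 * l)))"
proof -
  have l: "(- pW\<^sup>2) ^ l = (pW ^ l)\<^sup>2" "pW ^ (2 * l) = (pW ^ l)\<^sup>2"
    using assms unfolding neg_pW2_power by (simp_all add: power_mult[symmetric] mult.commute)
  \<comment> \<open>These two relations between the constants are what completes the
    squares.\<close>
  have id: "pD\<^sup>2 = pA * pB + pW\<^sup>2 * pM\<^sup>2" "pD\<^sup>2 = pB\<^sup>2 - pW * pM * pC"
    by (simp_all add: pA_def pB_def pC_def pD_def pM_def pW_def power2_eq_square)
  have gen: "A\<^sup>2 + 2 * D\<^sup>2 * (x * z * (1 - x\<^sup>2) + x * z * (1 - x\<^sup>2) + x * x * (1 - q)) +
      M\<^sup>2 * (x\<^sup>2 * (- W\<^sup>2) + x\<^sup>2 * (- W\<^sup>2) + q * (- W\<^sup>2)) + B\<^sup>2 * (x\<^sup>2 * q + x\<^sup>2 * q + x\<^sup>2 * x\<^sup>2) - C\<^sup>2 * (x\<^sup>2 * x\<^sup>2 * q) =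
      (A + B * x\<^sup>2)\<^sup>2 - q * (W * M - C * x\<^sup>2)\<^sup>2 + x * z * (4 * D\<^sup>2 * (1 - x\<^sup>2))"
    if "D\<^sup>2 = A * B + W\<^sup>2 * M\<^sup>2" "D\<^sup>2 = B\<^sup>2 - W * M * C" for A B C D M W x z q :: "int poly"
    using that by algebra
  show ?thesis
    unfolding theta_poly_def power_add power_one_right l by (rule gen[OF id])
qed

text \<open>For even \<open>a\<close> the signs disappear, and \<open>pA + pB = 2 pD\<close> and
  \<open>pW pM - pC = -2 pD\<close> turn the middle terms into the sums needed to split off
  \<open>1 + w^a\<close>.\<close>

lemma lolly_even:
  assumes "even a" "0 < a"
  shows "lolly a = U a * (pA + pB * pW ^ a)" "pW * lolly' a = U a * (pW * pM - pC * pW ^ a)"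
proof -
  have s: "(- pW\<^sup>2) ^ a = (pW ^ a)\<^sup>2" "(-1 :: int poly) ^ a = 1"
    using assms(1) unfolding neg_pW2_power by (simp_all add: power_mult[symmetric] mult.commute)
  have id: "pA + pB = 2 * pD" "pW * pM - pC = - 2 * pD"
    by (simp_all add: pA_def pB_def pC_def pD_def pM_def pW_def numeral_poly)
  have gen: "A + 2 * D * x + x\<^sup>2 * B = (1 + x) * (A + B * x)" if "A + B = 2 * D" for A B D x :: "int poly"
    using that by algebra
  show "lolly a = U a * (pA + pB * pW ^ a)"
    unfolding lolly_def s by (rule gen[OF id(1)])
  have w: "pW * pW ^ (a - 1) = pW ^ a" "pW * pW ^ (2 * a - 1) = (pW ^ a)\<^sup>2"
    using assms(2) by (simp_all add: power_Suc[symmetric] power_mult[symmetric] mult.commute del: power_Suc)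
  have gen': "W * (M - 2 * D * u - 1 * v * C) = (1 + x) * (W * M - C * x)"
    if "W * M - C = - 2 * D" "W * u = x" "W * v = x\<^sup>2" for W M D u v C x :: "int poly"
    using that by algebra
  show "pW * lolly' a = U a * (pW * pM - pC * pW ^ a)"
    unfolding lolly'_def s by (rule gen'[OF id(2) w])
qed

text \<open>The dumbbell polynomial is divisible by \<open>cycle_poly g = (U g)^2\<close> as well.
  After cancelling it both sides share \<open>K\<close>. If \<open>ks\<close> is empty, the path
  terms cancel and the last term of \<open>theta_poly_double\<close> remains. Otherwise the lowest
  order decides: the path term there is 1 or -1, while the last term, 4, and the cycles, twice a
  count, are even and positive.\<close>

lemma theta_near_miss:
  assumes E: "dumbbell_poly g g r = theta_poly l l m * (cycle_poly g * prod_list (map cycle_poly ks))"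
    and g: "g = 2 * l" "even l" "2 \<le> l" and ks: "\<forall>k\<in>set ks. 3 \<le> k" and r: "r = m + 1 + sum_list ks"
  shows False
proof -
  define v where "v = pM - pC * pW ^ (g - 1)"
  define K where "K = (pA + pB * pW ^ g)\<^sup>2"
  define Z where "Z = prod_list (map cycle_poly ks)"
  have wv: "pW * pM - pC * pW ^ g = pW * v"
  proof -
    have "pW ^ g = pW * pW ^ (g - 1)" using g by (simp add: power_Suc[symmetric] del: power_Suc)
    then show ?thesis unfolding v_def by (simp add: algebra_simps)
  qed
  have ev: "even g" "0 < g" using g by auto
  have W: "pW \<noteq> 0" "U g \<noteq> 0"
  proof -
    show "pW \<noteq> 0" by (simp add: pW_def)
    have "coeff (U g) 0 = 1" using ev by (simp add: coeff_pW_power)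
    then show "U g \<noteq> 0" by (metis coeff_0 zero_neq_one)
  qed
  have l': "lolly' g = U g * v"
  proof -
    have "pW * lolly' g = pW * (U g * v)" using lolly_even(2)[OF ev] unfolding wv by (simp only: ac_simps)
    then show ?thesis using W(1) by simp
  qed
  have c: "cycle_poly g = (U g)\<^sup>2"
  proof -
    have "(- pW\<^sup>2) ^ g = (pW ^ g)\<^sup>2"
      using ev unfolding neg_pW2_power by (simp add: power_mult[symmetric] mult.commute)
    moreover have "1 + 2 * x + x\<^sup>2 = (1 + x)\<^sup>2" for x :: "int poly" by algebra
    ultimately show ?thesis unfolding cycle_poly_def by (simp only:)
  qed
  have th: "theta_poly l l m = K + (-1) ^ (m + 1) * (pW ^ (2 * (m + 1)) * v\<^sup>2) + pW ^ (l + m) * (4 * pD\<^sup>2 * (1 - pW ^ g))"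
  proof -
    have "pW ^ (2 * (m + 1)) = pW ^ (2 * m) * pW\<^sup>2"
      unfolding power_add[symmetric] by (rule arg_cong[of _ _ "\<lambda>n. pW ^ n"]) simp
    then have "(- pW\<^sup>2) ^ m * (pW * v)\<^sup>2 = - ((-1) ^ (m + 1) * (pW ^ (2 * (m + 1)) * v\<^sup>2))"
      unfolding neg_pW2_power power_mult_distrib power_add[of "-1" m 1]
      by (simp only: power_one_right mult_minus_right mult_minus_left minus_minus mult_1_right ac_simps)
    then show ?thesis unfolding theta_poly_double[OF g(2)] g(1)[symmetric] wv K_def by simp
  qed
  let ?F = "K + (-1) ^ (m + 1) * (pW ^ (2 * (m + 1)) * v\<^sup>2) + pW ^ (l + m) * (4 * pD\<^sup>2 * (1 - pW ^ g))"
  have "(U g)\<^sup>2 * (K + (-1) ^ r * (pW ^ (2 * r) * v\<^sup>2)) = (U g)\<^sup>2 * (?F * Z)"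
  proof -
    have gen: "(u * x) * (u * x) + e * (u * v) * (u * v) = u\<^sup>2 * (x\<^sup>2 + e * v\<^sup>2)" for u x e v :: "int poly"
      by algebra
    have "dumbbell_poly g g r = (U g)\<^sup>2 * (K + (-1) ^ r * (pW ^ (2 * r) * v\<^sup>2))"
      unfolding dumbbell_poly_def lolly_even(1)[OF ev] l' gen K_def unfolding neg_pW2_power by (simp only: mult.assoc)
    then show ?thesis using E unfolding th c Z_def by (simp only: ac_simps)
  qed
  then have main: "K + (-1) ^ r * (pW ^ (2 * r) * v\<^sup>2) = ?F * Z" using W(2) by simp
  have v0: "coeff (v\<^sup>2) 0 = 1"
    unfolding power2_eq_square coeff_mult_0 v_def using g by (simp add: coeff_mult_0 coeff_0_simps)
  have K0: "coeff K 0 = 1"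
    unfolding power2_eq_square coeff_mult_0 K_def using g by (simp add: coeff_mult_0 coeff_0_simps)
  have d0: "coeff (4 * pD\<^sup>2 * (1 - pW ^ g)) 0 = 4"
    unfolding power2_eq_square coeff_mult_0 using g by (simp add: coeff_0_simps)
  show False
  proof (cases "ks = []")
    case True
    then have "pW ^ (l + m) * (4 * pD\<^sup>2 * (1 - pW ^ g)) = 0"
      using main r by (simp add: Z_def)
    then have "coeff (4 * pD\<^sup>2 * (1 - pW ^ g)) 0 = 0" using W(1) by (metis coeff_0 mult_eq_0_iff power_not_zero)
    then show False using d0 by simp
  next
    case False
    define h where "h = Min (set ks)"
    have h: "h \<in> set ks" using False unfolding h_def by (intro Min_in) simp_all
    have h': "\<forall>k\<in>set ks. h \<le> k" unfolding h_def by simp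
    have h3: "3 \<le> h" using h ks by auto
    obtain z where z: "Z = 1 + pW ^ h * (2 * cyc_sum h ks + pW ^ 3 * z)"
      using prod_cycle_poly_head[OF h3 h'] unfolding Z_def by blast
    let ?Q = "2 * cyc_sum h ks + pW ^ 3 * z"
    have Q0: "coeff ?Q 0 = 2 * int (count_list ks h)"
      unfolding coeff_add coeff_double coeff_pW3_mult coeff_cyc_sum[OF h'] by simp
    have kap: "count_list ks h > 0" using h by (simp add: count_list_0_iff neq0_conv[symmetric])
    have rr: "m + 1 < r"
    proof -
      have "0 < sum_list ks" using h h3 member_le_sum_list[of h ks] by arith
      then show ?thesis using r by simp
    qed
    have F0: "coeff (?F * ?Q) 0 = 2 * int (count_list ks h)"
    proof -
      have "coeff ?F 0 = 1"
        using K0 g by (simp add: coeff_neg_one_power_mult coeff_mult_0 coeff_0_simps del: power_Suc mult_Suc_right)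
      then show ?thesis unfolding coeff_mult_0 Q0 by simp
    qed
    have gen: "e = e' + d + H * ((k + e' + d) * q)" if "k + e = (k + e' + d) * (1 + H * q)" for k e e' d H q :: "int poly"
      using that by algebra
    have eq: "(-1) ^ r * (pW ^ (2 * r) * v\<^sup>2) = (-1) ^ (m + 1) * (pW ^ (2 * (m + 1)) * v\<^sup>2) +
        pW ^ (l + m) * (4 * pD\<^sup>2 * (1 - pW ^ g)) + pW ^ h * (?F * ?Q)"
      by (rule gen) (use main in \<open>simp only: z\<close>)
    define n where "n = Min {2 * (m + 1), l + m, h}"
    have n: "n \<le> 2 * (m + 1)" "n \<le> l + m" "n \<le> h" "n = 2 * (m + 1) \<or> n = l + m \<or> n = h"
      unfolding n_def by auto
    have low: "coeff (pW ^ i * p) n = of_bool (i = n) * coeff p 0" if "n \<le> i" for i p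
      using that by (auto simp: coeff_pW_power_mult)
    have eq0: "0 = (-1) ^ (m + 1) * of_bool (2 * (m + 1) = n) + 4 * of_bool (l + m = n) +
        2 * int (count_list ks h) * of_bool (h = n)"
    proof -
      have "n < 2 * r" using n(1) rr by simp
      then have "coeff ((-1) ^ r * (pW ^ (2 * r) * v\<^sup>2)) n = 0"
        by (simp add: coeff_neg_one_power_mult coeff_pW_power_mult)
      then show ?thesis
        unfolding eq coeff_add coeff_neg_one_power_mult low[OF n(1)] low[OF n(2)] low[OF n(3)] v0 d0 F0
        by (simp only: mult_1_right ac_simps)
    qed
    show False
    proof (cases "2 * (m + 1) = n")
      case True
      then have "(-1 :: int) ^ (m + 1) = 2 * (- 2 * of_bool (l + m = n) - int (count_list ks h) * of_bool (h = n))"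
      proof -
        have "s = 2 * (- 2 * x - c * z)" if "0 = s * t + 4 * x + 2 * c * z" "t = 1" for s t x c z :: int
          using that by algebra
        from this[OF eq0] show ?thesis using True by simp
      qed
      then have "even ((-1 :: int) ^ (m + 1))" by (metis dvd_triv_left)
      then show False by simp
    next
      case False
      then have e: "0 = 4 * of_bool (l + m = n) + 2 * int (count_list ks h) * of_bool (h = n)"
        using eq0 by (simp only: of_bool_eq mult_zero_right add_0_left)
      then show False using n(4) False kap by (cases "l + m = n"; cases "h = n"; simp)
    qed
  qed
qed

theorem theta_poly_neq_dumbbell:
  assumes E: "dumbbell_poly a b r = theta_poly l1 l2 l3 * prod_list (map cycle_poly ks)"
    and ab: "3 \<le> a" "3 \<le> b" and r: "2 \<le> r" and ks: "\<forall>k\<in>set ks. 3 \<le> k"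
    and l: "l1 \<le> l2" "l2 \<le> l3" "1 \<le> l1" "2 \<le> l2"
    and size: "a + b + r = l1 + l2 + l3 + 1 + sum_list ks"
  shows False
proof -
  define g where "g = Min ({a, b, l1 + l2} \<union> set ks)"
  have g_in: "g \<in> {a, b, l1 + l2} \<union> set ks"
    unfolding g_def by (rule Min_in) simp_all
  have g_le: "\<forall>k\<in>{a, b, l1 + l2} \<union> set ks. g \<le> k"
    unfolding g_def by (intro ballI Min_le) simp_all
  have g3: "3 \<le> g" using g_in ab ks l by auto
  have ge: "g \<le> a" "g \<le> b" "\<forall>k\<in>set ks. g \<le> k" "g \<le> l1 + l2" using g_le by auto
  define M where "M = (\<lambda>j. lolly_count a b (g + j))"
  define T where "T = (\<lambda>j. theta_count l1 l2 l3 (g + j))"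
  define K where "K = (\<lambda>j. int (count_list ks (g + j)))"
  define D where "D = (\<lambda>j. path_coeff r (g + j) - (path_coeff (l1 + 1) (g + j) + path_coeff (l2 + 1) (g + j) + path_coeff (l3 + 1) (g + j)))"
  note eqs = theta_equations[OF E g3 ge r l]
  have e0: "M 0 = T 0 + K 0" unfolding M_def T_def K_def by (rule eqs(1))
  have e1: "M 1 - M 0 = T 1 + (K 1 - 2 * K 0)" unfolding M_def T_def K_def by (rule eqs(3))
  have e2: "D 2 + 2 * (M 2 - M 1 + 3 * M 0) = 2 * (T 2 + 2 * T 0 + (K 2 - 2 * K 1 + 5 * K 0))"
    unfolding M_def T_def K_def D_def by (rule eqs(4))
  have e3: "D 3 + 2 * (M 3 - M 2 + 3 * M 1 - M 0) - 2 * of_bool (r = 2) * M 0 =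
      2 * (T 3 + 2 * T 1 + (K 3 - 2 * K 2 + 5 * K 1 - 4 * K 0))"
    if "g < l1 + l2 \<or> 4 \<le> g \<and> 2 \<le> l1" "g = 3 \<longrightarrow> T 0 = 0"
    using eqs(5)[OF that(1)] that(2) unfolding M_def T_def K_def D_def by blast
  note rl = eqs(2) and par = eqs(6)
  have T: "0 \<le> T j" and K: "0 \<le> K j" and M: "0 \<le> M j" for j
    by (simp_all add: T_def K_def M_def theta_count_nonneg lolly_count_bounds)
  have M_le: "M 0 + M i + M j \<le> 2" if "distinct [0, i, j]" for i j
    using lolly_count_rest[of "g + 0" "g + i" "g + j" a b] that by (simp add: M_def)
  \<comment> \<open>Either the theta cycles are all longer than \<open>g\<close>, or the shortest
    one attains \<open>g\<close>; then it matters whether its two paths are equal, because equal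
    paths cancel modulo 2.\<close>
  consider "g < l1 + l2" | "g = l1 + l2" "l1 < l2" | "g = l1 + l2" "l1 = l2" using ge(4) l(1) by arith
  then show False
  proof cases
    case 1
    have T0: "T 0 = 0" using 1 l by (simp add: T_def theta_count_def)
    have "0 < M 0"
    proof -
      have "0 < M 0 \<or> 0 < K 0"
        using g_in 1 by (auto simp: M_def K_def lolly_count_def count_list_0_iff)
      then show ?thesis using e0 T0 by auto
    qed
    have D2: "D 2 = 0" and D3: "D 3 \<le> 1 + 2 * T 1"
      unfolding D_def T_def
      by (rule path_coeff_diff_bound[OF l(1,2) 1 _ rl par]; use g3 r in simp)+
    define X where "X = 2 * of_bool (r = 2) * M 0"
    have X: "0 \<le> X" using M[of 0] by (simp add: X_def)
    have e3': "D 3 + 2 * (M 3 - M 2 + 3 * M 1 - M 0) - X =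
      2 * (T 3 + 2 * T 1 + (K 3 - 2 * K 2 + 5 * K 1 - 4 * K 0))"
      unfolding X_def using e3 1 T0 by simp
    have "M 0 + M 2 + M 3 \<le> 2" by (rule M_le) simp
    \<comment> \<open>The equations give \<open>K 3 = D 3 / 2 - X / 2 + M 3 + M 2 - 2 * M 0 - T 1 -
      2 * T 2 - T 3\<close>, which is negative by the bounds on \<open>D 3\<close> and on
      \<open>M 0 + M 2 + M 3\<close>.\<close>
    then show False
      using e0 e1 e2 e3' T0 D2 D3 X T[of 1] T[of 2] T[of 3] K[of 3] \<open>0 < M 0\<close> by (smt (verit))
  next
    case 2
    then have "r = l1 + 1" using rl by auto
    have "l2 + 1 \<le> g" using 2 l by simp
    \<comment> \<open>At order \<open>l2 + 1\<close> only the third path can restore parity, because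
      \<open>r\<close> is already paired with the shortest path. Two theta cycles of length
      \<open>g\<close> then exhaust both lollipop cycles.\<close>
    then have "l3 = l2" using par[of "l2 + 1"] \<open>r = l1 + 1\<close> 2 by (cases "l3 = l2") auto
    then have "2 \<le> T 0" using 2 by (simp add: T_def theta_count_def)
    moreover have "M 0 + M 1 + M 2 \<le> 2" by (rule M_le) simp
    ultimately show False
      using e0 e1 M[of 1] M[of 2] K[of 0] K[of 1] T[of 1] by (smt (verit))
  next
    case 3
    define l where "l = l1"
    have ll: "l1 = l" "l2 = l" "g = 2 * l" "2 \<le> l" "4 \<le> g" using 3 l_def \<open>2 \<le> l2\<close> by auto
    have rp: "r = l + 1 \<longleftrightarrow> l3 = l"
      using par[of "l + 1"] ll by (cases "r = l + 1"; cases "l3 = l") auto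
    have "l3 \<noteq> l"
    proof
      assume "l3 = l"
      then have "T 0 = 3" using ll by (simp add: T_def theta_count_def)
      then show False using e0 K[of 0] lolly_count_bounds(2)[of a b g] by (simp add: M_def)
    qed
    then have l3: "l < l3" and rne: "r \<noteq> l + 1" using rp \<open>l2 \<le> l3\<close> ll by auto
    have rge: "l + 2 \<le> r" using rl rne ll by auto
    have T0: "T 0 = 1" using ll l3 by (simp add: T_def theta_count_def)
    \<comment> \<open>Here \<open>2 (l + 1) = g + 2\<close>, so the two equal paths enter at the
      orders \<open>g + 2\<close> and \<open>g + 3\<close> with sign \<open>s\<close>, while the
      other paths start later.\<close>
    define s where "s = (-1 :: int) ^ (l + 1)"
    have z: "path_coeff r (g + 2) = 0" "path_coeff r (g + 3) = 0" "path_coeff (l3 + 1) (g + 2) = 0" "path_coeff (l3 + 1) (g + 3) = 0"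
      using rge l3 ll by (intro path_coeff_0; simp)+
    have D: "D 2 = - 2 * s" "D 3 = 4 * s"
      unfolding D_def z ll(1,2) by (simp_all add: path_coeff_def s_def ll)
    have s: "s = 1 \<or> s = -1" unfolding s_def by (cases "even l") auto
    have M0: "M 0 = 1 + K 0" using e0 T0 by simp
    have e3': "D 3 + 2 * (M 3 - M 2 + 3 * M 1 - M 0) =
      2 * (T 3 + 2 * T 1 + (K 3 - 2 * K 2 + 5 * K 1 - 4 * K 0))"
      using e3 ll rge by simp
    have sz: "a + b + r = g + l3 + 1 + sum_list ks" using size ll by simp
    have M12: "M 0 + M 1 + M 2 \<le> 2" and M23: "M 0 + M 2 + M 3 \<le> 2" and M13: "M 0 + M 1 + M 3 \<le> 2"
      by (rule M_le; simp)+
    have "M 0 = 1 \<or> M 0 = 2" using M0 K[of 0] M12 M[of 1] M[of 2] by (smt (verit))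
    then show False
    proof
      assume M0_2: "M 0 = 2"
      then have K0: "K 0 = 1" using M0 by simp
      have M123: "M 1 = 0" "M 2 = 0" "M 3 = 0" using M0_2 M12 M23 M[of 1] M[of 2] M[of 3] by (smt (verit))+
      have "T 1 + K 1 = 0" using e1 M123 M0_2 K0 by simp
      then have "T 1 = 0" "K 1 = 0" using T[of 1] K[of 1] by (smt (verit))+
      then have "T 2 + K 2 = - 1 - s" using e2 D M123 M0_2 K0 T0 by simp
      then have "s = -1" using s T[of 2] K[of 2] by (smt (verit))
      then have ev: "even l" unfolding s_def by (cases "even l") auto
      have ab: "a = g" "b = g" using M0_2 by (auto simp: M_def lolly_count_def of_bool_def split: if_splits)
      have "g \<in> set ks" using K0 count_list_0_iff[of ks g] by (auto simp: K_def)
      then obtain xs ys where split: "ks = xs @ g # ys" by (meson split_list)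
      then have p: "prod_list (map cycle_poly ks) = cycle_poly g * prod_list (map cycle_poly (xs @ ys))"
        "sum_list ks = g + sum_list (xs @ ys)"
        by (simp_all add: ac_simps)
      have "\<forall>k\<in>set (xs @ ys). 3 \<le> k" using ks split by simp
      moreover have "r = l3 + 1 + sum_list (xs @ ys)" using sz ab p(2) by simp
      ultimately show False
        using theta_near_miss[of g r l l3 "xs @ ys"] E ab ll ev p(1) by simp
    next
      assume M0_1: "M 0 = 1"
      then have K0: "K 0 = 0" using M0 by simp
      have "M 1 = 1 + T 1 + K 1" using e1 M0_1 K0 by simp
      then have M1: "M 1 = 1" "T 1 = 0" "K 1 = 0" "M 2 = 0" "M 3 = 0"
        using M12 M13 M0_1 M[of 2] M[of 3] T[of 1] K[of 1] by (smt (verit))+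
      have TK2: "T 2 + K 2 = - s" using e2 D M1 M0_1 K0 T0 by simp
      then have s1: "s = -1" using s T[of 2] K[of 2] by (smt (verit))
      then have ev: "even l" unfolding s_def by (cases "even l") auto
      have T2: "T 2 = 0 \<or> T 2 = 2" using ll by (simp add: T_def theta_count_def)
      then have K2: "K 2 = 1" using TK2 s1 K[of 2] T[of 2] by auto
      then have "T 2 = 0" using TK2 s1 by simp
      then have T3K3: "T 3 + K 3 = 2" using e3' D M1 M0_1 K0 K2 s1 by simp
      have ab: "a = g \<and> b = g + 1 \<or> a = g + 1 \<and> b = g"
        using M0_1 M1(1) by (auto simp: M_def lolly_count_def of_bool_def split: if_splits)
      have abs: "a + b = 2 * g + 1" using ab by auto
      \<comment> \<open>The coefficients leave one candidate: lollipop cycles of lengths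
        \<open>g\<close> and \<open>g + 1\<close>, and one component of length \<open>g + 2\<close>.
        After cancelling \<open>U g\<close>, the roots modulo 2 can be compared up to order
        \<open>g + 2\<close>, since all components have at least that length.\<close>
      have R: "eq2 (U a * U b * U r) (theta_root l l l3 * prod_list (map U ks))"
        using eq2_dumbbell_poly[of a b r] eq2_theta_poly[of l l l3] ge ll E by (intro eq2_root_cancel[of _ _ _ _ ks]) auto
      have eqU: "U a * U b * U r = U g * (U (g + 1) * U r)"
        using ab by (elim disjE conjE; simp only: ac_simps)
      have "eq2 (theta_root l l l3 * prod_list (map U ks)) (U g * U (l3 + 1) * prod_list (map U ks))"
        using theta_root_double[of l l3] ll by (intro eq2_mult eq2_refl) auto
      then have "eq2 (U a * U b * U r) (U g * U (l3 + 1) * prod_list (map U ks))"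
        by (rule eq2_trans[OF R])
      then have "eq2 (U g * (U (g + 1) * U r)) (U g * (U (l3 + 1) * prod_list (map U ks)))"
        unfolding eqU mult.assoc[of "U g" "U (l3 + 1)"] .
      moreover have "odd (coeff (U g) 0)" using ll by (simp add: coeff_pW_power)
      ultimately have Q: "eq2 (U (g + 1) * U r) (U (l3 + 1) * prod_list (map U ks))" by (rule eq2_mult_cancel)
      have ks2: "\<forall>k\<in>set ks. g + 2 \<le> k"
      proof
        fix k assume k: "k \<in> set ks"
        then have "k \<noteq> g" "k \<noteq> g + 1" using K0 M1(3) by (auto simp: K_def count_list_0_iff)
        then show "g + 2 \<le> k" using ge(3) k by force
      qed
      obtain n where n: "prod_list (map U ks) = 1 + pW ^ (g + 2) * n" "coeff n 0 = int (count_list ks (g + 2))"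
        using prod_U_head[of "g + 2" ks] ks2 by auto
      have in2: "g + 2 \<in> set ks" using K2 count_list_0_iff[of ks "g + 2"] by (auto simp: K_def)
      then have sum2: "g + 2 \<le> sum_list ks" using member_le_sum_list[of "g + 2" ks] by simp
      have r3: "l3 + 3 \<le> r + 1" using sz abs sum2 by simp
      have c1: "coeff (U (g + 1) * U r) e = of_bool (g + 1 = e) + of_bool (r = e) + of_bool (g + 1 + r = e)" if pos: "0 < e" for e
      proof -
        have "U (g + 1) * U r = 1 + pW ^ (g + 1) + pW ^ r + pW ^ (g + 1 + r)"
          unfolding power_add[of pW "g + 1" r] by (simp only: algebra_simps)
        moreover have "coeff (pW ^ i) e = of_bool (i = e)" for i unfolding coeff_pW_power by auto
        moreover have "coeff (1 :: int poly) e = 0" using pos by (cases e) simp_all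
        ultimately show ?thesis by (simp only: coeff_add add_0_left)
      qed
      have c2: "coeff (U (l3 + 1) * prod_list (map U ks)) e = of_bool (l3 + 1 = e) + of_bool (e = g + 2)" if "0 < e" "e \<le> g + 2" for e
      proof -
        have "U (l3 + 1) * prod_list (map U ks) = U (l3 + 1) + pW ^ (g + 2) * (n * U (l3 + 1))"
          unfolding n(1) by (simp only: algebra_simps)
        moreover have "coeff (n * U (l3 + 1)) 0 = 1"
          using n(2) K2 unfolding coeff_mult_0 coeff_add coeff_pW_power by (simp add: K_def)
        ultimately show ?thesis using that by (simp only: coeff_low coeff_U mult_1_right)
      qed
      have evc: "even (of_bool (g + 1 = e) + of_bool (r = e) + of_bool (g + 1 + r = e) - (of_bool (l3 + 1 = e) + of_bool (e = g + 2)) :: int)"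
        if "0 < e" "e \<le> g + 2" for e
        using eq2_coeff[OF Q, of e] unfolding c1[OF that(1)] c2[OF that] .
      \<comment> \<open>Since \<open>r \<ge> l3 + 2\<close>, a shorter third path would leave the
        term of order \<open>l3 + 1\<close> alone, and a longer one the term of order
        \<open>g + 1\<close>.\<close>
      have "g \<le> l3"
      proof (rule ccontr)
        assume "\<not> g \<le> l3"
        then show False using evc[of "l3 + 1"] r3 by simp
      qed
      moreover have "l3 \<le> g"
      proof (rule ccontr)
        assume "\<not> l3 \<le> g"
        then show False using evc[of "g + 1"] r3 by simp
      qed
      ultimately have l3g: "l3 = g" by simp
      then have "r = g + 2" using evc[of "g + 2"] \<open>2 \<le> r\<close> by (cases "r = g + 2") auto
      then have "sum_list ks = g + 2" using sz abs l3g by simp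
      \<comment> \<open>The component of length \<open>g + 2\<close> uses up all remaining vertices.
        Hence \<open>T 3\<close> must equal 2, and \<open>l + l3 = g + 3\<close> with
        \<open>l3 = g\<close> gives \<open>l = 3\<close>, contradicting the parity of
        \<open>l\<close>.\<close>
      then have "g + 3 \<notin> set ks" using member_le_sum_list[of "g + 3" ks] by auto
      then have "K 3 = 0" by (simp add: K_def count_list_0_iff)
      then have "T 3 = 2" using T3K3 by simp
      then have "l + l3 = g + 3" using ll by (auto simp: T_def theta_count_def of_bool_def split: if_splits)
      then have "l = 3" using l3g by simp
      then show False using ev by simp
    qed
  qed
qed

section \<open>Degree sums from the leading coefficients\<close>

lemma degree_permanent_le:
  fixes X :: "'a \<Rightarrow> 'a \<Rightarrow> 'b::comm_ring_1 poly"
  assumes "finite S" "\<forall>u v. degree (X u v) \<le> f v"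
  shows "degree (permanent S X) \<le> sum f S"
  unfolding permanent_def
proof (rule degree_sum_le)
  show "finite {p. p permutes S}" using assms(1) by (rule finite_permutations)
  fix p assume "p \<in> {p. p permutes S}"
  then have p: "p permutes S" by simp
  have "degree (\<Prod>v\<in>S. X v (p v)) \<le> (\<Sum>v\<in>S. degree (X v (p v)))"
    using degree_prod_sum_le[OF assms(1), of "\<lambda>v. X v (p v)"] by (simp add: o_def)
  also have "\<dots> \<le> (\<Sum>v\<in>S. f (p v))" using assms(2) by (intro sum_mono) simp
  also have "\<dots> = sum f S" using sum.permute[OF p, of f] by (simp add: o_def)
  finally show "degree (\<Prod>v\<in>S. X v (p v)) \<le> sum f S" .
qed

definition char_matrix :: "('a \<Rightarrow> 'a \<Rightarrow> int) \<Rightarrow> 'a \<Rightarrow> 'a \<Rightarrow> int poly" where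
  "char_matrix M u v = (if u = v then [:M u v, 1:] else [:M u v:])"

lemma degree_char_permanent:
  assumes "finite S"
  shows "degree (permanent S (char_matrix M)) \<le> card S"
  using degree_permanent_le[OF assms, of "char_matrix M" "\<lambda>_. 1"] by (simp add: char_matrix_def)

text \<open>The minors produced by expanding row \<open>a\<close>: column \<open>a\<close> in the
  place of column \<open>b\<close>. It is constant because its only entry with the variable stands
  in the deleted row.\<close>

definition const_col :: "('a \<Rightarrow> 'a \<Rightarrow> int) \<Rightarrow> 'a \<Rightarrow> 'a \<Rightarrow> 'a \<Rightarrow> 'a \<Rightarrow> int poly" where
  "const_col M a b u v = (if v = b then [:M u a:] else char_matrix M u v)"

lemma degree_const_col:
  assumes "finite S" "b \<in> S"
  shows "degree (permanent S (const_col M a b)) < card S"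
proof -
  have "degree (permanent S (const_col M a b)) \<le> (\<Sum>v\<in>S. if v = b then 0 else 1)"
    by (rule degree_permanent_le[OF assms(1)]) (simp add: char_matrix_def const_col_def)
  also have "\<dots> = (\<Sum>v\<in>S - {b}. 1)"
    using assms by (subst sum.remove[of S b]) (auto intro!: sum.cong)
  also have "\<dots> < card S" using card_Diff1_less[OF assms] by simp
  finally show ?thesis .
qed

lemma char_permanent_insert:
  assumes "finite S" "a \<notin> S"
  shows "permanent (insert a S) (char_matrix M) =
    pCons 0 (permanent S (char_matrix M)) + smult (M a a) (permanent S (char_matrix M)) +
    (\<Sum>b\<in>S. smult (M a b) (permanent S (const_col M a b)))"
proof -
  have "permanent S (\<lambda>u v. if v = b then char_matrix M u a else char_matrix M u v) = permanent S (const_col M a b)" for b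
    using assms(2) by (intro permanent_cong) (auto simp: char_matrix_def const_col_def)
  moreover have "char_matrix M a b = [:M a b:]" if "b \<in> S" for b
    using that assms(2) by (auto simp: char_matrix_def)
  ultimately show ?thesis
    unfolding permanent_insert[OF assms] by (simp add: char_matrix_def)
qed

lemma const_col_insert:
  assumes "finite S" "b \<notin> S" 
  shows "permanent (insert b S) (const_col M a b) =
    smult (M b a) (permanent S (char_matrix M)) + (\<Sum>c\<in>S. smult (M b c) (permanent S (const_col M a c)))"
proof -
  have "permanent S (\<lambda>u v. if v = c then const_col M a b u b else const_col M a b u v) = permanent S (const_col M a c)" for c
    using assms(2) by (intro permanent_cong) (auto simp: const_col_def)
  moreover have "permanent S (const_col M a b) = permanent S (char_matrix M)"
    using assms(2) by (intro permanent_cong) (auto simp: const_col_def)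
  moreover have "const_col M a b b c = [:M b c:]" if "c \<in> S" for c
    using that assms(2) by (auto simp: char_matrix_def const_col_def)
  ultimately show ?thesis
    unfolding permanent_insert[OF assms] by (simp add: const_col_def)
qed

lemma coeff_char_permanent_card:
  "finite S \<Longrightarrow> coeff (permanent S (char_matrix M)) (card S) = 1"
proof (induction S rule: finite_induct)
  case (insert a S)
  have "coeff (permanent S (const_col M a b)) (Suc (card S)) = 0" if "b \<in> S" for b
    using degree_const_col[OF insert.hyps(1) that, of M a] by (intro coeff_eq_0) simp
  moreover have "coeff (permanent S (char_matrix M)) (Suc (card S)) = 0"
    using degree_char_permanent[OF insert.hyps(1), of M] by (intro coeff_eq_0) simp
  ultimately show ?case
    using insert by (simp add: char_permanent_insert coeff_sum)
qed simp

lemma coeff_const_col: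
  assumes "finite S" "b \<in> S"
  shows "coeff (permanent S (const_col M a b)) (card S - 1) = M b a"
proof -
  obtain T where T: "S = insert b T" "b \<notin> T" using mk_disjoint_insert[OF assms(2)] by blast
  then have fT: "finite T" using assms(1) by simp
  have "coeff (permanent T (const_col M a c)) (card T) = 0" if "c \<in> T" for c
    using degree_const_col[OF fT that] by (rule coeff_eq_0)
  then show ?thesis
    using T fT by (simp add: const_col_insert coeff_sum coeff_char_permanent_card)
qed

text \<open>The factor \<open>pCons 0\<close> shifts the coefficients, so that the statement is also meaningful for
  fewer than two rows.\<close>

lemma char_permanent_coeffs:
  fixes M :: "'a \<Rightarrow> 'a \<Rightarrow> int"
  assumes "finite S"
  defines "P \<equiv> permanent S (char_matrix M)"
  shows "coeff (pCons 0 P) (card S) = (\<Sum>u\<in>S. M u u) \<and>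
    2 * coeff (pCons 0 (pCons 0 P)) (card S) =
      (\<Sum>u\<in>S. M u u)\<^sup>2 - (\<Sum>u\<in>S. (M u u)\<^sup>2) + (\<Sum>u\<in>S. \<Sum>v\<in>S - {u}. M u v * M v u)"
  unfolding P_def using assms(1)
proof (induction S rule: finite_induct)
  case (insert a S)
  define P where "P = permanent S (char_matrix M)"
  define R where "R = (\<Sum>b\<in>S. smult (M a b) (permanent S (const_col M a b)))"
  have ins: "permanent (insert a S) (char_matrix M) = pCons 0 P + smult (M a a) P + R"
    using insert.hyps unfolding P_def R_def by (rule char_permanent_insert)
  have R0: "coeff R (card S) = 0"
    unfolding R_def coeff_sum
    using degree_const_col[OF insert.hyps(1)] by (intro sum.neutral) (auto intro!: coeff_eq_0)
  have R1: "coeff (pCons 0 R) (card S) = (\<Sum>b\<in>S. M a b * M b a)"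
  proof (cases "card S")
    case 0
    then show ?thesis using insert.hyps(1) by (simp add: R_def)
  next
    case (Suc k)
    then show ?thesis
      using coeff_const_col[OF insert.hyps(1), of _ M a] by (simp add: R_def coeff_sum)
  qed
  have P0: "coeff P (card S) = 1" unfolding P_def using insert.hyps(1) by (rule coeff_char_permanent_card)
  have IH: "coeff (pCons 0 P) (card S) = (\<Sum>u\<in>S. M u u)" "2 * coeff (pCons 0 (pCons 0 P)) (card S) =
      (\<Sum>u\<in>S. M u u)\<^sup>2 - (\<Sum>u\<in>S. (M u u)\<^sup>2) + (\<Sum>u\<in>S. \<Sum>v\<in>S - {u}. M u v * M v u)"
    using insert.IH unfolding P_def by auto
  have off: "(\<Sum>u\<in>insert a S. \<Sum>v\<in>insert a S - {u}. M u v * M v u) =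
      (\<Sum>u\<in>S. \<Sum>v\<in>S - {u}. M u v * M v u) + 2 * (\<Sum>b\<in>S. M a b * M b a)"
  proof -
    have "(\<Sum>v\<in>insert a S - {u}. M u v * M v u) = (\<Sum>v\<in>S - {u}. M u v * M v u) + M a u * M u a" if "u \<in> S" for u
    proof -
      have "insert a S - {u} = insert a (S - {u})" using that insert.hyps(2) by auto
      then show ?thesis using insert.hyps by simp
    qed
    moreover have "insert a S - {a} = S" using insert.hyps(2) by auto
    ultimately show ?thesis using insert.hyps by (simp add: sum.distrib mult.commute)
  qed
  have c1: "coeff (pCons 0 (pCons 0 P + smult (M a a) P + R)) (Suc (card S)) = M a a + (\<Sum>u\<in>S. M u u)"
    using P0 R0 IH(1) by simp
  have c2: "coeff (pCons 0 (pCons 0 (pCons 0 P + smult (M a a) P + R))) (Suc (card S)) =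
      coeff (pCons 0 (pCons 0 P)) (card S) + M a a * coeff (pCons 0 P) (card S) + coeff (pCons 0 R) (card S)"
  proof -
    have "pCons 0 (pCons 0 P + smult (M a a) P + R) = pCons 0 (pCons 0 P) + smult (M a a) (pCons 0 P) + pCons 0 R" by simp
    then show ?thesis by (simp only: coeff_pCons_Suc coeff_add coeff_smult)
  qed
  have gen: "2 * (x + m * s + c) = (m + s)\<^sup>2 - (m\<^sup>2 + q) + (t + 2 * c)" if "2 * x = s\<^sup>2 - q + t" for x m s c q t :: int
    using that by algebra
  show ?case
    unfolding ins card_insert_disjoint[OF insert.hyps] c1 c2 off R1 IH(1)
    using gen[OF IH(2), of "M a a" "\<Sum>b\<in>S. M a b * M b a"] by (simp only: sum.insert[OF insert.hyps] simp_thms)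
qed simp

text \<open>The products of opposite off-diagonal entries are 1 exactly on adjacent pairs, so they
  add up to the degree sum; the last equation then determines the sum of the squared
  degrees.\<close>

lemma laplacian_char_permanent:
  fixes d :: "'a \<Rightarrow> int"
  assumes fin: "finite V" and sym: "sym E"
    and d: "\<forall>u\<in>V. (\<Sum>v\<in>V - {u}. of_bool ((u, v) \<in> E)) = d u"
  defines "P \<equiv> permanent V (char_matrix (\<lambda>u v. if u = v then - d u else of_bool ((u, v) \<in> E)))"
  shows "degree P = card V"
    "coeff (pCons 0 P) (card V) = - sum d V"
    "2 * coeff (pCons 0 (pCons 0 P)) (card V) = (sum d V)\<^sup>2 - (\<Sum>u\<in>V. (d u)\<^sup>2) + sum d V"
proof -
  let ?M = "\<lambda>u v. if u = v then - d u else of_bool ((u, v) \<in> E)"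
  show "degree P = card V"
    unfolding P_def
    using degree_char_permanent[OF fin, of ?M] le_degree[of "permanent V (char_matrix ?M)" "card V"]
    by (simp only: coeff_char_permanent_card[OF fin] one_neq_zero not_False_eq_True True_implies_equals le_antisym)
  have "(if u = v then - d u else of_bool ((u, v) \<in> E)) * (if v = u then - d v else of_bool ((v, u) \<in> E)) = of_bool ((u, v) \<in> E)"
    if "v \<in> V - {u}" for u v
    using that sym by (auto dest: symD)
  then have "(\<Sum>u\<in>V. \<Sum>v\<in>V - {u}. ?M u v * ?M v u) = (\<Sum>u\<in>V. \<Sum>v\<in>V - {u}. of_bool ((u, v) \<in> E))"
    by (intro sum.cong refl) simp
  also have "\<dots> = sum d V" using d by (intro sum.cong) auto
  finally have "(\<Sum>u\<in>V. \<Sum>v\<in>V - {u}. ?M u v * ?M v u) = sum d V" .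
  then show "coeff (pCons 0 P) (card V) = - sum d V"
    "2 * coeff (pCons 0 (pCons 0 P)) (card V) = (sum d V)\<^sup>2 - (\<Sum>u\<in>V. (d u)\<^sup>2) + sum d V"
    using char_permanent_coeffs[OF fin, of ?M] unfolding P_def by (auto simp: sum_negf)
qed

lemma laplacian_permanental_poly_char:
  assumes "pair_graph H"
  shows "laplacian_permanental_poly H = permanent (pverts H) (char_matrix
    (\<lambda>u v. if u = v then - int (out_degree (with_proj H) u) else of_bool ((u, v) \<in> parcs H)))"
proof -
  interpret pair_graph H by fact
  have "(u, u) \<notin> parcs H" for u using no_loops[of "(u, u)"] by auto
  then show ?thesis
    unfolding laplacian_permanental_poly_def
    by (intro permanent_cong) (auto simp: char_matrix_def laplacian_matrix_def degree_matrix_def adjacency_matrix_def)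
qed

lemma out_degree_Image: "out_degree (with_proj H) u = card (parcs H `` {u})"
proof -
  have "out_arcs (with_proj H) u = Pair u ` (parcs H `` {u})" by (auto simp: out_arcs_def)
  then show ?thesis by (simp add: out_degree_def card_image inj_on_def)
qed

lemma (in pair_graph) sym_parcs: "sym (parcs G)"
  using sym_arcs by (simp add: symmetric_def arcs_ends_def arc_to_ends_def)

lemma (in pair_graph) parcs_Image: "parcs G `` {u} \<subseteq> pverts G - {u}"
proof
  fix v assume "v \<in> parcs G `` {u}"
  then have "(u, v) \<in> parcs G" by simp
  then show "v \<in> pverts G - {u}" using in_arcsD2[of u v] no_loops[of "(u, v)"] by auto
qed

lemma (in pair_graph) sum_adjacency_out_degree:
  "(\<Sum>v\<in>pverts G - {u}. of_bool ((u, v) \<in> parcs G)) = int (out_degree (with_proj G) u)"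
proof -
  have "(pverts G - {u}) \<inter> {v. (u, v) \<in> parcs G} = parcs G `` {u}" using parcs_Image[of u] by auto
  then show ?thesis using pair_finite_verts by (simp add: out_degree_Image)
qed

lemma degree_sums_eq:
  assumes H: "pair_graph H" and G: "pair_graph G"
    and eq: "laplacian_permanental_poly H = laplacian_permanental_poly G"
  defines "h \<equiv> \<lambda>v. int (out_degree (with_proj H) v)" and "g \<equiv> \<lambda>v. int (out_degree (with_proj G) v)"
  shows "card (pverts H) = card (pverts G)" "sum h (pverts H) = sum g (pverts G)"
    "(\<Sum>v\<in>pverts H. (h v)\<^sup>2) = (\<Sum>v\<in>pverts G. (g v)\<^sup>2)"
proof -
  interpret H: pair_graph H by fact
  interpret G: pair_graph G by fact
  note cH = laplacian_char_permanent[OF H.pair_finite_verts H.sym_parcs, of h]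
    and cG = laplacian_char_permanent[OF G.pair_finite_verts G.sym_parcs, of g]
  have dH: "\<forall>u\<in>pverts H. (\<Sum>v\<in>pverts H - {u}. of_bool ((u, v) \<in> parcs H)) = h u"
    and dG: "\<forall>u\<in>pverts G. (\<Sum>v\<in>pverts G - {u}. of_bool ((u, v) \<in> parcs G)) = g u"
    unfolding h_def g_def by (simp_all add: H.sum_adjacency_out_degree G.sum_adjacency_out_degree)
  have e: "permanent (pverts H) (char_matrix (\<lambda>u v. if u = v then - h u else of_bool ((u, v) \<in> parcs H))) =
      permanent (pverts G) (char_matrix (\<lambda>u v. if u = v then - g u else of_bool ((u, v) \<in> parcs G)))"
    using eq unfolding laplacian_permanental_poly_char[OF H] laplacian_permanental_poly_char[OF G] h_def g_def .
  show card: "card (pverts H) = card (pverts G)" using cH(1)[OF dH] cG(1)[OF dG] unfolding e by simp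
  show s: "sum h (pverts H) = sum g (pverts G)"
    using cH(2)[OF dH] cG(2)[OF dG] unfolding e card by simp
  show "(\<Sum>v\<in>pverts H. (h v)\<^sup>2) = (\<Sum>v\<in>pverts G. (g v)\<^sup>2)"
    using cH(3)[OF dH] cG(3)[OF dG] unfolding e card s by simp
qed

section \<open>Ears in graphs whose vertices have degree 2 except for two of degree 3\<close>

lemma walk_edges_swap: "(v, z) \<in> walk_edges p \<longleftrightarrow> (z, v) \<in> walk_edges p"
  by (auto simp: walk_edges_def)

lemma walk_edges_Cons: "p \<noteq> [] \<Longrightarrow> walk_edges (x # p) = {(x, hd p), (hd p, x)} \<union> walk_edges p"
  by (auto simp: walk_edges_def walk_arcs_Cons)

lemma walk_arcs_append:
  "walk_arcs (xs @ x # ys) = walk_arcs (xs @ [x]) \<union> walk_arcs (x # ys)"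
  by (induction xs rule: induct_list012) auto

lemma walk_edges_append:
  "walk_edges (xs @ x # ys) = walk_edges (xs @ [x]) \<union> walk_edges (x # ys)"
  by (auto simp: walk_edges_def walk_arcs_append[of xs x ys])

lemma walk_edges_snoc: "p \<noteq> [] \<Longrightarrow> walk_edges (p @ [x]) = {(x, last p), (last p, x)} \<union> walk_edges p"
proof (induction p rule: rev_induct)
  case (snoc y p)
  show ?case using walk_edges_append[of p y "[x]"] by (auto simp: walk_edges_def)
qed simp

lemma walk_edges_rev: "walk_edges (rev p) = walk_edges p"
proof (induction p)
  case (Cons x p)
  show ?case
  proof (cases "p = []")
    case False
    then have "walk_edges (rev p @ [x]) = {(x, hd p), (hd p, x)} \<union> walk_edges p"
      using walk_edges_snoc[of "rev p" x] Cons.IH last_rev[of p] by simp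
    then show ?thesis using walk_edges_Cons[OF False, of x] by simp
  qed simp
qed simp

lemma walk_edges_set: "walk_edges p \<subseteq> set p \<times> set p"
  by (induction p rule: induct_list012) (auto simp: walk_edges_def)

lemma walk_edges_inner: "(v, z) \<in> walk_edges (u # xs @ [w]) \<Longrightarrow> v \<in> {u, w} \<union> set xs \<and> z \<in> {u, w} \<union> set xs"
  using walk_edges_subset[of u xs w] by auto

lemma walk_edges_first:
  assumes "u \<notin> set xs" "u \<noteq> w" "(u, z) \<in> walk_edges (u # xs @ [w])"
  shows "z = hd (xs @ [w])"
  using assms walk_edges_Cons[of "xs @ [w]" u] walk_edges_inner[of u z "hd (xs @ [w])" "tl xs" w]
  by (cases xs) (auto simp: walk_edges_def)

lemma loop_ends:
  assumes "u \<notin> set xs" "xs \<noteq> []" "(u, z) \<in> walk_edges (u # xs @ [u])"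
  shows "z = hd xs \<or> z = last xs"
proof -
  have "(u, z) \<notin> walk_edges xs"
    using walk_edges_set[of xs] assms(1) by auto
  then show ?thesis
    using assms by (auto simp: walk_edges_Cons walk_edges_snoc)
qed

text \<open>An ear leaving a terminal \<open>u\<close> towards its neighbour \<open>x\<close>: all neighbours of the inner
  vertices \<open>xs\<close> lie on it.\<close>

definition is_ear :: "('a \<times> 'a) set \<Rightarrow> 'a set \<Rightarrow> 'a \<Rightarrow> 'a \<Rightarrow> 'a list \<Rightarrow> 'a \<Rightarrow> bool" where
  "is_ear E T u x xs t \<longleftrightarrow> t \<in> T \<and> hd (xs @ [t]) = x \<and> distinct xs \<and> set xs \<inter> T = {} \<and>
     walk_edges (u # xs @ [t]) \<subseteq> E \<and> (\<forall>v\<in>set xs. \<forall>z. (v, z) \<in> E \<longrightarrow> (v, z) \<in> walk_edges (u # xs @ [t]))"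

text \<open>Follow the walk from \<open>u\<close> through \<open>x\<close> until it meets a
  terminal. A vertex \<open>x\<close> of degree 2 has one continuation \<open>x'\<close>; declaring
  \<open>x\<close> a terminal makes \<open>V - T\<close> shrink and keeps the inner vertices of the
  remaining walk distinct from \<open>x\<close>.\<close>

lemma ear_exists:
  assumes "finite V" "sym E" "\<forall>v. (v, v) \<notin> E" "\<forall>v\<in>V. E `` {v} \<subseteq> V"
    "T \<subseteq> V" "\<forall>v\<in>V - T. card (E `` {v}) = 2" "u \<in> T" "(u, x) \<in> E"
  shows "\<exists>xs t. is_ear E T u x xs t \<and> set xs \<subseteq> V"
  using assms(5-)
proof (induction "card (V - T)" arbitrary: T u x rule: less_induct)
  case less
  have uV: "u \<in> V" using less.prems by auto
  then have xV: "x \<in> V" using assms(4) less.prems by auto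
  have xu: "(x, u) \<in> E" using less.prems(4) assms(2) by (auto dest: symD)
  show ?case
  proof (cases "x \<in> T")
    case True
    then have "is_ear E T u x [] x" using less.prems(4) xu by (auto simp: is_ear_def walk_edges_def)
    then show ?thesis by force
  next
    case False
    then have "card (E `` {x}) = 2" using less.prems(2) xV by auto
    then obtain a b where ab: "E `` {x} = {a, b}" "a \<noteq> b" by (auto simp: card_2_iff)
    then have "u = a \<or> u = b" using xu by auto
    then obtain x' where x': "E `` {x} = {u, x'}" "x' \<noteq> u"
      using ab by (elim disjE) (metis insert_commute)+
    have xx': "(x, x') \<in> E" using x' by auto
    have "\<exists>xs t. is_ear E (insert x T) x x' xs t \<and> set xs \<subseteq> V"
    proof (rule less.hyps)
      show "card (V - insert x T) < card (V - T)"
        using assms(1) xV False by (intro psubset_card_mono) auto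
    qed (use less.prems xV xx' in auto)
    then obtain xs t where ear: "is_ear E (insert x T) x x' xs t" and xs: "set xs \<subseteq> V" by blast
    note ear' = ear[unfolded is_ear_def]
    \<comment> \<open>If the remaining ear returned to \<open>x\<close>, it would begin and end at
      \<open>x'\<close>, the only neighbour of \<open>x\<close> besides \<open>u\<close>. Then it
      has the single inner vertex \<open>x'\<close>, whose degree would be 1.\<close>
    have tx: "t \<noteq> x"
    proof
      assume t: "t = x"
      have "xs \<noteq> []" using ear' t xx' assms(3) by auto
      then have "(x, last xs) \<in> E" using ear' t walk_edges_snoc[of "x # xs" x] by auto
      moreover have "last xs \<noteq> u" using ear' less.prems(3) \<open>xs \<noteq> []\<close> by (metis disjoint_iff insertCI last_in_set)
      ultimately have l: "last xs = x'" using x' by auto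
      have h: "hd xs = x'" using ear' \<open>xs \<noteq> []\<close> by auto
      have xs1: "xs = [x']"
        using l h ear' \<open>xs \<noteq> []\<close> by (cases xs) (auto split: if_splits)
      have "x' \<notin> T" "x' \<in> V" using ear' xs1 xs by auto
      then have "card (E `` {x'}) = 2" using less.prems(2) by auto
      moreover have "E `` {x'} \<subseteq> {x}" using ear' xs1 t assms(3) by (auto simp: walk_edges_def)
      ultimately show False by (metis card_mono card.empty card_insert_disjoint finite.emptyI finite_insert empty_iff numeral_2_eq_2 not_less_eq_eq le_refl)
    qed
    have W: "walk_edges (u # (x # xs) @ [t]) = {(u, x), (x, u)} \<union> walk_edges (x # xs @ [t])"
      by (auto simp: walk_edges_def)
    have "(x, x') \<in> walk_edges (x # xs @ [t])"
      using ear' walk_edges_Cons[of "xs @ [t]" x] by auto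
    then have "\<forall>z. (x, z) \<in> E \<longrightarrow> (x, z) \<in> walk_edges (u # (x # xs) @ [t])"
      unfolding W using x'(1) by auto
    then have "is_ear E T u x (x # xs) t"
      using ear' tx False less.prems(4) xu unfolding is_ear_def W by auto
    then show ?thesis using xs xV by (intro exI[of _ "x # xs"] exI[of _ t]) simp
  qed
qed

lemma is_earD:
  assumes "is_ear E T u x xs t"
  shows "t \<in> T" "hd (xs @ [t]) = x" "distinct xs" "set xs \<inter> T = {}" "walk_edges (u # xs @ [t]) \<subseteq> E"
    "\<And>v z. v \<in> set xs \<Longrightarrow> (v, z) \<in> E \<Longrightarrow> (v, z) \<in> walk_edges (u # xs @ [t])"
    "(t, last (u # xs)) \<in> E"
proof -
  have "(t, last (u # xs)) \<in> walk_edges (u # xs @ [t])"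
    using walk_edges_snoc[of "u # xs" t] by auto
  then show "(t, last (u # xs)) \<in> E" using assms by (auto simp: is_ear_def)
qed (use assms in \<open>auto simp: is_ear_def\<close>)

lemma walk_edges_end:
  assumes "w \<notin> set xs" "u \<noteq> w" "(w, z) \<in> walk_edges (u # xs @ [w])"
  shows "z = last (u # xs)"
proof -
  have "rev (w # rev xs @ [u]) = u # xs @ [w]" by simp
  then have "(w, z) \<in> walk_edges (w # rev xs @ [u])" using walk_edges_rev[of "w # rev xs @ [u]"] assms(3) by simp
  then have "z = hd (rev xs @ [u])" using assms by (intro walk_edges_first) auto
  then show ?thesis by (cases xs rule: rev_cases) auto
qed

text \<open>No inner vertex would give a loop at \<open>u\<close>; a single one would have
  \<open>u\<close> as its only neighbour.\<close>

lemma ear_loop_length: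
  assumes "is_ear E T u x xs u" "\<forall>v. (v, v) \<notin> E" "\<forall>v\<in>set xs. card (E `` {v}) = 2"
  shows "2 \<le> length xs"
proof (rule ccontr)
  note e = is_earD[OF assms(1)]
  assume "\<not> 2 \<le> length xs"
  then consider "xs = []" | a where "xs = [a]" by (cases xs; cases "tl xs") auto
  then show False
  proof cases
    case 1 then show False using e(7) assms(2) by auto
  next
    case 2
    have "E `` {a} \<subseteq> {u}" using e(6)[of a] assms(2) 2 by (auto simp: walk_edges_def)
    then have "card (E `` {a}) \<le> 1" using card_mono[of "{u}" "E `` {a}"] by simp
    then show False using assms(3) 2 by simp
  qed
qed

text \<open>All neighbours of an inner vertex lie on its own ear. An ear arriving there from outside
  would have its last inner vertex among the terminals.\<close>

lemma ear_avoids: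
  assumes "is_ear E T u x xs t" "is_ear E T' s x' ys t'" "{u, t} \<union> set xs \<subseteq> T'" "x' \<notin> set xs" "sym E"
  shows "t' \<notin> set xs"
proof
  assume t': "t' \<in> set xs"
  note e = is_earD[OF assms(1)] and f = is_earD[OF assms(2)]
  have "ys \<noteq> []" using f(2) t' assms(4) by auto
  then have "last ys \<in> set ys" "(t', last ys) \<in> E" using f(7) by auto
  then have "last ys \<in> {u, t} \<union> set xs" using e(6)[OF t'] walk_edges_inner by fastforce
  then show False using \<open>last ys \<in> set ys\<close> f(4) assms(3) by auto
qed

lemma is_ear_mono: "is_ear E T u x xs t \<Longrightarrow> T' \<subseteq> T \<Longrightarrow> t \<in> T' \<Longrightarrow> is_ear E T' u x xs t"
  by (auto simp: is_ear_def)

lemma hd_neq_last: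
  assumes "distinct xs" "2 \<le> length xs"
  shows "hd xs \<noteq> last xs"
proof -
  obtain x ys where "xs = x # ys" "ys \<noteq> []" using assms(2) by (cases xs; cases "tl xs") auto
  then show ?thesis using assms(1) last_in_set[of ys] by auto
qed

lemma card_3_obtain:
  assumes "card S = 3" "a \<in> S" "b \<in> S" "a \<noteq> b"
  obtains c where "S = {a, b, c}" "c \<noteq> a" "c \<noteq> b"
  using assms by (auto simp: card_3_iff)

text \<open>If some ear from \<open>u\<close> returns to \<open>u\<close>, only one neighbour of
  \<open>u\<close> is left, its ear must reach \<open>w\<close>, and the remaining neighbours of
  \<open>w\<close> lie on an ear returning to \<open>w\<close>. Otherwise all three ears from
  \<open>u\<close> end in \<open>w\<close>. Each ear is sought with the previous ones added to the
  terminals, which makes them disjoint.\<close>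

lemma cubic_structure:
  assumes fin: "finite V" and sym: "sym E" and irr: "\<forall>v. (v, v) \<notin> E" and clo: "\<forall>v\<in>V. E `` {v} \<subseteq> V"
    and uw: "u \<in> V" "w \<in> V" "u \<noteq> w" and u3: "card (E `` {u}) = 3" and w3: "card (E `` {w}) = 3"
    and deg: "\<forall>v\<in>V - {u, w}. card (E `` {v}) = 2"
  obtains
    (dumbbell) xs ys zs where "distinct (u # w # xs @ ys @ zs)" "set (xs @ ys @ zs) \<subseteq> V" "2 \<le> length xs" "2 \<le> length ys"
      "\<forall>v\<in>{u, w} \<union> set zs \<union> set xs \<union> set ys. \<forall>z. (v, z) \<in> E \<longleftrightarrow>
        (v, z) \<in> walk_edges (u # zs @ [w]) \<union> walk_edges (u # xs @ [u]) \<union> walk_edges (w # ys @ [w])" |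
    (theta) xs ys zs where "distinct (u # w # xs @ ys @ zs)" "set (xs @ ys @ zs) \<subseteq> V" "ys \<noteq> []" "zs \<noteq> []"
      "\<forall>v\<in>{u, w} \<union> set xs \<union> set ys \<union> set zs. \<forall>z. (v, z) \<in> E \<longleftrightarrow>
        (v, z) \<in> walk_edges (u # xs @ [w]) \<union> walk_edges (u # ys @ [w]) \<union> walk_edges (u # zs @ [w])"
proof -
  have ears: "\<exists>xs t. is_ear E T v x xs t \<and> set xs \<subseteq> V" if "{u, w} \<subseteq> T" "T \<subseteq> V" "v \<in> T" "(v, x) \<in> E" for T v x
    by (rule ear_exists[OF fin sym irr clo that(2) _ that(3,4)]) (use deg that(1) in blast)
  show thesis
  proof (cases "\<exists>x xs. is_ear E {u, w} u x xs u \<and> set xs \<subseteq> V")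
  case True
  then obtain x xs where e1: "is_ear E {u, w} u x xs u" and xsV: "set xs \<subseteq> V" by blast
  note E1 = is_earD[OF e1]
  have "2 \<le> length xs" using e1 irr deg xsV E1(4) by (intro ear_loop_length[of E "{u, w}" u x xs]) auto
  define a b where "a = hd xs" and "b = last xs"
  have "xs \<noteq> []" using \<open>2 \<le> length xs\<close> by auto
  then have xs: "xs \<noteq> []" "a \<in> set xs" "b \<in> set xs" by (simp_all add: a_def b_def)
  have ab: "a \<noteq> b" unfolding a_def b_def by (rule hd_neq_last[OF E1(3) \<open>2 \<le> length xs\<close>])
  have W1: "(u, a) \<in> walk_edges (u # xs @ [u])" "(u, b) \<in> walk_edges (u # xs @ [u])"
    using xs(1) by (auto simp: a_def b_def walk_edges_Cons walk_edges_snoc)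
  then have uab: "a \<in> E `` {u}" "b \<in> E `` {u}" using E1(5) by auto
  obtain c where c: "E `` {u} = {a, b, c}" "c \<noteq> a" "c \<noteq> b" using card_3_obtain[OF u3 uab ab] .
  have uc: "(u, c) \<in> E" "(c, u) \<in> E" using c sym by (auto dest: symD)
  have u_xs: "u \<notin> set xs" "w \<notin> set xs" using E1(4) by auto
  have c_xs: "c \<notin> set xs"
  proof
    assume "c \<in> set xs"
    then have "(u, c) \<in> walk_edges (u # xs @ [u])" using E1(6) uc walk_edges_swap[of c u] by blast
    then have "c = a \<or> c = b" unfolding a_def b_def by (rule loop_ends[OF u_xs(1) xs(1)])
    then show False using c(2,3) by blast
  qed
  define T1 where "T1 = {u, w} \<union> set xs"
  obtain zs t where e2: "is_ear E T1 u c zs t" and zsV: "set zs \<subseteq> V"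
    using ears[of T1 u c] uw xsV uc by (auto simp: T1_def)
  note E2 = is_earD[OF e2]
  have "t \<notin> set xs" using ear_avoids[OF e1 e2 _ c_xs sym] by (auto simp: T1_def)
  \<comment> \<open>Another ear returning to \<open>u\<close> would need two further neighbours of
    \<open>u\<close>, but only \<open>c\<close> is left.\<close>
  moreover have "t \<noteq> u"
  proof
    assume t: "t = u"
    have l: "2 \<le> length zs" using e2 irr deg zsV E2(4) unfolding t by (intro ear_loop_length[of E T1 u c zs]) (auto simp: T1_def)
    then have ne: "zs \<noteq> []" by auto
    then have "last zs \<in> {a, b, c}" using E2(7) t c(1) by auto
    moreover have "last zs \<notin> set xs" using E2(4) last_in_set[OF ne] unfolding T1_def by blast
    ultimately have "last zs = c" using xs by auto
    moreover have "hd zs = c" using E2(2) ne by simp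
    moreover have "hd zs \<noteq> last zs" by (rule hd_neq_last[OF E2(3) l])
    ultimately show False by simp
  qed
  ultimately have t: "t = w" using E2(1) by (auto simp: T1_def)
  note e2 = e2[unfolded t] and E2 = E2[unfolded t]
  define z1 where "z1 = last (u # zs)"
  have wz1: "z1 \<in> E `` {w}" using E2(7) by (simp add: z1_def)
  have W2: "(w, z1) \<in> walk_edges (u # zs @ [w])" "(u, c) \<in> walk_edges (u # zs @ [w])"
    unfolding z1_def E2(2)[symmetric]
    using walk_edges_snoc[of "u # zs" w] apply (metis Cons_eq_appendI UnI1 insertI1 list.distinct(1))
    using walk_edges_Cons[of "zs @ [w]" u] apply (metis UnI1 append_is_Nil_conv insertI1 list.distinct(1))
    done
  obtain e where e: "(w, e) \<in> E" "e \<noteq> z1"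
    using w3 wz1 by (auto simp: card_3_iff)
  have ew: "(e, w) \<in> E" using e sym by (auto dest: symD)
  have u_zs: "u \<notin> set zs" "w \<notin> set zs" using E2(4) by (auto simp: T1_def)
  have e_xs: "e \<notin> set xs"
    using E1(6)[of e w] ew walk_edges_inner[of e w u xs u] u_xs uw by auto
  have e_zs: "e \<notin> set zs"
  proof
    assume "e \<in> set zs"
    then have "(w, e) \<in> walk_edges (u # zs @ [w])" using E2(6) ew walk_edges_swap[of e w] by blast
    then have "e = z1" unfolding z1_def by (rule walk_edges_end[OF u_zs(2) uw(3)])
    then show False using e(2) by contradiction
  qed
  \<comment> \<open>An edge between \<open>u\<close> and \<open>w\<close> could only be the
    connecting path itself, which already uses \<open>z1\<close> and not \<open>e\<close> at
    \<open>w\<close>.\<close>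
  have eu: "e \<noteq> u"
  proof
    assume "e = u"
    then have "w \<in> {a, b, c}" using c(1) ew by auto
    then have "w = c" using xs u_xs by auto
    then have "zs = []" using E2(2) u_zs(2) by (cases zs) auto
    then show False using e(2) \<open>e = u\<close> by (simp add: z1_def)
  qed
  define T2 where "T2 = {u, w} \<union> set xs \<union> set zs"
  obtain ys t' where e3: "is_ear E T2 w e ys t'" and ysV: "set ys \<subseteq> V"
    using ears[of T2 w e] uw xsV zsV e by (auto simp: T2_def)
  note E3 = is_earD[OF e3]
  have "t' \<notin> set xs" using ear_avoids[OF e1 e3 _ e_xs sym] by (auto simp: T2_def)
  moreover have "t' \<notin> set zs" using ear_avoids[OF e2 e3 _ e_zs sym] by (auto simp: T2_def)
  moreover have "t' \<noteq> u"
  proof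
    assume t': "t' = u"
    then have ne: "ys \<noteq> []" using E3(2) eu by auto
    have "last ys \<in> {a, b, c}" using E3(7) t' ne c(1) by auto
    moreover have "c \<in> T2" using E2(2) by (cases zs) (auto simp: T2_def)
    ultimately have "last ys \<in> T2" using xs by (auto simp: T2_def)
    then show False using last_in_set[OF ne] E3(4) by blast
  qed
  ultimately have t': "t' = w" using E3(1) by (auto simp: T2_def)
  note e3 = e3[unfolded t'] and E3 = E3[unfolded t']
  have leny: "2 \<le> length ys" using e3 irr deg ysV E3(4) by (intro ear_loop_length[of E T2 w e ys]) (auto simp: T2_def)
  then have ne: "ys \<noteq> []" by auto
  have hl: "hd ys \<noteq> last ys" by (rule hd_neq_last[OF E3(3) leny])
  have W3: "(w, hd ys) \<in> walk_edges (w # ys @ [w])" "(w, last ys) \<in> walk_edges (w # ys @ [w])"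
    using ne by (auto simp: walk_edges_Cons walk_edges_snoc)
  then have whl: "hd ys \<in> E `` {w}" "last ys \<in> E `` {w}" using E3(5) by auto
  obtain f where f: "E `` {w} = {hd ys, last ys, f}" using card_3_obtain[OF w3 whl hl] .
  have "z1 \<in> T2" by (auto simp: z1_def T2_def)
  then have "z1 \<noteq> hd ys" "z1 \<noteq> last ys" using E3(4) hd_in_set[OF ne] last_in_set[OF ne] by blast+
  then have f: "E `` {w} = {hd ys, last ys, z1}" using f wz1 by auto
  show thesis
  proof (rule dumbbell)
    show "distinct (u # w # xs @ ys @ zs)"
      using E1(3,4) E2(3,4) E3(3,4) uw(3) by (auto simp: T1_def T2_def)
    show "set (xs @ ys @ zs) \<subseteq> V" using xsV ysV zsV by simp
    show "\<forall>v\<in>{u, w} \<union> set zs \<union> set xs \<union> set ys. \<forall>z. (v, z) \<in> E \<longleftrightarrow>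
        (v, z) \<in> walk_edges (u # zs @ [w]) \<union> walk_edges (u # xs @ [u]) \<union> walk_edges (w # ys @ [w])" (is "\<forall>v\<in>_. \<forall>z. _ \<longleftrightarrow> _ \<in> ?W")
    proof (intro ballI allI iffI)
      fix v z assume v: "v \<in> {u, w} \<union> set zs \<union> set xs \<union> set ys" and vz: "(v, z) \<in> E"
      consider "v = u" | "v = w" | "v \<in> set zs" | "v \<in> set xs" | "v \<in> set ys" using v by blast
      then show "(v, z) \<in> ?W"
      proof cases
        case 1
        then have "z \<in> {a, b, c}" using c(1) vz by auto
        then show ?thesis using W1 W2 1 by auto
      next
        case 2
        then have "z \<in> {hd ys, last ys, z1}" using f vz by auto
        then show ?thesis using W3 W2 2 by auto
      qed (use E1(6) E2(6) E3(6) vz in blast)+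
    next
      fix v z assume "(v, z) \<in> ?W"
      then show "(v, z) \<in> E" using E1(5) E2(5) E3(5) by blast
    qed
  qed fact+
next
  case False
  \<comment> \<open>If \<open>w\<close> is a neighbour of \<open>u\<close>, it is named
    \<open>a\<close>. Then only the first path can lack inner vertices.\<close>
  obtain a b c where abc: "E `` {u} = {a, b, c}" "a \<noteq> b" "b \<noteq> c" "a \<noteq> c" "b \<noteq> w" "c \<noteq> w"
  proof -
    obtain a b c where *: "E `` {u} = {a, b, c}" "a \<noteq> b" "b \<noteq> c" "a \<noteq> c" using u3 by (auto simp: card_3_iff)
    then consider "b \<noteq> w" "c \<noteq> w" | "b = w" | "c = w" by blast
    then show thesis
    proof cases
      case 1 then show thesis using that[of a b c] * by blast
    next
      case 2 then show thesis using that[of b a c] * by blast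
    next
      case 3 then show thesis using that[of c a b] * by blast
    qed
  qed
  have au: "(u, a) \<in> E" "(u, b) \<in> E" "(u, c) \<in> E" using abc(1) by auto
  then have bu: "(b, u) \<in> E" "(c, u) \<in> E" using sym by (auto dest: symD)
  \<comment> \<open>Among the inner vertices of an ear from \<open>u\<close> to \<open>w\<close>,
    only the first one is adjacent to \<open>u\<close>; so the other neighbours of \<open>u\<close>
    start new ears.\<close>
  have first: "y \<notin> set xs" if "is_ear E T u x xs w" "u \<in> T" "y \<noteq> x" "(y, u) \<in> E" for T x xs y
  proof
    note f = is_earD[OF that(1)]
    assume "y \<in> set xs"
    then have "(u, y) \<in> walk_edges (u # xs @ [w])" using f(6) that(4) walk_edges_swap[of y u] by blast
    then have "y = x" using walk_edges_first[of u xs w y] f(2,4) that(2) uw(3) by auto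
    then show False using that(3) by simp
  qed
  obtain xs t where e1: "is_ear E {u, w} u a xs t" and xsV: "set xs \<subseteq> V"
    using ears[of "{u, w}" u a] uw au by auto
  have t: "t = w" using is_earD(1)[OF e1] e1 False xsV by auto
  note e1 = e1[unfolded t] note E1 = is_earD[OF e1]
  have n1: "b \<notin> set xs" "c \<notin> set xs" using first[OF e1] abc bu by auto
  define T1 where "T1 = {u, w} \<union> set xs"
  obtain ys t1 where e2: "is_ear E T1 u b ys t1" and ysV: "set ys \<subseteq> V"
    using ears[of T1 u b] uw au xsV by (auto simp: T1_def)
  have "t1 \<notin> set xs" using ear_avoids[OF e1 e2 _ n1(1) sym] by (auto simp: T1_def)
  moreover have "t1 \<noteq> u" using is_ear_mono[OF e2, of "{u, w}"] False ysV by (auto simp: T1_def)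
  ultimately have t1: "t1 = w" using is_earD(1)[OF e2] by (auto simp: T1_def)
  note e2 = e2[unfolded t1] note E2 = is_earD[OF e2]
  have n2: "c \<notin> set ys" using first[OF e2] abc bu by (auto simp: T1_def)
  define T2 where "T2 = {u, w} \<union> set xs \<union> set ys"
  obtain zs t2 where e3: "is_ear E T2 u c zs t2" and zsV: "set zs \<subseteq> V"
    using ears[of T2 u c] uw au xsV ysV by (auto simp: T2_def)
  have "t2 \<notin> set xs" using ear_avoids[OF e1 e3 _ n1(2) sym] by (auto simp: T2_def)
  moreover have "t2 \<notin> set ys" using ear_avoids[OF e2 e3 _ n2 sym] by (auto simp: T2_def)
  moreover have "t2 \<noteq> u" using is_ear_mono[OF e3, of "{u, w}"] False zsV by (auto simp: T2_def)
  ultimately have t2: "t2 = w" using is_earD(1)[OF e3] by (auto simp: T2_def)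
  note e3 = e3[unfolded t2] note E3 = is_earD[OF e3]
  have ne: "ys \<noteq> []" "zs \<noteq> []" using E2(2) E3(2) abc by auto
  have W: "(u, a) \<in> walk_edges (u # xs @ [w])" "(u, b) \<in> walk_edges (u # ys @ [w])" "(u, c) \<in> walk_edges (u # zs @ [w])"
    using walk_edges_Cons[of "_ @ [w]" u] E1(2) E2(2) E3(2) by auto
  define la where "la = last (u # xs)"
  have Wl: "(w, la) \<in> walk_edges (u # xs @ [w])" "(w, last ys) \<in> walk_edges (u # ys @ [w])" "(w, last zs) \<in> walk_edges (u # zs @ [w])"
    using walk_edges_snoc[of "u # _" w] ne by (auto simp: la_def)
  have ll: "last ys \<in> set ys" "last zs \<in> set zs" "la \<in> insert u (set xs)" using ne by (auto simp: la_def)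
  have nd: "last ys \<noteq> last zs" "la \<noteq> last ys" "la \<noteq> last zs" using ll E2(4) E3(4) by (auto simp: T1_def T2_def)
  have wl: "last ys \<in> E `` {w}" "last zs \<in> E `` {w}" "la \<in> E `` {w}" using Wl E1(5) E2(5) E3(5) by auto
  obtain f where "E `` {w} = {last ys, last zs, f}" using card_3_obtain[OF w3 wl(1,2) nd(1)] .
  then have f: "E `` {w} = {last ys, last zs, la}" using wl(3) nd by auto
  show thesis
  proof (rule theta)
    show "distinct (u # w # xs @ ys @ zs)"
      using E1(3,4) E2(3,4) E3(3,4) uw(3) by (auto simp: T1_def T2_def)
    show "set (xs @ ys @ zs) \<subseteq> V" using xsV ysV zsV by simp
    show "\<forall>v\<in>{u, w} \<union> set xs \<union> set ys \<union> set zs. \<forall>z. (v, z) \<in> E \<longleftrightarrow>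
        (v, z) \<in> walk_edges (u # xs @ [w]) \<union> walk_edges (u # ys @ [w]) \<union> walk_edges (u # zs @ [w])" (is "\<forall>v\<in>_. \<forall>z. _ \<longleftrightarrow> _ \<in> ?W")
    proof (intro ballI allI iffI)
      fix v z assume v: "v \<in> {u, w} \<union> set xs \<union> set ys \<union> set zs" and vz: "(v, z) \<in> E"
      consider "v = u" | "v = w" | "v \<in> set zs" | "v \<in> set xs" | "v \<in> set ys" using v by blast
      then show "(v, z) \<in> ?W"
      proof cases
        case 1
        then have "z \<in> {a, b, c}" using abc(1) vz by auto
        then show ?thesis using W 1 by auto
      next
        case 2
        then have "z \<in> {last ys, last zs, la}" using f vz by auto
        then show ?thesis using Wl 2 by auto
      qed (use E1(6) E2(6) E3(6) vz in blast)+
    next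
      fix v z assume "(v, z) \<in> ?W"
      then show "(v, z) \<in> E" using E1(5) E2(5) E3(5) by blast
    qed
  qed fact+
qed
qed

section \<open>Splitting the permanent into a core and cycle components\<close>

definition cycle_factor :: "real \<Rightarrow> nat \<Rightarrow> real" where
  "cycle_factor y k = cont y (k + 1) * y + 2 * (cont y k + 1)"

lemma cycle_factors_eval:
  assumes "0 < w" "\<forall>k\<in>set ks. 1 \<le> k"
  shows "w ^ sum_list ks * prod_list (map (cycle_factor (1 / w - w)) ks) = reval (prod_list (map cycle_poly ks)) w"
  using assms(2)
proof (induction ks)
  case (Cons k ks)
  obtain m where m: "k = m + 1" using Cons.prems by (cases k) auto
  have "w ^ k * cycle_factor (1 / w - w) k = reval (cycle_poly k) w"
    unfolding m using cycle_value[OF assms(1), of m] by (simp add: cycle_factor_def)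
  moreover have "w ^ sum_list ks * prod_list (map (cycle_factor (1 / w - w)) ks) = reval (prod_list (map cycle_poly ks)) w"
    using Cons by simp
  ultimately have "(w ^ k * cycle_factor (1 / w - w) k) * (w ^ sum_list ks * prod_list (map (cycle_factor (1 / w - w)) ks)) =
      reval (cycle_poly k) w * reval (prod_list (map cycle_poly ks)) w" by (simp only:)
  then show ?case by (simp add: power_add mult_ac)
qed simp

lemma permanent_component:
  fixes d :: "'a \<Rightarrow> 'b::comm_ring_1"
  assumes "finite V" "C \<subseteq> V" and c: "\<forall>v\<in>C. \<forall>z. (v, z) \<in> E \<longleftrightarrow> (v, z) \<in> W" and "W \<subseteq> C \<times> C"
  shows "permanent V (adj_matrix E d) = permanent C (adj_matrix W d) * permanent (V - C) (adj_matrix E d)"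
proof -
  have fin: "finite C" "finite (V - C)" using assms(1,2) finite_subset by auto
  have "permanent (C \<union> (V - C)) (adj_matrix E d) = permanent C (adj_matrix E d) * permanent (V - C) (adj_matrix E d)"
  proof (rule permanent_Un[OF fin])
    fix u v assume "u \<in> C" "v \<in> V - C"
    then show "adj_matrix E d u v = 0" using c assms(4) by (auto simp: adj_matrix_def)
  qed auto
  moreover have "permanent C (adj_matrix E d) = permanent C (adj_matrix W d)"
    using c by (intro permanent_cong) (auto simp: adj_matrix_def)
  moreover have "C \<union> (V - C) = V" using assms(2) by auto
  ultimately show ?thesis by simp
qed

lemma component_rest_closed:
  assumes "sym E" "\<forall>v\<in>C. \<forall>z. (v, z) \<in> E \<longleftrightarrow> (v, z) \<in> W" "W \<subseteq> C \<times> C" "\<forall>v\<in>V. E `` {v} \<subseteq> V"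
  shows "\<forall>v\<in>V - C. E `` {v} \<subseteq> V - C"
proof (intro ballI subsetI)
  fix v z assume v: "v \<in> V - C" and "z \<in> E `` {v}"
  then have vz: "(v, z) \<in> E" "z \<in> V" using assms(4) by auto
  then have "(z, v) \<in> E" using assms(1) by (auto dest: symD)
  then show "z \<in> V - C" using vz v assms(2,3) by blast
qed

text \<open>With \<open>u\<close> as the only terminal, the ear from \<open>u\<close> must return to
  \<open>u\<close> and is a whole component. The list \<open>ks\<close> is chosen before
  \<open>y\<close> and \<open>d\<close>, since it must serve all evaluation points.\<close>

lemma two_regular_permanent:
  assumes "finite R" and sym: "sym E" and irr: "\<forall>v. (v, v) \<notin> E" and "\<forall>v\<in>R. E `` {v} \<subseteq> R" "\<forall>v\<in>R. card (E `` {v}) = 2"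
  shows "\<exists>ks. (\<forall>k\<in>set ks. 3 \<le> k) \<and> sum_list ks = card R \<and>
    (\<forall>y d. (\<forall>v\<in>R. d v = y) \<longrightarrow> permanent R (adj_matrix E d) = prod_list (map (cycle_factor y) ks))"
  using assms(1,4,5)
proof (induction "card R" arbitrary: R rule: less_induct)
  case less
  show ?case
  proof (cases "R = {}")
    case True
    then show ?thesis by (intro exI[of _ "[]"]) simp
  next
    case False
    then obtain u where u: "u \<in> R" by auto
    then have u2: "card (E `` {u}) = 2" using less.prems by auto
    then obtain x where x: "(u, x) \<in> E" by (auto simp: card_2_iff)
    obtain xs t where "is_ear E {u} u x xs t" and xs: "set xs \<subseteq> R"
      using ear_exists[OF less.prems(1) sym irr less.prems(2), of "{u}" u x] u x less.prems(3) by auto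
    moreover from this have "t = u" by (auto simp: is_ear_def)
    ultimately have e: "is_ear E {u} u x xs u" by simp
    note E = is_earD[OF e]
    have len: "2 \<le> length xs" using less.prems(3) xs by (intro ear_loop_length[OF e irr]) auto
    have hl: "hd xs \<noteq> last xs" by (rule hd_neq_last[OF E(3) len])
    have ne: "xs \<noteq> []" using len by auto
    define C where "C = insert u (set xs)"
    define W where "W = walk_edges (u # xs @ [u])"
    have W: "(u, hd xs) \<in> W" "(u, last xs) \<in> W"
      unfolding W_def using ne by (auto simp: walk_edges_Cons walk_edges_snoc)
    have WC: "W \<subseteq> C \<times> C" using walk_edges_subset[of u xs u] by (simp add: W_def C_def)
    have "{hd xs, last xs} \<subseteq> E `` {u}" using W E(5) by (auto simp: W_def)
    moreover have "finite (E `` {u})" using u2 by (auto intro: card_ge_0_finite)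
    moreover have "card {hd xs, last xs} = 2" using hl by simp
    ultimately have u': "E `` {u} = {hd xs, last xs}" using u2 by (metis card_subset_eq)
    have clo: "\<forall>v\<in>C. \<forall>z. (v, z) \<in> E \<longleftrightarrow> (v, z) \<in> W"
    proof (intro ballI allI iffI)
      fix v z assume "v \<in> C" and vz: "(v, z) \<in> E"
      then consider "v = u" | "v \<in> set xs" by (auto simp: C_def)
      then show "(v, z) \<in> W"
      proof cases
        case 1
        then have "z \<in> {hd xs, last xs}" using u' vz by blast
        then show ?thesis using W 1 by auto
      next
        case 2
        show ?thesis unfolding W_def by (rule E(6)[OF 2 vz])
      qed
    next
      fix v z assume "(v, z) \<in> W"
      then show "(v, z) \<in> E" using E(5) unfolding W_def by (rule subsetD[rotated])
    qed
    have CR: "C \<subseteq> R" using xs u by (simp add: C_def)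
    have cC: "card C = length xs + 1" using E(3,4) by (simp add: C_def distinct_card)
    have dist: "distinct (u # xs)" using E(3,4) by simp
    have rest: "\<forall>v\<in>R - C. E `` {v} \<subseteq> R - C" by (rule component_rest_closed[OF sym clo WC less.prems(2)])
    have cR: "card R = card C + card (R - C)"
      using CR less.prems(1) by (simp add: card_Diff_subset card_mono finite_subset)
    have "\<exists>ks. (\<forall>k\<in>set ks. 3 \<le> k) \<and> sum_list ks = card (R - C) \<and>
       (\<forall>y d. (\<forall>v\<in>R - C. d v = y) \<longrightarrow> permanent (R - C) (adj_matrix E d) = prod_list (map (cycle_factor y) ks))"
      by (rule less.hyps) (use cR cC less.prems rest in auto)
    then obtain ks where ks: "\<forall>k\<in>set ks. 3 \<le> k" "sum_list ks = card (R - C)"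
      "\<And>y d. (\<forall>v\<in>R - C. d v = y) \<Longrightarrow> permanent (R - C) (adj_matrix E d) = prod_list (map (cycle_factor y) ks)" by blast
    have "permanent R (adj_matrix E d) = prod_list (map (cycle_factor y) ((length xs + 1) # ks))" if "\<forall>v\<in>R. d v = y" for y d
    proof -
      have "permanent C (adj_matrix W d) = cycle_factor y (length xs + 1)"
      proof -
        have "d v = y" if "v \<in> set (u # xs)" for v using that \<open>\<forall>v\<in>R. d v = y\<close> CR by (auto simp: C_def)
        from permanent_cycle[OF dist len this] show ?thesis
          by (simp add: C_def W_def cycle_factor_def)
      qed
      moreover have "permanent (R - C) (adj_matrix E d) = prod_list (map (cycle_factor y) ks)"
        by (rule ks(3)) (use that in auto)
      ultimately show ?thesis using permanent_component[OF less.prems(1) CR clo WC, of d] by simp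
    qed
    then show ?thesis
      using ks(1,2) len cR cC by (intro exI[of _ "(length xs + 1) # ks"]) auto
  qed
qed

lemma dumbbell_eval:
  fixes d :: "'a \<Rightarrow> real" and x :: real
  assumes dist: "distinct (u # w # xs @ ys @ zs)" and len: "2 \<le> length xs" "2 \<le> length ys" and x: "0 < x"
    and d: "d u = 1 / x - x - 1" "d w = 1 / x - x - 1" "\<forall>v\<in>set (xs @ ys @ zs). d v = 1 / x - x"
  shows "x ^ (length xs + length ys + length zs + 2) * (1 + x\<^sup>2) ^ 3 * permanent ({u, w} \<union> set zs \<union> set xs \<union> set ys)
      (adj_matrix (walk_edges (u # zs @ [w]) \<union> walk_edges (u # xs @ [u]) \<union> walk_edges (w # ys @ [w])) d) =
    reval (dumbbell_poly (length xs + 1) (length ys + 1) (length zs + 2)) x"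
  apply (subst permanent_dumbbell[OF dist len d(1,2), where y = "1 / x - x"])
   apply (use d(3) in blast | rule dumbbell_value[OF x])+
  done

lemma theta_eval:
  fixes d :: "'a \<Rightarrow> real" and x :: real
  assumes dist: "distinct (u # w # xs @ ys @ zs)" and ne: "ys \<noteq> []" "zs \<noteq> []" and x: "0 < x"
    and d: "d u = 1 / x - x - 1" "d w = 1 / x - x - 1" "\<forall>v\<in>set (xs @ ys @ zs). d v = 1 / x - x"
  shows "x ^ (length xs + length ys + length zs + 2) * (1 + x\<^sup>2) ^ 3 * permanent ({u, w} \<union> set xs \<union> set ys \<union> set zs)
      (adj_matrix (walk_edges (u # xs @ [w]) \<union> walk_edges (u # ys @ [w]) \<union> walk_edges (u # zs @ [w])) d) =
    reval (theta_poly (length xs + 1) (length ys + 1) (length zs + 1)) x"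
  apply (subst permanent_theta[OF dist ne d(1,2), where y = "1 / x - x"])
   apply (use d(3) in blast | rule theta_value[OF x])+
  done

text \<open>The core \<open>C\<close> contains all vertices of degree other than 2, so the rest is a
  union of cycles. As \<open>ks\<close> depends on the graph only, the conclusion is one identity
  for all \<open>x > 0\<close>; here \<open>x\<close> stands for the variable
  \<open>w\<close>.\<close>

lemma core_eval:
  assumes H: "pair_graph H" and CV: "C \<subseteq> pverts H" and WC: "W \<subseteq> C \<times> C"
    and clo: "\<forall>v\<in>C. \<forall>z. (v, z) \<in> parcs H \<longleftrightarrow> (v, z) \<in> W"
    and deg: "\<forall>v\<in>pverts H - C. out_degree (with_proj H) v = 2"
    and P: "\<forall>x>0. x ^ card C * (1 + x\<^sup>2) ^ 3 *
      permanent C (adj_matrix W (\<lambda>v. 1 / x - x + 2 - real (out_degree (with_proj H) v))) = reval P x"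
  obtains ks where "\<forall>k\<in>set ks. 3 \<le> k" "card (pverts H) = card C + sum_list ks"
    "\<And>x. 0 < x \<Longrightarrow> x ^ card (pverts H) * (1 + x\<^sup>2) ^ 3 * reval (laplacian_permanental_poly H) (1 / x - x + 2) =
      reval (P * prod_list (map cycle_poly ks)) x"
proof -
  interpret pair_graph H by fact
  let ?R = "pverts H - C" and ?E = "parcs H"
  have irr: "\<forall>v. (v, v) \<notin> ?E" using parcs_Image by blast
  have "\<forall>v\<in>pverts H. ?E `` {v} \<subseteq> pverts H" using parcs_Image by blast
  then have R1: "\<forall>v\<in>?R. ?E `` {v} \<subseteq> ?R" by (rule component_rest_closed[OF sym_parcs clo WC])
  have R2: "\<forall>v\<in>?R. card (?E `` {v}) = 2" using deg by (simp add: out_degree_Image)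
  obtain ks where k: "(\<forall>k\<in>set ks. 3 \<le> k) \<and> sum_list ks = card ?R \<and>
    (\<forall>y d. (\<forall>v\<in>?R. d v = y) \<longrightarrow> permanent ?R (adj_matrix ?E d) = prod_list (map (cycle_factor y) ks))"
    by (rule exE[OF two_regular_permanent[OF finite_Diff[OF pair_finite_verts] sym_parcs irr R1 R2]])
  note ks = k[THEN conjunct1] k[THEN conjunct2, THEN conjunct1]
    k[THEN conjunct2, THEN conjunct2, THEN spec, THEN spec, THEN mp]
  have card: "card (pverts H) = card C + sum_list ks"
    using CV pair_finite_verts ks(2) by (simp add: card_Diff_subset card_mono finite_subset)
  show thesis
  proof (rule that[OF ks(1) card])
    fix x :: real assume x: "0 < x"
    define d where "d = (\<lambda>v. 1 / x - x + 2 - real (out_degree (with_proj H) v))"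
    have R: "permanent ?R (adj_matrix ?E d) = prod_list (map (cycle_factor (1 / x - x)) ks)"
      by (rule ks(3)) (simp add: d_def deg)
    have "\<forall>k\<in>set ks. 1 \<le> k" using ks(1) by auto
    then have R': "x ^ sum_list ks * permanent ?R (adj_matrix ?E d) = reval (prod_list (map cycle_poly ks)) x"
      unfolding R by (rule cycle_factors_eval[OF x])
    have C: "x ^ card C * (1 + x\<^sup>2) ^ 3 * permanent C (adj_matrix W d) = reval P x"
      using P x unfolding d_def by blast
    have "reval (laplacian_permanental_poly H) (1 / x - x + 2) = permanent C (adj_matrix W d) * permanent ?R (adj_matrix ?E d)"
      unfolding reval_laplacian_permanental_poly[OF H] d_def
      by (rule permanent_component[OF pair_finite_verts CV clo WC])
    then have "x ^ card (pverts H) * (1 + x\<^sup>2) ^ 3 * reval (laplacian_permanental_poly H) (1 / x - x + 2) =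
        (x ^ card C * (1 + x\<^sup>2) ^ 3 * permanent C (adj_matrix W d)) * (x ^ sum_list ks * permanent ?R (adj_matrix ?E d))"
      unfolding card power_add by (simp only: mult_ac)
    then show "x ^ card (pverts H) * (1 + x\<^sup>2) ^ 3 * reval (laplacian_permanental_poly H) (1 / x - x + 2) =
      reval (P * prod_list (map cycle_poly ks)) x"
      unfolding C R' by simp
  qed
qed

section \<open>The labelled dumbbell graph and the isomorphism\<close>

lemma walk_arcs_nth: "walk_arcs p = {(p ! i, p ! Suc i) | i. Suc i < length p}"
  by (auto simp: walk_arcs_def set_zip nth_tl)

definition dumbbell_edges :: "'a \<Rightarrow> 'a \<Rightarrow> 'a list \<Rightarrow> 'a list \<Rightarrow> 'a list \<Rightarrow> ('a \<times> 'a) set" where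
  "dumbbell_edges u w xs ys zs = walk_edges (u # zs @ [w]) \<union> walk_edges (u # xs @ [u]) \<union> walk_edges (w # ys @ [w])"

lemma dumbbell_edges_swap: "dumbbell_edges w u ys xs (rev zs) = dumbbell_edges u w xs ys zs"
proof -
  have "rev (u # zs @ [w]) = w # rev zs @ [u]" by simp
  then have "walk_edges (w # rev zs @ [u]) = walk_edges (u # zs @ [w])" using walk_edges_rev[of "u # zs @ [w]"] by simp
  then show ?thesis by (auto simp: dumbbell_edges_def)
qed

text \<open>A dumbbell has a Hamiltonian path: around the first cycle to \<open>u\<close>, along the
  connecting path to \<open>w\<close>, then around the second cycle. Only the two edges closing the
  cycles are missing from it.\<close>

lemma dumbbell_edges_walk:
  assumes "xs \<noteq> []" "ys \<noteq> []"
  shows "dumbbell_edges u w xs ys zs = walk_edges (xs @ u # zs @ w # ys) \<union>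
    {(u, hd xs), (hd xs, u), (w, last ys), (last ys, w)}"
proof -
  have "walk_edges (xs @ u # zs @ w # ys) = walk_edges (xs @ [u]) \<union> walk_edges (u # zs @ w # ys)"
    by (rule walk_edges_append)
  moreover have "walk_edges (u # zs @ w # ys) = walk_edges (u # zs @ [w]) \<union> walk_edges (w # ys)"
    using walk_edges_append[of "u # zs" w ys] by simp
  moreover have "walk_edges (u # xs @ [u]) = {(u, hd xs), (hd xs, u)} \<union> walk_edges (xs @ [u])"
    using walk_edges_Cons[of "xs @ [u]" u] assms by simp
  moreover have "walk_edges (w # ys @ [w]) = {(w, last ys), (last ys, w)} \<union> walk_edges (w # ys)"
    using walk_edges_snoc[of "w # ys" w] assms by simp
  ultimately show ?thesis unfolding dumbbell_edges_def by blast
qed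

lemma pverts_dumbbell_graph:
  "3 \<le> p \<Longrightarrow> 3 \<le> q \<Longrightarrow> 2 \<le> r \<Longrightarrow> pverts (dumbbell_graph p q r) = {..<p + q + r - 2}"
  by (auto simp: dumbbell_graph_def pair_union_def cycle_graph_def path_graph_def)

lemma parcs_dumbbell_graph:
  assumes "3 \<le> p" "3 \<le> q" "2 \<le> r"
  defines "n \<equiv> p + q + r - 2"
  shows "parcs (dumbbell_graph p q r) = {(i, Suc i) | i. Suc i < n} \<union> {(Suc i, i) | i. Suc i < n} \<union>
    {(p - 1, 0), (0, p - 1), (p + r - 2, n - 1), (n - 1, p + r - 2)}"
proof (rule set_eqI, clarify)
  fix i j
  have l: "p + r - 2 + q - 1 = n - 1" using assms by simp
  have "(i, j) \<in> parcs (dumbbell_graph p q r) \<longleftrightarrow>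
    (i < p \<and> j < p \<or> p - 1 \<le> i \<and> i < p - 1 + r \<and> p - 1 \<le> j \<and> j < p - 1 + r \<or>
      p + r - 2 \<le> i \<and> i < p + r - 2 + q \<and> p + r - 2 \<le> j \<and> j < p + r - 2 + q) \<and> (j = Suc i \<or> i = Suc j) \<or>
    (i, j) \<in> {(p - 1, 0), (0, p - 1), (p + r - 2, n - 1), (n - 1, p + r - 2)}"
    unfolding l[symmetric]
    by (auto simp: dumbbell_graph_def pair_union_def cycle_graph_def path_graph_def)
  moreover have "(i < p \<and> j < p \<or> p - 1 \<le> i \<and> i < p - 1 + r \<and> p - 1 \<le> j \<and> j < p - 1 + r \<or>
      p + r - 2 \<le> i \<and> i < p + r - 2 + q \<and> p + r - 2 \<le> j \<and> j < p + r - 2 + q) \<and> (j = Suc i \<or> i = Suc j) \<longleftrightarrow>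
    j = Suc i \<and> Suc i < n \<or> i = Suc j \<and> Suc j < n" (is "?A \<longleftrightarrow> ?B")
  proof
    assume ?A
    then have "i < n" "j < n" using assms by auto
    then show ?B using \<open>?A\<close> by auto
  next
    have seg: "(m < p \<and> Suc m < p \<or> p - 1 \<le> m \<and> m < p - 1 + r \<and> p - 1 \<le> Suc m \<and> Suc m < p - 1 + r \<or>
      p + r - 2 \<le> m \<and> m < p + r - 2 + q \<and> p + r - 2 \<le> Suc m \<and> Suc m < p + r - 2 + q)" if "Suc m < n" for m
    proof -
      consider "Suc m < p" | "p \<le> Suc m" "Suc m < p - 1 + r" | "p - 1 + r \<le> Suc m" by linarith
      then show ?thesis using that assms by cases auto
    qed
    assume ?B
    then show ?A
    proof
      assume "j = Suc i \<and> Suc i < n"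
      then show ?A using seg[of i] by blast
    next
      assume "i = Suc j \<and> Suc j < n"
      then show ?A using seg[of j] by blast
    qed
  qed
  ultimately have "(i, j) \<in> parcs (dumbbell_graph p q r) \<longleftrightarrow> (j = Suc i \<and> Suc i < n \<or> i = Suc j \<and> Suc j < n) \<or>
    (i, j) \<in> {(p - 1, 0), (0, p - 1), (p + r - 2, n - 1), (n - 1, p + r - 2)}" by (simp only:)
  then show "(i, j) \<in> parcs (dumbbell_graph p q r) \<longleftrightarrow> (i, j) \<in> {(i, Suc i) | i. Suc i < n} \<union> {(Suc i, i) | i. Suc i < n} \<union>
    {(p - 1, 0), (0, p - 1), (p + r - 2, n - 1), (n - 1, p + r - 2)}" by blast
qed

text \<open>The labels of \<open>dumbbell_graph\<close> follow the same Hamiltonian path, so looking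
  up a label in \<open>L\<close> maps successive labels to path edges and the two closing edges to
  each other.\<close>

lemma dumbbell_edges_image:
  fixes u w :: 'a and xs ys zs :: "'a list"
  assumes "2 \<le> length xs" "2 \<le> length ys"
  defines "L \<equiv> xs @ u # zs @ w # ys"
  shows "dumbbell_edges u w xs ys zs =
    (\<lambda>(i, j). (L ! i, L ! j)) ` parcs (dumbbell_graph (length xs + 1) (length ys + 1) (length zs + 2))"
proof -
  have n: "length xs + 1 + (length ys + 1) + (length zs + 2) - 2 = length L" by (simp add: L_def)
  have ne: "xs \<noteq> []" "ys \<noteq> []" using assms by auto
  have at: "L ! (length xs + 1 - 1) = u" "L ! 0 = hd xs" "L ! (length xs + 1 + (length zs + 2) - 2) = w" "L ! (length L - 1) = last ys"
  proof -
    show "L ! (length xs + 1 - 1) = u" by (simp add: L_def)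
    show "L ! 0 = hd xs" using ne by (simp add: L_def nth_append hd_conv_nth)
    have "L = (xs @ u # zs) @ w # ys" by (simp add: L_def)
    then have "L ! length (xs @ u # zs) = w" by (simp only: nth_append_length)
    then show "L ! (length xs + 1 + (length zs + 2) - 2) = w" by simp
    have "last L = last ys" using ne by (simp add: L_def)
    moreover have "L \<noteq> []" by (simp add: L_def)
    ultimately show "L ! (length L - 1) = last ys" using trans[OF last_conv_nth[symmetric, of L]] by blast
  qed
  have g: "parcs (dumbbell_graph (length xs + 1) (length ys + 1) (length zs + 2)) =
    {(i, Suc i) | i. Suc i < length L} \<union> {(Suc i, i) | i. Suc i < length L} \<union>
    {(length xs + 1 - 1, 0), (0, length xs + 1 - 1), (length xs + 1 + (length zs + 2) - 2, length L - 1), (length L - 1, length xs + 1 + (length zs + 2) - 2)}"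
    using parcs_dumbbell_graph[of "length xs + 1" "length ys + 1" "length zs + 2"] assms(1,2) unfolding n by simp
  have i1: "(\<lambda>(i, j). (L ! i, L ! j)) ` {(i, Suc i) | i. Suc i < length L} = walk_arcs L"
    unfolding walk_arcs_nth by (auto simp: image_iff)
  have i2: "(\<lambda>(i, j). (L ! i, L ! j)) ` {(Suc i, i) | i. Suc i < length L} = (walk_arcs L)\<inverse>"
    unfolding walk_arcs_nth by (auto simp: image_iff)
  show ?thesis
    unfolding g image_Un i1 i2 image_insert image_empty prod.case at
    unfolding dumbbell_edges_walk[OF ne] L_def[symmetric] walk_edges_def by blast
qed

lemma set_nth_image: "set p = (!) p ` {..<length p}"
  by (auto simp: in_set_conv_nth)

lemma dumbbell_iso:
  assumes H: "pair_graph H" and len: "2 \<le> length xs" "2 \<le> length ys"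
    and V: "pverts H = set (xs @ u # zs @ w # ys)" and dist: "distinct (xs @ u # zs @ w # ys)"
    and E: "parcs H = dumbbell_edges u w xs ys zs"
  shows "digraph_iso (with_proj H) (with_proj (dumbbell_graph (length xs + 1) (length ys + 1) (length zs + 2)))"
proof -
  let ?G = "dumbbell_graph (length xs + 1) (length ys + 1) (length zs + 2)"
  let ?L = "xs @ u # zs @ w # ys"
  interpret G: pair_graph ?G by (rule pair_graph_dumbbell_graph) (use len in auto)
  define f where "f = \<lparr> iso_verts = (\<lambda>i. ?L ! i), iso_arcs = (\<lambda>(i, j). (?L ! i, ?L ! j)),
    iso_head = snd, iso_tail = fst \<rparr>"
  have vG: "pverts ?G = {..<length ?L}" using pverts_dumbbell_graph[of "length xs + 1" "length ys + 1" "length zs + 2"] len by simp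
  have inj: "inj_on (\<lambda>i. ?L ! i) (pverts ?G)" unfolding vG using dist by (auto simp: inj_on_nth)
  have sub: "parcs ?G \<subseteq> pverts ?G \<times> pverts ?G" using G.in_arcsD1 G.in_arcsD2 by auto
  have iso: "pre_digraph.digraph_isomorphism (with_proj ?G) f"
    unfolding pre_digraph.digraph_isomorphism_def
  proof (intro conjI ballI)
    show "wf_digraph (with_proj ?G)" by unfold_locales
    show "inj_on (iso_verts f) (verts (with_proj ?G))" using inj by (simp add: f_def)
    show "inj_on (iso_arcs f) (arcs (with_proj ?G))"
    proof (rule inj_onI)
      fix a b assume "a \<in> arcs (with_proj ?G)" "b \<in> arcs (with_proj ?G)" and e: "iso_arcs f a = iso_arcs f b"
      then have "fst a \<in> pverts ?G" "snd a \<in> pverts ?G" "fst b \<in> pverts ?G" "snd b \<in> pverts ?G" using sub by auto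
      moreover have "?L ! fst a = ?L ! fst b" "?L ! snd a = ?L ! snd b" using e by (simp_all add: f_def split_beta)
      ultimately have "fst a = fst b" "snd a = snd b"
        using inj_onD[OF inj, of "fst a" "fst b"] inj_onD[OF inj, of "snd a" "snd b"] by simp_all
      then show "a = b" by (rule prod_eqI)
    qed
  qed (auto simp: f_def)
  have "app_iso f (with_proj ?G) = with_proj H"
  proof (rule pre_digraph.equality)
    show "verts (app_iso f (with_proj ?G)) = verts (with_proj H)"
    proof -
      show ?thesis using vG set_nth_image[of ?L] by (simp only: f_def verts_app_iso with_proj_simps digraph_isomorphism.simps V)
    qed
    show "arcs (app_iso f (with_proj ?G)) = arcs (with_proj H)"
      using dumbbell_edges_image[OF len, of u w zs, symmetric]
      by (simp only: f_def arcs_app_iso with_proj_simps digraph_isomorphism.simps E)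
  qed (simp_all add: f_def)
  then have "digraph_iso (with_proj ?G) (with_proj H)" using iso unfolding digraph_iso_def by metis
  then show ?thesis using digraph_iso_swap[OF G.wf_digraph] by blast
qed

lemma card_neighbours_dumbbell_graph:
  assumes "3 \<le> p" "3 \<le> q" "2 \<le> r" "v < p + q + r - 2"
  shows "card (parcs (dumbbell_graph p q r) `` {v}) = (if v = p - 1 \<or> v = p + r - 2 then 3 else 2)"
proof -
  \<comment> \<open>Writing the parameters as \<open>a + 3\<close>, \<open>b + 3\<close> and
    \<open>c + 2\<close> removes the truncated subtractions.\<close>
  obtain a where a: "p = a + 3" using assms(1) by (metis add.commute le_Suc_ex)
  obtain b where b: "q = b + 3" using assms(2) by (metis add.commute le_Suc_ex)
  obtain c where c: "r = c + 2" using assms(3) by (metis add.commute le_Suc_ex)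
  define n where "n = a + b + c + 6"
  let ?N = "parcs (dumbbell_graph p q r) `` {v}"
  have s: "p + q + r - 2 = n" "p - 1 = a + 2" "p + r - 2 = a + c + 3" "n - 1 = a + b + c + 5"
    by (simp_all add: a b c n_def)
  note P = parcs_dumbbell_graph[OF assms(1-3), unfolded s]
  have v: "v < n" using assms(4) unfolding s .
  have e1: "(v, j) \<in> {(i, Suc i) | i. Suc i < n} \<longleftrightarrow> j = Suc v \<and> Suc v < n" for j by auto
  have e2: "(v, j) \<in> {(Suc i, i) | i. Suc i < n} \<longleftrightarrow> v = Suc j" for j using v by auto
  have N: "j \<in> ?N \<longleftrightarrow> (j = Suc v \<and> Suc v < n \<or> v = Suc j) \<or> v = a + 2 \<and> j = 0 \<or> v = 0 \<and> j = a + 2 \<or>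
      v = a + c + 3 \<and> j = a + b + c + 5 \<or> v = a + b + c + 5 \<and> j = a + c + 3" for j
    unfolding P Image_singleton_iff Un_iff e1 e2 insert_iff empty_iff prod.inject by (simp only: simp_thms)
  consider "v = 0" | "v = a + 2" | "v = a + c + 3" | "v = a + b + c + 5"
    | m where "v = Suc m" "v \<noteq> a + 2" "v \<noteq> a + c + 3" "v \<noteq> a + b + c + 5" by (cases v) auto
  then have "card ?N = (if v = a + 2 \<or> v = a + c + 3 then 3 else 2)"
  proof cases
    case 1
    have "?N = {1, a + 2}" by (rule set_eqI) (simp only: N, use 1 in \<open>auto simp: n_def\<close>)
    then show ?thesis using 1 by simp
  next
    case 2
    have "?N = {a + 1, a + 3, 0}" by (rule set_eqI) (simp only: N, use 2 in \<open>auto simp: n_def\<close>)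
    then show ?thesis using 2 by simp
  next
    case 3
    have "?N = {a + c + 2, a + c + 4, a + b + c + 5}" by (rule set_eqI) (simp only: N, use 3 in \<open>auto simp: n_def\<close>)
    then show ?thesis using 3 by simp
  next
    case 4
    have "?N = {a + b + c + 4, a + c + 3}" by (rule set_eqI) (simp only: N, use 4 in \<open>auto simp: n_def\<close>)
    then show ?thesis using 4 by simp
  next
    case 5
    have "Suc v < n" using v 5(4) by (simp add: n_def)
    then have "?N = {m, Suc (Suc m)}" by (intro set_eqI) (simp only: N, use 5 in auto)
    then show ?thesis using 5 by simp
  qed
  then show ?thesis unfolding s .
qed

lemma theta_poly_swap:
  "theta_poly b a c = theta_poly a b c" "theta_poly a c b = theta_poly a b c"
  by (simp_all add: theta_poly_def ac_simps)

lemma theta_poly_neq_dumbbell_unordered: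
  assumes E: "dumbbell_poly p q r = theta_poly a b c * prod_list (map cycle_poly ks)"
    and pq: "3 \<le> p" "3 \<le> q" "2 \<le> r" and ks: "\<forall>k\<in>set ks. 3 \<le> k"
    and abc: "1 \<le> a" "2 \<le> b" "2 \<le> c" and size: "p + q + r = a + b + c + 1 + sum_list ks"
  shows False
proof -
  have *: False if "theta_poly l1 l2 l3 = theta_poly a b c" "l1 + l2 + l3 = a + b + c" "l1 \<le> l2" "l2 \<le> l3" "1 \<le> l1" "2 \<le> l2" for l1 l2 l3
    using theta_poly_neq_dumbbell[of p q r l1 l2 l3 ks] E pq ks size that by simp
  consider "a \<le> b" "b \<le> c" | "a \<le> c" "c \<le> b" | "b \<le> a" "a \<le> c" | "b \<le> c" "c \<le> a" | "c \<le> a" "a \<le> b" | "c \<le> b" "b \<le> a"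
    by linarith
  then show False
  proof cases
    case 1 then show False using *[of a b c] abc by simp
  next
    case 2 then show False using *[of a c b] theta_poly_swap(2)[of a c b] abc by simp
  next
    case 3 then show False using *[of b a c] theta_poly_swap(1)[of b a c] abc by simp
  next
    case 4 then show False using *[of b c a] theta_poly_swap(2)[of b c a] theta_poly_swap(1)[of b a c] abc by simp
  next
    case 5 then show False using *[of c a b] theta_poly_swap(1)[of c a b] theta_poly_swap(2)[of a c b] abc by simp
  next
    case 6 then show False
      using *[of c b a] theta_poly_swap(1)[of c b a] theta_poly_swap(2)[of b c a] theta_poly_swap(1)[of b a c] abc by simp
  qed
qed

lemma upt_split:
  assumes "i \<le> j" "j \<le> k"
  shows "[i..<k] = [i..<j] @ [j..<k]"
  using upt_add_eq_append[OF assms(1), of "k - j"] assms(2) by simp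

lemma dumbbell_graph_eval:
  assumes pqr: "3 \<le> p" "3 \<le> q" "2 \<le> r" and x: "0 < x"
  shows "x ^ (p + q + r - 2) * (1 + x\<^sup>2) ^ 3 * reval (laplacian_permanental_poly (dumbbell_graph p q r)) (1 / x - x + 2) =
    reval (dumbbell_poly p q r) x"
proof -
  let ?G = "dumbbell_graph p q r"
  define n where "n = p + q + r - 2"
  define u w xs ys zs where defs: "u = p - 1" "w = p + r - 2" "xs = [0..<p - 1]" "ys = [p + r - 1..<n]" "zs = [p..<p + r - 2]"
  have G: "pair_graph ?G" by (rule pair_graph_dumbbell_graph[OF pqr])
  interpret pair_graph ?G by fact
  have V: "pverts ?G = {..<n}" unfolding n_def by (rule pverts_dumbbell_graph[OF pqr])
  have len: "length xs + 1 = p" "length ys + 1 = q" "length zs + 2 = r" using pqr by (simp_all add: defs n_def)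
  have len2: "2 \<le> length xs" "2 \<le> length ys" using pqr len by auto
  have "w # ys = [p + r - 2..<n]"
  proof -
    have "Suc (p + r - 2) = p + r - 1" "p + r - 2 < n" using pqr by (auto simp: n_def)
    then show ?thesis using upt_conv_Cons[of "p + r - 2" n] unfolding defs by (simp only: simp_thms)
  qed
  moreover have "u # zs = [p - 1..<p + r - 2]"
    using upt_conv_Cons[of "p - 1" "p + r - 2"] pqr by (simp add: defs)
  moreover have nn: "0 \<le> p - 1" "p - 1 \<le> n" "p - 1 \<le> p + r - 2" "p + r - 2 \<le> n" using pqr by (auto simp: n_def)
  moreover have "[0..<n] = [0..<p - 1] @ [p - 1..<p + r - 2] @ [p + r - 2..<n]"
    using upt_split[of 0 "p - 1" n] upt_split[of "p - 1" "p + r - 2" n] nn by (simp only: simp_thms)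
  ultimately have L: "xs @ u # zs @ w # ys = [0..<n]" by (simp add: defs(3))
  have sub: "parcs ?G \<subseteq> {..<n} \<times> {..<n}" using in_arcsD1 in_arcsD2 V by auto
  have E: "parcs ?G = dumbbell_edges u w xs ys zs"
  proof -
    have "dumbbell_edges u w xs ys zs = (\<lambda>(i, j). ([0..<n] ! i, [0..<n] ! j)) ` parcs ?G"
      using dumbbell_edges_image[OF len2, of u w zs] unfolding L len .
    also have "\<dots> = (\<lambda>e. e) ` parcs ?G" using sub by (intro image_cong) auto
    finally show ?thesis by simp
  qed
  have dist: "distinct (u # w # xs @ ys @ zs)"
  proof -
    have "distinct (xs @ u # zs @ w # ys)" unfolding L by simp
    then show ?thesis by auto
  qed
  have C: "{u, w} \<union> set zs \<union> set xs \<union> set ys = {..<n}"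
  proof -
    have "set (xs @ u # zs @ w # ys) = {..<n}" unfolding L by auto
    then show ?thesis by auto
  qed
  have deg: "out_degree (with_proj ?G) v = (if v = u \<or> v = w then 3 else 2)" if "v < n" for v
    unfolding out_degree_Image defs using card_neighbours_dumbbell_graph[OF pqr, of v] that by (simp add: n_def)
  have un: "u < n" "w < n" using pqr by (auto simp: defs n_def)
  have size: "length xs + length ys + length zs + 2 = n" using len pqr by (simp add: n_def)
  have ev: "\<forall>x>0. x ^ card {..<n} * (1 + x\<^sup>2) ^ 3 *
    permanent {..<n} (adj_matrix (parcs ?G) (\<lambda>v. 1 / x - x + 2 - real (out_degree (with_proj ?G) v))) = reval (dumbbell_poly p q r) x"
  proof (intro allI impI)
    fix x :: real assume x: "0 < x"
    have d: "\<forall>v\<in>set (xs @ ys @ zs). 1 / x - x + 2 - real (out_degree (with_proj ?G) v) = 1 / x - x"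
    proof
      fix v assume v: "v \<in> set (xs @ ys @ zs)"
      then have "v < n" using C by auto
      moreover have "v \<noteq> u" "v \<noteq> w" using v dist by auto
      ultimately show "1 / x - x + 2 - real (out_degree (with_proj ?G) v) = 1 / x - x" by (simp add: deg)
    qed
    show "x ^ card {..<n} * (1 + x\<^sup>2) ^ 3 *
      permanent {..<n} (adj_matrix (parcs ?G) (\<lambda>v. 1 / x - x + 2 - real (out_degree (with_proj ?G) v))) = reval (dumbbell_poly p q r) x"
      using dumbbell_eval[OF dist len2 x _ _ d] deg[OF un(1)] deg[OF un(2)]
      unfolding size len C E dumbbell_edges_def by simp
  qed
  obtain ks where ks: "\<forall>k\<in>set ks. 3 \<le> k" "card (pverts ?G) = card {..<n} + sum_list ks"
    "\<And>x. 0 < x \<Longrightarrow> x ^ card (pverts ?G) * (1 + x\<^sup>2) ^ 3 * reval (laplacian_permanental_poly ?G) (1 / x - x + 2) =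
      reval (dumbbell_poly p q r * prod_list (map cycle_poly ks)) x"
    by (rule core_eval[OF G, of "{..<n}" "parcs ?G" "dumbbell_poly p q r"]) (use V sub ev in auto)
  \<comment> \<open>The core is the whole graph, so the lengths in \<open>ks\<close>, each at least
    3, have sum 0.\<close>
  have "ks = []" using ks(1,2) unfolding V by (cases ks) auto
  then show ?thesis using ks(3)[OF x] unfolding V by (simp add: n_def)
qed

section \<open>From the polynomial back to the graph\<close>

text \<open>The product \<open>(h - 2) * (h - 3)\<close> is nonnegative for every integer
  \<open>h\<close>, and its sum over all vertices is fixed by the known sums as
  \<open>(4 n + 10) - 5 (2 n + 2) + 6 n = 0\<close>. So all degrees are 2 or 3, and the degree sum
  leaves exactly two vertices of degree 3.\<close>

lemma degrees_of_dumbbell_mate: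
  assumes pqr: "3 \<le> p" "3 \<le> q" "2 \<le> r" and H: "pair_graph H"
    and eq: "laplacian_permanental_poly H = laplacian_permanental_poly (dumbbell_graph p q r)"
  obtains u w where "card (pverts H) = p + q + r - 2" "u \<in> pverts H" "w \<in> pverts H" "u \<noteq> w"
    "out_degree (with_proj H) u = 3" "out_degree (with_proj H) w = 3"
    "\<forall>v\<in>pverts H - {u, w}. out_degree (with_proj H) v = 2"
proof -
  let ?G = "dumbbell_graph p q r"
  define n where "n = p + q + r - 2"
  define T where "T = {p - 1, p + r - 2}"
  define h where "h = (\<lambda>v. int (out_degree (with_proj H) v))"
  interpret H: pair_graph H by fact
  have V: "pverts ?G = {..<n}" unfolding n_def by (rule pverts_dumbbell_graph[OF pqr])
  have T: "{..<n} \<inter> T = T" "card T = 2" using pqr by (auto simp: T_def n_def)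
  have g: "int (out_degree (with_proj ?G) v) = 2 + (if v \<in> T then 1 else 0)" if "v < n" for v
    unfolding out_degree_Image T_def using card_neighbours_dumbbell_graph[OF pqr, of v] that by (simp add: n_def)
  note s = degree_sums_eq[OF H pair_graph_dumbbell_graph[OF pqr] eq, folded h_def]
  have card: "card (pverts H) = n" using s(1) V by simp
  have "sum h (pverts H) = (\<Sum>v<n. 2 + (if v \<in> T then 1 else 0))"
    unfolding s(2) V using g by (intro sum.cong) auto
  also have "\<dots> = 2 * int n + 2" using T by (simp add: sum.distrib sum.If_cases)
  finally have s1: "sum h (pverts H) = 2 * int n + 2" .
  have "(\<Sum>v\<in>pverts H. (h v)\<^sup>2) = (\<Sum>v\<in>pverts ?G. (int (out_degree (with_proj ?G) v))\<^sup>2)"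
    unfolding h_def by (rule degree_sums_eq(3)[OF H pair_graph_dumbbell_graph[OF pqr] eq])
  also have "\<dots> = (\<Sum>v<n. 4 + (if v \<in> T then 5 else 0))"
    unfolding V using g by (intro sum.cong) auto
  also have "\<dots> = 4 * int n + 10" using T by (simp add: sum.distrib sum.If_cases)
  finally have s2: "(\<Sum>v\<in>pverts H. (h v)\<^sup>2) = 4 * int n + 10" .
  have e: "(h v - 2) * (h v - 3) = (h v)\<^sup>2 - 5 * h v + 6" for v by (simp add: power2_eq_square algebra_simps)
  have "(\<Sum>v\<in>pverts H. (h v - 2) * (h v - 3)) = (\<Sum>v\<in>pverts H. (h v)\<^sup>2) - 5 * sum h (pverts H) + 6 * int n"
    unfolding e by (simp add: sum.distrib sum_subtractf sum_distrib_left card)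
  then have z: "(\<Sum>v\<in>pverts H. (h v - 2) * (h v - 3)) = 0" unfolding s1 s2 by simp
  have nonneg: "0 \<le> (a - 2) * (a - 3)" for a :: int
  proof (cases "a \<le> 2")
    case True
    then show ?thesis by (intro mult_nonpos_nonpos) auto
  next
    case False
    then show ?thesis by (intro mult_nonneg_nonneg) auto
  qed
  have h23: "h v = 2 \<or> h v = 3" if v: "v \<in> pverts H" for v
  proof -
    have "(h v - 2) * (h v - 3) = 0" by (rule sum_nonneg_0[OF H.pair_finite_verts _ z v]) (rule nonneg)
    then show ?thesis by auto
  qed
  have "sum h (pverts H) = (\<Sum>v\<in>pverts H. 2 + (if h v = 3 then 1 else 0))"
    using h23 by (intro sum.cong) auto
  also have "\<dots> = 2 * int n + int (card {v \<in> pverts H. h v = 3})"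
    using H.pair_finite_verts card by (simp add: sum.distrib sum.If_cases Int_def)
  finally have "card {v \<in> pverts H. h v = 3} = 2" using s1 by simp
  then obtain u w where uw: "{v \<in> pverts H. h v = 3} = {u, w}" "u \<noteq> w" by (auto simp: card_2_iff)
  then have m: "v \<in> pverts H \<and> h v = 3 \<longleftrightarrow> v = u \<or> v = w" for v by blast
  show thesis
  proof (rule that)
    show "card (pverts H) = p + q + r - 2" using card by (simp add: n_def)
    show "u \<in> pverts H" "w \<in> pverts H" using m by auto
    show "out_degree (with_proj H) u = 3" "out_degree (with_proj H) w = 3" using m[of u] m[of w] by (auto simp: h_def)
    show "\<forall>v\<in>pverts H - {u, w}. out_degree (with_proj H) v = 2" using m h23 by (fastforce simp: h_def)
  qed fact
qed

theorem theorem1p1: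
  fixes p q r :: nat and H :: "'a pair_pre_digraph"
  assumes "p \<ge> 3" and "q \<ge> 3" and "r \<ge> 2"
    and "pair_graph H"
    and "laplacian_permanental_poly H = laplacian_permanental_poly (dumbbell_graph p q r)"
  shows "digraph_iso (with_proj H) (with_proj (dumbbell_graph p q r))"
proof -
  note pqr = assms(1-3)
  interpret H: pair_graph H by fact
  obtain u w where card: "card (pverts H) = p + q + r - 2" and uw: "u \<in> pverts H" "w \<in> pverts H" "u \<noteq> w"
    and d3: "out_degree (with_proj H) u = 3" "out_degree (with_proj H) w = 3"
    and d2: "\<forall>v\<in>pverts H - {u, w}. out_degree (with_proj H) v = 2"
    by (rule degrees_of_dumbbell_mate[OF pqr assms(4,5)])
  have irr: "\<forall>v. (v, v) \<notin> parcs H" and clo: "\<forall>v\<in>pverts H. parcs H `` {v} \<subseteq> pverts H"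
    using H.parcs_Image by blast+
  \<comment> \<open>For every \<open>x > 0\<close> both sides are the same multiple of the common
    Laplacian polynomial evaluated at \<open>1 / x - x + 2\<close>; agreement at all these points
    makes the polynomials equal.\<close>
  have poly: "dumbbell_poly p q r = Q * prod_list (map cycle_poly ks)"
    if "\<And>x. 0 < x \<Longrightarrow> x ^ card (pverts H) * (1 + x\<^sup>2) ^ 3 * reval (laplacian_permanental_poly H) (1 / x - x + 2) =
      reval (Q * prod_list (map cycle_poly ks)) x" for Q ks
  proof (rule reval_eqI)
    fix x :: real assume x: "0 < x"
    show "reval (dumbbell_poly p q r) x = reval (Q * prod_list (map cycle_poly ks)) x"
      using dumbbell_graph_eval[OF pqr x] that[OF x] unfolding card assms(5) by (simp only:)
  qed
  have u3: "card (parcs H `` {u}) = 3" "card (parcs H `` {w}) = 3" "\<forall>v\<in>pverts H - {u, w}. card (parcs H `` {v}) = 2"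
    using d3 d2 by (simp_all add: out_degree_Image)
  have dval: "\<forall>v\<in>set ps. 1 / x - x + 2 - real (out_degree (with_proj H) v) = 1 / x - x"
    if "set ps \<subseteq> pverts H" "u \<notin> set ps" "w \<notin> set ps" for ps and x :: real
    using d2 that by auto
  show ?thesis
  proof (rule cubic_structure[OF H.pair_finite_verts H.sym_parcs irr clo uw u3])
    fix xs ys zs
    assume dist: "distinct (u # w # xs @ ys @ zs)" and sub: "set (xs @ ys @ zs) \<subseteq> pverts H"
      and len: "2 \<le> length xs" "2 \<le> length ys"
      and W: "\<forall>v\<in>{u, w} \<union> set zs \<union> set xs \<union> set ys. \<forall>z. (v, z) \<in> parcs H \<longleftrightarrow>
        (v, z) \<in> walk_edges (u # zs @ [w]) \<union> walk_edges (u # xs @ [u]) \<union> walk_edges (w # ys @ [w])"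
    define C where "C = {u, w} \<union> set zs \<union> set xs \<union> set ys"
    define D where "D = dumbbell_edges u w xs ys zs"
    have W: "\<forall>v\<in>C. \<forall>z. (v, z) \<in> parcs H \<longleftrightarrow> (v, z) \<in> D" using W unfolding C_def D_def dumbbell_edges_def .
    have CV: "C \<subseteq> pverts H" using sub uw by (auto simp: C_def)
    have DC: "D \<subseteq> C \<times> C"
      using walk_edges_subset[of u zs w] walk_edges_subset[of u xs u] walk_edges_subset[of w ys w]
      unfolding D_def C_def dumbbell_edges_def by blast
    have "C = set (u # w # xs @ ys @ zs)" by (auto simp: C_def)
    then have cC: "card C = length xs + length ys + length zs + 2" using distinct_card[OF dist] by simp
    have nt: "u \<notin> set (xs @ ys @ zs)" "w \<notin> set (xs @ ys @ zs)" using dist by auto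
    have ev: "\<forall>x>0. x ^ card C * (1 + x\<^sup>2) ^ 3 *
        permanent C (adj_matrix D (\<lambda>v. 1 / x - x + 2 - real (out_degree (with_proj H) v))) =
        reval (dumbbell_poly (length xs + 1) (length ys + 1) (length zs + 2)) x"
    proof (intro allI impI)
      fix x :: real assume x: "0 < x"
      have "1 / x - x + 2 - real (out_degree (with_proj H) u) = 1 / x - x - 1"
        "1 / x - x + 2 - real (out_degree (with_proj H) w) = 1 / x - x - 1" by (simp_all add: d3)
      from dumbbell_eval[where d = "\<lambda>v. 1 / x - x + 2 - real (out_degree (with_proj H) v)", OF dist len x this dval[OF sub nt]]
      show "x ^ card C * (1 + x\<^sup>2) ^ 3 *
          permanent C (adj_matrix D (\<lambda>v. 1 / x - x + 2 - real (out_degree (with_proj H) v))) =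
          reval (dumbbell_poly (length xs + 1) (length ys + 1) (length zs + 2)) x"
        unfolding cC unfolding C_def D_def dumbbell_edges_def .
    qed
    have d2': "\<forall>v\<in>pverts H - C. out_degree (with_proj H) v = 2" using d2 by (simp add: C_def)
    obtain ks where ks: "\<forall>k\<in>set ks. 3 \<le> k" "card (pverts H) = card C + sum_list ks"
      and E: "dumbbell_poly p q r = dumbbell_poly (length xs + 1) (length ys + 1) (length zs + 2) * prod_list (map cycle_poly ks)"
    proof (rule core_eval[OF assms(4) CV DC W d2' ev])
      fix ks
      assume a: "\<forall>k\<in>set ks. 3 \<le> k" and b: "card (pverts H) = card C + sum_list ks"
        and c: "\<And>x. 0 < x \<Longrightarrow> x ^ card (pverts H) * (1 + x\<^sup>2) ^ 3 * reval (laplacian_permanental_poly H) (1 / x - x + 2) =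
          reval (dumbbell_poly (length xs + 1) (length ys + 1) (length zs + 2) * prod_list (map cycle_poly ks)) x"
      show thesis by (rule that[OF a b], rule poly, erule c)
    qed
    have u: "ks = [] \<and> r = length zs + 2 \<and> {p, q} = {length xs + 1, length ys + 1} \<and>
        (p = length xs + 1 \<and> q = length ys + 1 \<or> p = length ys + 1 \<and> q = length xs + 1)"
      by (rule dumbbell_poly_unique[OF E]) (use pqr len ks card cC in auto)
    \<comment> \<open>No additional cycle is left, so the core is all of \<open>H\<close>.\<close>
    then have "card C = card (pverts H)" using ks(2) by simp
    then have V: "pverts H = C" using card_subset_eq[OF H.pair_finite_verts CV] by simp
    have arcs: "parcs H = D"
    proof (rule set_eqI, clarify)
      fix a b
      show "(a, b) \<in> parcs H \<longleftrightarrow> (a, b) \<in> D"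
      proof
        assume h: "(a, b) \<in> parcs H"
        then have "a \<in> C" using H.in_arcsD1[OF h] V by simp
        then show "(a, b) \<in> D" using W h by blast
      next
        assume h: "(a, b) \<in> D"
        then have "a \<in> C" using DC by blast
        then show "(a, b) \<in> parcs H" using W h by blast
      qed
    qed
    from u consider "p = length xs + 1" "q = length ys + 1" "r = length zs + 2"
      | "p = length ys + 1" "q = length xs + 1" "r = length zs + 2" by blast
    then show ?thesis
    proof cases
      case 1
      have "digraph_iso (with_proj H) (with_proj (dumbbell_graph (length xs + 1) (length ys + 1) (length zs + 2)))"
      proof (rule dumbbell_iso[OF assms(4) len])
        show "pverts H = set (xs @ u # zs @ w # ys)" unfolding V C_def by auto
        show "distinct (xs @ u # zs @ w # ys)" using dist by auto
        show "parcs H = dumbbell_edges u w xs ys zs" unfolding arcs D_def ..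
      qed
      then show ?thesis unfolding 1 .
    next
      \<comment> \<open>The two cycles match in exchanged order: the core is read from
        \<open>w\<close> to \<open>u\<close>, which reverses the connecting path.\<close>
      case 2
      have "digraph_iso (with_proj H) (with_proj (dumbbell_graph (length ys + 1) (length xs + 1) (length (rev zs) + 2)))"
      proof (rule dumbbell_iso[OF assms(4) len(2,1)])
        show "pverts H = set (ys @ w # rev zs @ u # xs)" unfolding V C_def by auto
        show "distinct (ys @ w # rev zs @ u # xs)" using dist by auto
        show "parcs H = dumbbell_edges w u ys xs (rev zs)" unfolding arcs D_def dumbbell_edges_swap ..
      qed
      then show ?thesis unfolding 2 by simp
    qed
  next
    fix xs ys zs
    assume dist: "distinct (u # w # xs @ ys @ zs)" and sub: "set (xs @ ys @ zs) \<subseteq> pverts H"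
      and ne: "ys \<noteq> []" "zs \<noteq> []"
      and W: "\<forall>v\<in>{u, w} \<union> set xs \<union> set ys \<union> set zs. \<forall>z. (v, z) \<in> parcs H \<longleftrightarrow>
        (v, z) \<in> walk_edges (u # xs @ [w]) \<union> walk_edges (u # ys @ [w]) \<union> walk_edges (u # zs @ [w])"
    define C where "C = {u, w} \<union> set xs \<union> set ys \<union> set zs"
    define D where "D = walk_edges (u # xs @ [w]) \<union> walk_edges (u # ys @ [w]) \<union> walk_edges (u # zs @ [w])"
    have W: "\<forall>v\<in>C. \<forall>z. (v, z) \<in> parcs H \<longleftrightarrow> (v, z) \<in> D" using W unfolding C_def D_def .
    have CV: "C \<subseteq> pverts H" using sub uw by (auto simp: C_def)
    have DC: "D \<subseteq> C \<times> C"
      using walk_edges_subset[of u xs w] walk_edges_subset[of u ys w] walk_edges_subset[of u zs w]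
      unfolding D_def C_def by blast
    have "C = set (u # w # xs @ ys @ zs)" by (auto simp: C_def)
    then have cC: "card C = length xs + length ys + length zs + 2" using distinct_card[OF dist] by simp
    have nt: "u \<notin> set (xs @ ys @ zs)" "w \<notin> set (xs @ ys @ zs)" using dist by auto
    have ev: "\<forall>x>0. x ^ card C * (1 + x\<^sup>2) ^ 3 *
        permanent C (adj_matrix D (\<lambda>v. 1 / x - x + 2 - real (out_degree (with_proj H) v))) =
        reval (theta_poly (length xs + 1) (length ys + 1) (length zs + 1)) x"
    proof (intro allI impI)
      fix x :: real assume x: "0 < x"
      have "1 / x - x + 2 - real (out_degree (with_proj H) u) = 1 / x - x - 1"
        "1 / x - x + 2 - real (out_degree (with_proj H) w) = 1 / x - x - 1" by (simp_all add: d3)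
      from theta_eval[where d = "\<lambda>v. 1 / x - x + 2 - real (out_degree (with_proj H) v)", OF dist ne x this dval[OF sub nt]]
      show "x ^ card C * (1 + x\<^sup>2) ^ 3 *
          permanent C (adj_matrix D (\<lambda>v. 1 / x - x + 2 - real (out_degree (with_proj H) v))) =
          reval (theta_poly (length xs + 1) (length ys + 1) (length zs + 1)) x"
        unfolding cC unfolding C_def D_def .
    qed
    have d2': "\<forall>v\<in>pverts H - C. out_degree (with_proj H) v = 2" using d2 by (simp add: C_def)
    obtain ks where ks: "\<forall>k\<in>set ks. 3 \<le> k" "card (pverts H) = card C + sum_list ks"
      and E: "dumbbell_poly p q r = theta_poly (length xs + 1) (length ys + 1) (length zs + 1) * prod_list (map cycle_poly ks)"
    proof (rule core_eval[OF assms(4) CV DC W d2' ev])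
      fix ks
      assume a: "\<forall>k\<in>set ks. 3 \<le> k" and b: "card (pverts H) = card C + sum_list ks"
        and c: "\<And>x. 0 < x \<Longrightarrow> x ^ card (pverts H) * (1 + x\<^sup>2) ^ 3 * reval (laplacian_permanental_poly H) (1 / x - x + 2) =
          reval (theta_poly (length xs + 1) (length ys + 1) (length zs + 1) * prod_list (map cycle_poly ks)) x"
      show thesis by (rule that[OF a b], rule poly, erule c)
    qed
    have "1 \<le> length ys" "1 \<le> length zs" using ne by (simp_all add: Suc_le_eq)
    then have False
      by (intro theta_poly_neq_dumbbell_unordered[OF E pqr ks(1)]) (use ks(2) card cC pqr in auto)
    then show ?thesis ..
  qed
qed

end
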